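(* Let $L$ be a holomorphic line bundle over $X=\mathbb{C}$, let $\varphi\in A^0(L)$ be a section of $L$ that is not identically zero, and let $\lambda\in C^\infty(\mathbb{C})$ be real-valued. Let $K$ be a Hermitian structure on $L$ and let $k,l$ be two constants such that $l>0$, $k\in[l-2,l-1)$ and $$\int_{\mathbb{C}}(2\sqrt{-1}F_K-\lambda\omega_{k})<0,\qquad \left|\sqrt{-1}\Lambda_{\omega_{k}}F_K-\tfrac{\lambda}{2}\right|+|\varphi|^2\leq\Lambda(1+|z|^2)^{-l}$$ for a constant $\Lambda$, where $\omega_k=\frac{\sqrt{-1}}{2}(1+|z|^2)^{k}dz\wedge d\bar z$ and $|\varphi|^2=|\varphi|_K^2$. Then the curvature equation $$\sqrt{-1}F_H+\frac12\varphi\otimes\varphi^{\ast H}\omega_{k}=\frac{\lambda}{2}\omega_{k}$$ admits a solution, i.e. there is a Hermitian structure $H$ on $L$ satisfying it on $\mathbb{C}$.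
   Context: $\Lambda_{\omega_k}$ is the adjoint of wedging with $\omega_k$ (so $\Lambda_{\omega_k}(\rho\,\omega_k)=\rho$ for a function $\rho$). $A^0(L)$ is the space of smooth sections of $L$. $F_H$ denotes the curvature of the Chern connection of the Hermitian structure $H$ on $L$; if $H=e^fK$ then $F_H=F_K-\partial\bar\partial f$. $\varphi^{\ast H}$ is the dual of $\varphi$ with respect to $H$, so that $\varphi\otimes\varphi^{\ast H}\in\mathrm{End}(L)$ is identified with the function $|\varphi|_H^2$. *)

theory Defs
  imports "HOL-Analysis.Analysis"
begin

section \<open>Smooth functions and Wirtinger derivatives on the complex plane\<close>

text \<open>
  \<open>C_on n U f\<close>: \<open>f\<close> is \<open>n\<close> times continuously differentiable, in the real sense, on the open set
  \<open>U\<close>. The directions \<open>1\<close> and \<open>\<i>\<close> are those of the real coordinates \<open>x\<close> and \<open>y\<close>.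
\<close>

primrec C_on :: "nat \<Rightarrow> complex set \<Rightarrow> (complex \<Rightarrow> 'b::real_normed_vector) \<Rightarrow> bool" where
  "C_on 0 U f \<longleftrightarrow> continuous_on U f"
| "C_on (Suc n) U f \<longleftrightarrow>
     (\<forall>z\<in>U. f differentiable (at z)) \<and>
     C_on n U (\<lambda>z. frechet_derivative f (at z) 1) \<and>
     C_on n U (\<lambda>z. frechet_derivative f (at z) \<i>)"

definition smooth_on :: "complex set \<Rightarrow> (complex \<Rightarrow> 'b::real_normed_vector) \<Rightarrow> bool" where
  "smooth_on U f \<longleftrightarrow> (\<forall>n. C_on n U f)"

definition d_z :: "(complex \<Rightarrow> complex) \<Rightarrow> complex \<Rightarrow> complex" where
  "d_z f z = (frechet_derivative f (at z) 1 - \<i> * frechet_derivative f (at z) \<i>) / 2"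

definition d_zbar :: "(complex \<Rightarrow> complex) \<Rightarrow> complex \<Rightarrow> complex" where
  "d_zbar f z = (frechet_derivative f (at z) 1 + \<i> * frechet_derivative f (at z) \<i>) / 2"


section \<open>Holomorphic line bundles over the complex plane\<close>

text \<open>
  The total space is the carrier \<open>total L\<close>. A chart \<open>(U, \<psi>)\<close> is a local trivialization over \<open>U\<close>,
  of which \<open>\<psi>\<close> is the component with values in the typical fibre \<open>\<complex>\<close>.
\<close>

record 'e line_bundle =
  total :: "'e set"
  proj :: "'e \<Rightarrow> complex"
  vzero :: "complex \<Rightarrow> 'e"
  vadd :: "'e \<Rightarrow> 'e \<Rightarrow> 'e"
  vscale :: "complex \<Rightarrow> 'e \<Rightarrow> 'e"
  charts :: "(complex set \<times> ('e \<Rightarrow> complex)) set"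

definition fibre :: "'e line_bundle \<Rightarrow> complex \<Rightarrow> 'e set" where
  "fibre L z = {e \<in> total L. proj L e = z}"

text \<open>
  The vector space axioms in the fibres follow from closure and the third clause, which makes every
  chart a linear isomorphism from the fibre onto \<open>\<complex>\<close>. The topology and the complex structure of the
  total space are the ones induced by the charts, the transition functions being holomorphic.
\<close>

definition holomorphic_line_bundle :: "'e line_bundle \<Rightarrow> bool" where
  "holomorphic_line_bundle L \<longleftrightarrow>
     (\<forall>z. vzero L z \<in> fibre L z \<and>
          (\<forall>e\<in>fibre L z. \<forall>e'\<in>fibre L z. vadd L e e' \<in> fibre L z) \<and>
          (\<forall>c. \<forall>e\<in>fibre L z. vscale L c e \<in> fibre L z)) \<and>
     (\<forall>(U, \<psi>)\<in>charts L. open U) \<and>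
     (\<forall>(U, \<psi>)\<in>charts L. \<forall>z\<in>U.
          bij_betw \<psi> (fibre L z) UNIV \<and>
          \<psi> (vzero L z) = 0 \<and>
          (\<forall>e\<in>fibre L z. \<forall>e'\<in>fibre L z. \<psi> (vadd L e e') = \<psi> e + \<psi> e') \<and>
          (\<forall>c. \<forall>e\<in>fibre L z. \<psi> (vscale L c e) = c * \<psi> e)) \<and>
     (\<Union>(U, \<psi>)\<in>charts L. U) = UNIV \<and>
     (\<forall>(U, \<psi>)\<in>charts L. \<forall>(V, \<psi>')\<in>charts L. \<exists>g. g holomorphic_on (U \<inter> V) \<and>
          (\<forall>z\<in>U \<inter> V. g z \<noteq> 0 \<and> (\<forall>e\<in>fibre L z. \<psi>' e = g z * \<psi> e)))"

definition smooth_section :: "'e line_bundle \<Rightarrow> complex set \<Rightarrow> (complex \<Rightarrow> 'e) \<Rightarrow> bool" where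
  "smooth_section L V s \<longleftrightarrow>
     open V \<and> (\<forall>z\<in>V. s z \<in> fibre L z) \<and>
     (\<forall>(U, \<psi>)\<in>charts L. smooth_on (U \<inter> V) (\<lambda>z. \<psi> (s z)))"

text \<open>\<open>H e e'\<close> only matters for \<open>e\<close>, \<open>e'\<close> in a common fibre; it is linear in the first argument.\<close>

definition hermitian_structure :: "'e line_bundle \<Rightarrow> ('e \<Rightarrow> 'e \<Rightarrow> complex) \<Rightarrow> bool" where
  "hermitian_structure L H \<longleftrightarrow>
     (\<forall>z. \<forall>u\<in>fibre L z. \<forall>v\<in>fibre L z.
        H v u = cnj (H u v) \<and>
        (\<forall>c. H (vscale L c u) v = c * H u v) \<and>
        (\<forall>w\<in>fibre L z. H (vadd L u w) v = H u v + H w v) \<and>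
        (u \<noteq> vzero L z \<longrightarrow> Re (H u u) > 0)) \<and>
     (\<forall>V s t. smooth_section L V s \<longrightarrow> smooth_section L V t \<longrightarrow> smooth_on V (\<lambda>z. H (s z) (t z)))"

definition norm_sq :: "('e \<Rightarrow> 'e \<Rightarrow> complex) \<Rightarrow> (complex \<Rightarrow> 'e) \<Rightarrow> complex \<Rightarrow> real" where
  "norm_sq H s z = Re (H (s z) (s z))"


section \<open>The Chern connection and its curvature\<close>

text \<open>
  A connection \<open>\<nabla>\<close> is given by its components: \<open>\<nabla> s = D1 s \<otimes> dz + D2 s \<otimes> dzbar\<close>, for smooth
  sections \<open>s\<close> over arbitrary open sets.
\<close>

definition connection ::
    "'e line_bundle \<Rightarrow> ((complex \<Rightarrow> 'e) \<Rightarrow> complex \<Rightarrow> 'e) \<Rightarrow> ((complex \<Rightarrow> 'e) \<Rightarrow> complex \<Rightarrow> 'e) \<Rightarrow> bool" where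
  "connection L D1 D2 \<longleftrightarrow>
     (\<forall>V s. smooth_section L V s \<longrightarrow>
        smooth_section L V (D1 s) \<and> smooth_section L V (D2 s) \<and>
        (\<forall>t. smooth_section L V t \<longrightarrow> (\<forall>z\<in>V.
           D1 (\<lambda>w. vadd L (s w) (t w)) z = vadd L (D1 s z) (D1 t z) \<and>
           D2 (\<lambda>w. vadd L (s w) (t w)) z = vadd L (D2 s z) (D2 t z))) \<and>
        (\<forall>f. smooth_on V f \<longrightarrow> (\<forall>z\<in>V.
           D1 (\<lambda>w. vscale L (f w) (s w)) z = vadd L (vscale L (d_z f z) (s z)) (vscale L (f z) (D1 s z)) \<and>
           D2 (\<lambda>w. vscale L (f w) (s w)) z = vadd L (vscale L (d_zbar f z) (s z)) (vscale L (f z) (D2 s z)))))"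

text \<open>
  The first clause says that the (0,1)-part of the connection is the Cauchy-Riemann operator of the
  holomorphic structure; the other one is \<open>d (H(s,t)) = H(\<nabla>s,t) + H(s,\<nabla>t)\<close>, where the
  conjugate-linearity in the second argument exchanges \<open>dz\<close> and \<open>dzbar\<close>.
\<close>

definition chern_connection ::
    "'e line_bundle \<Rightarrow> ('e \<Rightarrow> 'e \<Rightarrow> complex) \<Rightarrow>
     ((complex \<Rightarrow> 'e) \<Rightarrow> complex \<Rightarrow> 'e) \<Rightarrow> ((complex \<Rightarrow> 'e) \<Rightarrow> complex \<Rightarrow> 'e) \<Rightarrow> bool" where
  "chern_connection L H D1 D2 \<longleftrightarrow>
     connection L D1 D2 \<and>
     (\<forall>V s. smooth_section L V s \<longrightarrow>
        (\<forall>(U, \<psi>)\<in>charts L. \<forall>z\<in>U \<inter> V. \<psi> (D2 s z) = d_zbar (\<lambda>w. \<psi> (s w)) z)) \<and>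
     (\<forall>V s t. smooth_section L V s \<longrightarrow> smooth_section L V t \<longrightarrow> (\<forall>z\<in>V.
        d_z (\<lambda>w. H (s w) (t w)) z = H (D1 s z) (t z) + H (s z) (D2 t z) \<and>
        d_zbar (\<lambda>w. H (s w) (t w)) z = H (D2 s z) (t z) + H (s z) (D1 t z)))"

text \<open>
  A 2-form \<open>\<alpha> dz \<and> dzbar\<close> on \<open>\<complex>\<close> is represented by its coefficient \<open>\<alpha>\<close>. Since
  \<open>\<nabla>\<^sup>2 s = (D1 (D2 s) - D2 (D1 s)) dz \<and> dzbar\<close>, the coefficient \<open>F\<close> of the curvature is
  characterized by \<open>D1 (D2 s) = D2 (D1 s) + F s\<close>.
\<close>

definition chern_curvature :: "'e line_bundle \<Rightarrow> ('e \<Rightarrow> 'e \<Rightarrow> complex) \<Rightarrow> complex \<Rightarrow> complex" where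
  "chern_curvature L H = (THE F. \<exists>D1 D2. chern_connection L H D1 D2 \<and>
     (\<forall>V s. smooth_section L V s \<longrightarrow>
        (\<forall>z\<in>V. D1 (D2 s) z = vadd L (D2 (D1 s) z) (vscale L (F z) (s z)))))"


section \<open>The conformal Kaehler form\<close>

definition omega :: "real \<Rightarrow> complex \<Rightarrow> complex" where
  "omega k z = \<i> / 2 * of_real ((1 + (cmod z)\<^sup>2) powr k)"

text \<open>
  In complex dimension one the adjoint of wedging with \<open>omega k\<close> is determined on 2-forms by
  \<open>Lambda_omega k (\<rho> omega k) = \<rho>\<close>.
\<close>

definition Lambda_omega :: "real \<Rightarrow> (complex \<Rightarrow> complex) \<Rightarrow> complex \<Rightarrow> complex" where
  "Lambda_omega k \<alpha> z = \<alpha> z / omega k z"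

text \<open>Here \<open>dz \<and> dzbar = -2 \<i> dx \<and> dy\<close>, and \<open>lborel\<close> on \<open>\<complex>\<close> is \<open>dx dy\<close>.\<close>

definition integral_2form :: "(complex \<Rightarrow> complex) \<Rightarrow> complex" where
  "integral_2form \<alpha> = (LINT z|lborel. - 2 * \<i> * \<alpha> z)"

end

theory Submission
  imports Defs "HOL-Complex_Analysis.Complex_Analysis"
begin

text \<open>
  Writing \<open>H = exp f K\<close>, the curvature equation becomes the Kazdan-Warner equation
  \<open>\<Delta> f = g + h exp f\<close> on the plane, with \<open>g = 4 F\<^sub>K - \<lambda> (1 + |z|\<^sup>2)\<^sup>k\<close> and
  \<open>h = |\<phi>|\<^sup>2 (1 + |z|\<^sup>2)\<^sup>k\<close>. Both are bounded by a multiple of \<open>(1 + |z|\<^sup>2)\<^sup>k\<^sup>-\<^sup>l\<close>, where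
  \<open>l - k > 1\<close>, and \<open>g\<close> has negative integral. The logarithmic potential \<open>u\<close> of \<open>g\<close> is
  asymptotic to a positive multiple of \<open>\<integral>g\<close> times \<open>ln (1 + |z|\<^sup>2)\<close>, hence bounded above.
  With \<open>f = u + ln \<epsilon> + y\<close> the equation reads \<open>\<Delta> y = \<epsilon> h exp u exp y\<close>, and for small \<open>\<epsilon>\<close>
  the logarithmic potential of the right-hand side is a contraction on a ball of functions of at most
  logarithmic growth. The fixed point is smooth because a logarithmic potential has one derivative
  more than its density.
\<close>

section \<open>Calculus of differentiable functions on the plane\<close>

text \<open>Only the sum \<open>u + ln \<epsilon> + y\<close> has to solve the equation, so
  \<open>\<epsilon>\<close> can be chosen freely: the Laplacian does not see the constant, while
  \<open>exp\<close> turns it into a small factor of the nonlinear term. A logarithmic potential is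
  unbounded in general, so the iteration runs in the sup norm on the quotient of \<open>y\<close> by
  a logarithmic weight. The powers of \<open>1 + |z|^2\<close> that arise from exponentiating the
  weight are paid for by the gap between \<open>l - k\<close> and \<open>1\<close>.

  Second derivatives of \<open>ln |s|\<close> are not locally integrable, so the Laplacian of a
  potential cannot be taken under the integral. The kernel is replaced by
  \<open>ln (|s|^2 + d) / 2\<close>, whose Laplacian is a bump of fixed mass that concentrates at
  the origin as \<open>d\<close> tends to \<open>0\<close>. Higher derivatives are moved to the
  density, which has to be cut off for that purpose.

  The curvature is a definite description over all Chern connections. Before any analysis, a
  connection has to be constructed and the coefficient shown to be unique; in a chart it is then
  \<open>-1/4\<close> times the Laplacian of the logarithm of the metric coefficient.\<close>

abbreviation deriv_dir :: "complex \<Rightarrow> (complex \<Rightarrow> 'b::real_normed_vector) \<Rightarrow> complex \<Rightarrow> 'b" where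
  "deriv_dir v f \<equiv> \<lambda>z. frechet_derivative f (at z) v"

lemma has_derivative_frechet_linear:
  assumes "(f has_derivative D) (at (z::complex))"
  shows "D v = Re v *\<^sub>R D 1 + Im v *\<^sub>R D \<i>"
proof -
  interpret bounded_linear D using assms by (rule has_derivative_bounded_linear)
  have "D v = D (Re v *\<^sub>R 1 + Im v *\<^sub>R \<i>)"
    by (metis complex_eq scaleR_conv_of_real mult.commute mult_1)
  then show ?thesis by (simp only: add scaleR)
qed

lemma has_derivative_frechet_derivative_eq:
  "(f has_derivative D) (at z) \<Longrightarrow> frechet_derivative f (at z) v = D v"
  by (metis frechet_derivative_at)

lemma C_on_cong:
  assumes "open U" "\<And>z. z \<in> U \<Longrightarrow> f z = g z" "C_on n U f"
  shows "C_on n U g"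
  using assms(2,3)
proof (induction n arbitrary: f g)
  case 0
  then show ?case using continuous_on_cong[of U U f g] by simp
next
  case (Suc n)
  have d: "(g has_derivative frechet_derivative f (at z)) (at z)" if "z \<in> U" for z
    using Suc.prems that assms(1) has_derivative_transform_within_open[of f "frechet_derivative f (at z)" z UNIV U g]
    by (auto simp: frechet_derivative_works)
  have e: "frechet_derivative f (at z) v = frechet_derivative g (at z) v" if "z \<in> U" for z v
    using has_derivative_frechet_derivative_eq[OF d[OF that]] by simp
  have "C_on n U (deriv_dir 1 g)" "C_on n U (deriv_dir \<i> g)"
    using Suc.IH[of "deriv_dir 1 f" "deriv_dir 1 g"] Suc.IH[of "deriv_dir \<i> f" "deriv_dir \<i> g"] e Suc.prems by auto
  then show ?case using d by (auto simp: differentiable_def)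
qed

text \<open>Trades the chosen value of \<open>frechet_derivative\<close> for an arbitrary witness
  \<open>F\<close>, so that the closure properties below can quote the differentiation rules as they
  stand.\<close>

lemma C_on_Suc_iff:
  assumes "open U"
  shows "C_on (Suc n) U f \<longleftrightarrow>
    (\<exists>F. (\<forall>z\<in>U. (f has_derivative F z) (at z)) \<and> C_on n U (\<lambda>z. F z 1) \<and> C_on n U (\<lambda>z. F z \<i>))"
proof
  assume "C_on (Suc n) U f"
  then show "\<exists>F. (\<forall>z\<in>U. (f has_derivative F z) (at z)) \<and> C_on n U (\<lambda>z. F z 1) \<and> C_on n U (\<lambda>z. F z \<i>)"
    by (intro exI[of _ "\<lambda>z. frechet_derivative f (at z)"]) (auto simp: frechet_derivative_works)
next
  assume "\<exists>F. (\<forall>z\<in>U. (f has_derivative F z) (at z)) \<and> C_on n U (\<lambda>z. F z 1) \<and> C_on n U (\<lambda>z. F z \<i>)"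
  then obtain F where F: "\<And>z. z \<in> U \<Longrightarrow> (f has_derivative F z) (at z)"
    "C_on n U (\<lambda>z. F z 1)" "C_on n U (\<lambda>z. F z \<i>)" by blast
  have "C_on n U (deriv_dir v f)" if "C_on n U (\<lambda>z. F z v)" for v
    by (rule C_on_cong[OF assms _ that]) (simp add: has_derivative_frechet_derivative_eq[OF F(1)])
  then show "C_on (Suc n) U f" using F by (auto simp: differentiable_def)
qed

lemma C_on_SucI:
  assumes "open U" "\<And>z. z \<in> U \<Longrightarrow> (f has_derivative F z) (at z)"
    "C_on n U (\<lambda>z. F z 1)" "C_on n U (\<lambda>z. F z \<i>)"
  shows "C_on (Suc n) U f"
  using assms C_on_Suc_iff by blast

lemma C_on_SucE:
  assumes "open U" "C_on (Suc n) U f"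
  obtains F where "\<And>z. z \<in> U \<Longrightarrow> (f has_derivative F z) (at z)"
    "C_on n U (\<lambda>z. F z 1)" "C_on n U (\<lambda>z. F z \<i>)"
  using assms C_on_Suc_iff by blast

lemma C_on_SucD: "C_on (Suc n) U f \<Longrightarrow> C_on n U f"
proof (induction n arbitrary: f)
  case 0
  then show ?case
    by (auto intro!: continuous_at_imp_continuous_on differentiable_imp_continuous_within)
next
  case (Suc n)
  then show ?case by (metis C_on.simps(2))
qed

lemma C_on_le: "C_on n U f \<Longrightarrow> m \<le> n \<Longrightarrow> C_on m U f"
  by (induction n) (auto simp: le_Suc_eq dest: C_on_SucD simp del: C_on.simps(2))

lemma C_on_imp_continuous: "C_on n U f \<Longrightarrow> continuous_on U f"
  using C_on_le[of n U f 0] by simp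

lemma C_on_subset: "C_on n U f \<Longrightarrow> V \<subseteq> U \<Longrightarrow> C_on n V f"
  by (induction n arbitrary: f) (auto intro: continuous_on_subset)

text \<open>Derivatives depend only on the germ of a function, so the neighbourhood may vary with
  the point. This glues statements that are proved in charts or on balls.\<close>

lemma C_on_local:
  assumes "\<And>z. z \<in> U \<Longrightarrow> \<exists>V. open V \<and> z \<in> V \<and> C_on n V f"
  shows "C_on n U f"
  using assms
proof (induction n arbitrary: f)
  case 0
  have "isCont f z" if z: "z \<in> U" for z
  proof -
    obtain V where "open V" "z \<in> V" "C_on 0 V f" using 0[OF z] by blast
    then show ?thesis by (simp add: continuous_on_eq_continuous_at)
  qed
  then show ?case by (simp add: continuous_at_imp_continuous_on)
next
  case (Suc n)
  have "f differentiable at z" if z: "z \<in> U" for z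
    using Suc.prems[OF z] by auto
  moreover have "C_on n U (deriv_dir v f)" if "v = 1 \<or> v = \<i>" for v
  proof (rule Suc.IH)
    fix z assume "z \<in> U"
    then obtain V where "open V" "z \<in> V" "C_on (Suc n) V f" using Suc.prems by blast
    then show "\<exists>V. open V \<and> z \<in> V \<and> C_on n V (deriv_dir v f)" using that by auto
  qed
  ultimately show ?case by simp
qed

lemma C_on_const [simp]: "C_on n U (\<lambda>_. c)"
  by (induction n arbitrary: c) (auto simp: continuous_on_const)

section \<open>Closure properties of finite differentiability on an open set\<close>

context
  fixes U :: "complex set"
  assumes U: "open U"
begin

lemma C_on_bounded_linear:
  assumes "bounded_linear T" "C_on n U f"
  shows "C_on n U (\<lambda>z. T (f z))"
  using assms(2)
proof (induction n arbitrary: f)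
  case 0
  then show ?case
    using assms(1) by (auto intro: bounded_linear.continuous_on)
next
  case (Suc n)
  obtain F where F: "\<And>z. z \<in> U \<Longrightarrow> (f has_derivative F z) (at z)"
    "C_on n U (\<lambda>z. F z 1)" "C_on n U (\<lambda>z. F z \<i>)" using C_on_SucE[OF U Suc.prems] by blast
  show ?case
    by (rule C_on_SucI[OF U, where F="\<lambda>z v. T (F z v)"])
      (auto intro: bounded_linear.has_derivative[OF assms(1)] F Suc.IH)
qed

lemma C_on_ident: "C_on n U (\<lambda>z. z)"
proof (cases n)
  case (Suc m)
  show ?thesis unfolding Suc
    by (rule C_on_SucI[OF U, where F="\<lambda>_ v. v"]) auto
qed (simp add: continuous_on_id)

lemma C_on_add:
  assumes "C_on n U f" "C_on n U g"
  shows "C_on n U (\<lambda>z. f z + g z)"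
  using assms
proof (induction n arbitrary: f g)
  case 0
  then show ?case by (auto intro: continuous_intros)
next
  case (Suc n)
  obtain F where F: "\<And>z. z \<in> U \<Longrightarrow> (f has_derivative F z) (at z)"
    "C_on n U (\<lambda>z. F z 1)" "C_on n U (\<lambda>z. F z \<i>)" using C_on_SucE[OF U Suc.prems(1)] by blast
  obtain G where G: "\<And>z. z \<in> U \<Longrightarrow> (g has_derivative G z) (at z)"
    "C_on n U (\<lambda>z. G z 1)" "C_on n U (\<lambda>z. G z \<i>)" using C_on_SucE[OF U Suc.prems(2)] by blast
  show ?case
    by (rule C_on_SucI[OF U, where F="\<lambda>z v. F z v + G z v"]) (auto intro: has_derivative_add F G Suc.IH)
qed

lemma C_on_bilinear:
  fixes prod :: "'b::real_normed_vector \<Rightarrow> 'c::real_normed_vector \<Rightarrow> 'd::real_normed_vector"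
  assumes "bounded_bilinear prod" "C_on n U f" "C_on n U g"
  shows "C_on n U (\<lambda>z. prod (f z) (g z))"
  using assms(2,3)
proof (induction n arbitrary: f g)
  case 0
  then show ?case using assms(1) by (auto intro: bounded_bilinear.continuous_on)
next
  case (Suc n)
  obtain F where F: "\<And>z. z \<in> U \<Longrightarrow> (f has_derivative F z) (at z)"
    "C_on n U (\<lambda>z. F z 1)" "C_on n U (\<lambda>z. F z \<i>)" using C_on_SucE[OF U Suc.prems(1)] by blast
  obtain G where G: "\<And>z. z \<in> U \<Longrightarrow> (g has_derivative G z) (at z)"
    "C_on n U (\<lambda>z. G z 1)" "C_on n U (\<lambda>z. G z \<i>)" using C_on_SucE[OF U Suc.prems(2)] by blast
  \<comment> \<open>Leibniz' rule leaves one factor undifferentiated, so the induction also needs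
    both functions themselves at the lower order.\<close>
  have n: "C_on n U f" "C_on n U g" using Suc.prems C_on_SucD by blast+
  show ?case
    by (rule C_on_SucI[OF U, where F="\<lambda>z v. prod (f z) (G z v) + prod (F z v) (g z)"])
      (auto intro!: bounded_bilinear.FDERIV[OF assms(1)] F G C_on_add Suc.IH n)
qed

lemmas C_on_mult = C_on_bilinear[OF bounded_bilinear_mult]

lemma C_on_uminus: "C_on n U f \<Longrightarrow> C_on n U (\<lambda>z. - f z)"
  by (rule C_on_bounded_linear[OF bounded_linear_minus[OF bounded_linear_ident]])

lemma C_on_diff: "C_on n U f \<Longrightarrow> C_on n U g \<Longrightarrow> C_on n U (\<lambda>z. f z - g z)"
  using C_on_add[of n f "\<lambda>z. - g z"] C_on_uminus[of n g] by simp

lemma C_on_inverse: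
  fixes f :: "complex \<Rightarrow> 'b::real_normed_field"
  assumes "C_on n U f" "\<And>z. z \<in> U \<Longrightarrow> f z \<noteq> 0"
  shows "C_on n U (\<lambda>z. inverse (f z))"
  using assms
proof (induction n)
  case 0
  then show ?case by (auto intro!: continuous_intros)
next
  case (Suc n)
  obtain F where F: "\<And>z. z \<in> U \<Longrightarrow> (f has_derivative F z) (at z)"
    "C_on n U (\<lambda>z. F z 1)" "C_on n U (\<lambda>z. F z \<i>)" using C_on_SucE[OF U Suc.prems(1)] by blast
  have n: "C_on n U (\<lambda>z. inverse (f z))" using Suc C_on_SucD by blast
  show ?case
    by (rule C_on_SucI[OF U, where F="\<lambda>z v. - (inverse (f z) * F z v * inverse (f z))"])
      (auto intro!: Deriv.has_derivative_inverse C_on_uminus C_on_mult F Suc.prems n)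
qed

lemma C_on_divide:
  fixes f :: "complex \<Rightarrow> 'b::real_normed_field"
  assumes "C_on n U f" "C_on n U g" "\<And>z. z \<in> U \<Longrightarrow> g z \<noteq> 0"
  shows "C_on n U (\<lambda>z. f z / g z)"
  using C_on_mult[OF assms(1) C_on_inverse[OF assms(2,3)]] by (simp add: divide_inverse)

lemma C_on_exp:
  fixes f :: "complex \<Rightarrow> real"
  assumes "C_on n U f"
  shows "C_on n U (\<lambda>z. exp (f z))"
  using assms
proof (induction n)
  case 0
  then show ?case by (auto intro!: continuous_intros)
next
  case (Suc n)
  obtain F where F: "\<And>z. z \<in> U \<Longrightarrow> (f has_derivative F z) (at z)"
    "C_on n U (\<lambda>z. F z 1)" "C_on n U (\<lambda>z. F z \<i>)" using C_on_SucE[OF U Suc.prems(1)] by blast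
  have n: "C_on n U (\<lambda>z. exp (f z))" using Suc C_on_SucD by blast
  show ?case
  proof (rule C_on_SucI[OF U, where F="\<lambda>z v. F z v * exp (f z)"])
    show "((\<lambda>z. exp (f z)) has_derivative (\<lambda>v. F z v * exp (f z))) (at z)" if "z \<in> U" for z
      using has_derivative_exp[OF F(1)[OF that]] by (simp add: mult.commute)
  qed (auto intro!: C_on_mult F n)
qed

lemma C_on_ln:
  fixes f :: "complex \<Rightarrow> real"
  assumes "C_on n U f" "\<And>z. z \<in> U \<Longrightarrow> f z > 0"
  shows "C_on n U (\<lambda>z. ln (f z))"
proof (cases n)
  case 0
  then show ?thesis using assms by (fastforce intro!: continuous_intros)
next
  case (Suc m)
  obtain F where F: "\<And>z. z \<in> U \<Longrightarrow> (f has_derivative F z) (at z)"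
    "C_on m U (\<lambda>z. F z 1)" "C_on m U (\<lambda>z. F z \<i>)" using C_on_SucE[OF U] assms(1) Suc by metis
  have n: "C_on m U (\<lambda>z. inverse (f z))"
    using assms Suc C_on_SucD C_on_inverse by (metis less_irrefl)
  show ?thesis unfolding Suc
  proof (rule C_on_SucI[OF U, where F="\<lambda>z v. F z v * inverse (f z)"])
    show "((\<lambda>z. ln (f z)) has_derivative (\<lambda>v. F z v * inverse (f z))) (at z)" if "z \<in> U" for z
      using has_derivative_ln[OF assms(2)[OF that] F(1)[OF that]] by (simp add: divide_inverse)
  qed (auto intro!: C_on_mult F n)
qed

lemma C_on_holomorphic:
  assumes "f holomorphic_on U"
  shows "C_on n U f"
  using assms
proof (induction n arbitrary: f)
  case 0
  then show ?case by (simp add: holomorphic_on_imp_continuous_on)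
next
  case (Suc n)
  show ?case
  proof (rule C_on_SucI[OF U, where F="\<lambda>z v. deriv f z * v"])
    show "(f has_derivative (*) (deriv f z)) (at z)" if "z \<in> U" for z
      using holomorphic_derivI[OF Suc.prems U that] by (simp add: has_field_derivative_def)
  qed (auto intro!: C_on_mult C_on_const Suc.IH[OF holomorphic_deriv] Suc.prems U)
qed

lemmas C_on_of_real = C_on_bounded_linear[OF bounded_linear_of_real]
  and C_on_Re = C_on_bounded_linear[OF bounded_linear_Re]
  and C_on_Im = C_on_bounded_linear[OF bounded_linear_Im]
  and C_on_cnj = C_on_bounded_linear[OF bounded_linear_cnj]

text \<open>Expanded into coordinates because \<open>cmod\<close> itself is not differentiable at
  the origin.\<close>

lemma C_on_norm_sq: "C_on n U (\<lambda>z. (cmod z)\<^sup>2)"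
  unfolding cmod_power2 unfolding power2_eq_square
  by (intro C_on_add C_on_mult C_on_Re C_on_Im C_on_ident)

lemma C_on_japanese_powr: "C_on n U (\<lambda>z. (1 + (cmod z)\<^sup>2) powr k)"
proof -
  have "1 + (cmod z)\<^sup>2 > 0" for z by (simp add: add_pos_nonneg)
  then have "C_on n U (\<lambda>z. exp (k * ln (1 + (cmod z)\<^sup>2)))"
    by (intro C_on_exp C_on_mult C_on_const C_on_ln C_on_add C_on_norm_sq)
  moreover have "1 + (cmod z)\<^sup>2 \<noteq> 0" for z by (smt (verit) zero_le_power2)
  ultimately show ?thesis by (simp add: powr_def)
qed

end

section \<open>Symmetry of mixed second derivatives\<close>

lemma second_difference_mean_value:
  fixes f :: "complex \<Rightarrow> real"
  assumes "h > 0" and ball: "\<And>s t. 0 \<le> s \<Longrightarrow> s \<le> h \<Longrightarrow> 0 \<le> t \<Longrightarrow> t \<le> h \<Longrightarrow> z + of_real s * u + of_real t * v \<in> U"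
    and f: "\<And>z. z \<in> U \<Longrightarrow> f differentiable at z"
    and fu: "\<And>z. z \<in> U \<Longrightarrow> deriv_dir u f differentiable at z"
  shows "\<exists>s t. 0 < s \<and> s < h \<and> 0 < t \<and> t < h \<and>
     f (z + of_real h * u + of_real h * v) - f (z + of_real h * u) - f (z + of_real h * v) + f z
     = h * h * deriv_dir v (deriv_dir u f) (z + of_real s * u + of_real t * v)"
proof -
  have chain: "((\<lambda>r. g (c + of_real r * w)) has_real_derivative deriv_dir w g (c + of_real r * w)) (at r)"
    if "g differentiable at (c + of_real r * w)" for g :: "complex \<Rightarrow> real" and c w r
  proof -
    have g: "(g has_derivative frechet_derivative g (at (c + of_real r * w))) (at (c + of_real r * w))"
      using that by (simp add: frechet_derivative_works)
    have lin: "frechet_derivative g (at (c + of_real r * w)) (x * w) = deriv_dir w g (c + of_real r * w) * x" for x :: real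
      using linear_scale[OF linear_frechet_derivative[OF that], of x w] by (simp add: scaleR_conv_of_real mult.commute)
    have "((\<lambda>r. c + of_real r * w) has_derivative (\<lambda>x. of_real x * w)) (at r)"
      by (auto intro!: derivative_eq_intros simp: mult.commute)
    from has_derivative_compose[OF this g] show ?thesis
      unfolding has_field_derivative_def by (simp add: lin)
  qed
  \<comment> \<open>The mean value theorem is applied twice: in direction \<open>u\<close> to the
    increment along \<open>h * v\<close>, and then in direction \<open>v\<close> to the derivative
    that results.\<close>
  define p where "p s = f ((z + of_real h * v) + of_real s * u) - f (z + of_real s * u)" for s
  have "(p has_real_derivative deriv_dir u f ((z + of_real h * v) + of_real s * u) - deriv_dir u f (z + of_real s * u)) (at s)"
    if "0 \<le> s" "s \<le> h" for s
    unfolding p_def using that ball[of s h] ball[of s 0] assms(1)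
    by (intro DERIV_diff chain f) (auto simp: algebra_simps)
  from MVT2[of 0 h p, OF assms(1) this]
  obtain s where s: "0 < s" "s < h"
    "p h - p 0 = (h - 0) * (deriv_dir u f ((z + of_real h * v) + of_real s * u) - deriv_dir u f (z + of_real s * u))"
    by auto
  have "((\<lambda>t. deriv_dir u f ((z + of_real s * u) + of_real t * v)) has_real_derivative
      deriv_dir v (deriv_dir u f) ((z + of_real s * u) + of_real t * v)) (at t)"
    if "0 \<le> t" "t \<le> h" for t
    using that s ball[of s t] by (intro chain fu) auto
  from MVT2[of 0 h, OF assms(1) this]
  obtain t where t: "0 < t" "t < h"
    "deriv_dir u f ((z + of_real s * u) + of_real h * v) - deriv_dir u f ((z + of_real s * u) + of_real 0 * v)
      = (h - 0) * deriv_dir v (deriv_dir u f) ((z + of_real s * u) + of_real t * v)"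
    by metis
  have "p h - p 0 = h * h * deriv_dir v (deriv_dir u f) (z + of_real s * u + of_real t * v)"
    using s(3) t(3) by (simp add: algebra_simps)
  then show ?thesis using s(1,2) t(1,2)
    by (intro exI[of _ s] exI[of _ t]) (simp add: p_def algebra_simps)
qed

text \<open>Schwarz' argument: the second difference over a square does not change when its two
  sides are interchanged. Divided by the area, it tends to either mixed derivative, because both are
  continuous at the corner.\<close>

lemma deriv_dir_commute_real:
  fixes f :: "complex \<Rightarrow> real"
  assumes "open U" "z \<in> U" "C_on 2 U f"
  shows "deriv_dir \<i> (deriv_dir 1 f) z = deriv_dir 1 (deriv_dir \<i> f) z"
proof -
  note c = assms(3)[unfolded numeral_2_eq_2 C_on.simps]
  have c1: "isCont (deriv_dir \<i> (deriv_dir 1 f)) z" and c2: "isCont (deriv_dir 1 (deriv_dir \<i> f)) z"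
    using c assms(1,2) by (auto simp: continuous_on_eq_continuous_at)
  obtain r where r: "r > 0" "ball z r \<subseteq> U" using assms(1,2) open_contains_ball by blast
  \<comment> \<open>The factor \<open>3\<close> keeps the closed square of side \<open>h n\<close>
    strictly inside the ball of radius \<open>r\<close>, since its points are at distance at most
    \<open>2 * h n\<close> from \<open>z\<close>.\<close>
  define h where "h n = r / (3 * (Suc n))" for n :: nat
  have h: "h n > 0" "3 * h n \<le> r" for n
    using r by (auto simp: h_def field_simps mult_left_mono)
  have small: "dist z (z + of_real s * u + of_real t * v) < 3 * h n"
    if "0 \<le> s" "s \<le> h n" "0 \<le> t" "t \<le> h n" "cmod u = 1" "cmod v = 1" for s t u v n
  proof -
    have "dist z (z + of_real s * u + of_real t * v) = norm (of_real s * u + of_real t * v)"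
      by (simp add: dist_norm norm_minus_commute algebra_simps)
    also have "\<dots> \<le> s + t" using that norm_triangle_ineq[of "of_real s * u" "of_real t * v"] by (simp add: norm_mult)
    finally show ?thesis using that h(1)[of n] by linarith
  qed
  have inU: "z + of_real s * u + of_real t * v \<in> U"
    if "0 \<le> s" "s \<le> h n" "0 \<le> t" "t \<le> h n" "cmod u = 1" "cmod v = 1" for s t u v n
    using small[OF that] h[of n] r by (force simp: subset_iff)
  have h0: "h \<longlonglongrightarrow> 0" unfolding h_def
    using tendsto_mult[OF tendsto_const[of "r/3"] LIMSEQ_inverse_real_of_nat] by (simp add: field_simps)
  define q where "q n = (f (z + of_real (h n) * 1 + of_real (h n) * \<i>) - f (z + of_real (h n) * 1) - f (z + of_real (h n) * \<i>) + f z) / (h n * h n)" for n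
  have lim: "q \<longlonglongrightarrow> g z"
    if that_g: "isCont g z" "cmod u = 1" "cmod v = 1"
      "\<And>n. \<exists>s t. 0 < s \<and> s < h n \<and> 0 < t \<and> t < h n \<and> q n = g (z + of_real s * u + of_real t * v)" for g :: "complex \<Rightarrow> real" and u v
  proof -
    obtain s t where st: "\<And>n. 0 < s n \<and> s n < h n \<and> 0 < t n \<and> t n < h n \<and> q n = g (z + of_real (s n) * u + of_real (t n) * v)"
      using that_g(4) by metis
    have "(\<lambda>n. z + of_real (s n) * u + of_real (t n) * v) \<longlonglongrightarrow> z"
    proof (rule tendsto_dist_iff[THEN iffD2], rule tendsto_sandwich[OF _ _ tendsto_const])
      show "(\<lambda>n. 3 * h n) \<longlonglongrightarrow> 0" using tendsto_mult_right_zero[OF h0] by simp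
      show "\<forall>\<^sub>F n in sequentially. dist (z + of_real (s n) * u + of_real (t n) * v) z \<le> 3 * h n"
        using small st that_g(2,3) by (intro always_eventually allI) (metis dist_commute less_imp_le)
    qed auto
    then have "(\<lambda>n. g (z + of_real (s n) * u + of_real (t n) * v)) \<longlonglongrightarrow> g z"
      using that_g(1) isCont_tendsto_compose by blast
    then show ?thesis using st by presburger
  qed
  have "q \<longlonglongrightarrow> deriv_dir \<i> (deriv_dir 1 f) z"
  proof (rule lim[OF c1, of 1 \<i>])
    fix n
    show "\<exists>s t. 0 < s \<and> s < h n \<and> 0 < t \<and> t < h n \<and> q n = deriv_dir \<i> (deriv_dir 1 f) (z + of_real s * 1 + of_real t * \<i>)"
    proof -
      obtain s t where "0 < s" "s < h n" "0 < t" "t < h n"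
        "f (z + of_real (h n) * 1 + of_real (h n) * \<i>) - f (z + of_real (h n) * 1) - f (z + of_real (h n) * \<i>) + f z
          = h n * h n * deriv_dir \<i> (deriv_dir 1 f) (z + of_real s * 1 + of_real t * \<i>)"
        using second_difference_mean_value[of "h n" z 1 \<i> U f, OF h(1) inU[of _ n]] c by auto
      then show ?thesis using h(1)[of n]
        by (intro exI[of _ s] exI[of _ t]) (simp add: q_def add_ac diff_diff_eq)
    qed
  qed auto
  moreover have "q \<longlonglongrightarrow> deriv_dir 1 (deriv_dir \<i> f) z"
  proof (rule lim[OF c2, of \<i> 1])
    fix n
    show "\<exists>s t. 0 < s \<and> s < h n \<and> 0 < t \<and> t < h n \<and> q n = deriv_dir 1 (deriv_dir \<i> f) (z + of_real s * \<i> + of_real t * 1)"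
    proof -
      obtain s t where "0 < s" "s < h n" "0 < t" "t < h n"
        "f (z + of_real (h n) * \<i> + of_real (h n) * 1) - f (z + of_real (h n) * \<i>) - f (z + of_real (h n) * 1) + f z
          = h n * h n * deriv_dir 1 (deriv_dir \<i> f) (z + of_real s * \<i> + of_real t * 1)"
        using second_difference_mean_value[of "h n" z \<i> 1 U f, OF h(1) inU[of _ n]] c by auto
      then show ?thesis using h(1)[of n]
        by (intro exI[of _ s] exI[of _ t]) (simp add: q_def add_ac diff_diff_eq)
    qed
  qed auto
  ultimately show ?thesis using LIMSEQ_unique by blast
qed

lemma frechet_derivative_bounded_linear:
  assumes "bounded_linear T" "f differentiable at z"
  shows "frechet_derivative (\<lambda>w. T (f w)) (at z) v = T (frechet_derivative f (at z) v)"
  using has_derivative_frechet_derivative_eq[OF bounded_linear.has_derivative[OF assms(1)]] assms(2)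
  by (metis frechet_derivative_works)

lemma deriv_dir_commute:
  fixes f :: "complex \<Rightarrow> complex"
  assumes "open U" "z \<in> U" "C_on 2 U f"
  shows "deriv_dir \<i> (deriv_dir 1 f) z = deriv_dir 1 (deriv_dir \<i> f) z"
proof -
  note c = assms(3)[unfolded numeral_2_eq_2 C_on.simps]
  \<comment> \<open>The mean value theorem is confined to real values, so the identity is tested
    against real functionals; real and imaginary part suffice.\<close>
  have *: "T (deriv_dir \<i> (deriv_dir 1 f) z) = T (deriv_dir 1 (deriv_dir \<i> f) z)"
    if T: "bounded_linear (T :: complex \<Rightarrow> real)" for T
  proof -
    have 1: "deriv_dir v (deriv_dir u (\<lambda>w. T (f w))) z = T (deriv_dir v (deriv_dir u f) z)"
      if "deriv_dir u f differentiable at z" for u v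
    proof -
      have "(deriv_dir u (\<lambda>w. T (f w)) has_derivative (\<lambda>v. T (deriv_dir v (deriv_dir u f) z))) (at z)"
        by (rule has_derivative_transform_within_open[OF _ assms(1,2), of "\<lambda>w. T (deriv_dir u f w)"])
          (use that c in \<open>auto simp: frechet_derivative_bounded_linear[OF T] frechet_derivative_works
            intro!: bounded_linear.has_derivative[OF T]\<close>)
      then show ?thesis by (rule has_derivative_frechet_derivative_eq)
    qed
    have "C_on 2 U (\<lambda>w. T (f w))" using C_on_bounded_linear[OF assms(1) T assms(3)] .
    from deriv_dir_commute_real[OF assms(1,2) this] show ?thesis
      using 1 c assms(2) by auto
  qed
  show ?thesis using *[OF bounded_linear_Re] *[OF bounded_linear_Im] by (simp add: complex_eq_iff)
qed

section \<open>Wirtinger calculus\<close>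

lemma d_z_eq:
  assumes "(f has_derivative F) (at z)"
  shows "d_z f z = (F 1 - \<i> * F \<i>) / 2" "d_zbar f z = (F 1 + \<i> * F \<i>) / 2"
  by (simp_all add: d_z_def d_zbar_def has_derivative_frechet_derivative_eq[OF assms])

lemma d_z_cong:
  assumes "open U" "z \<in> U" "\<And>w. w \<in> U \<Longrightarrow> f w = g w"
  shows "d_z f z = d_z g z" "d_zbar f z = d_zbar g z"
proof -
  have "(f has_derivative D) (at z) \<longleftrightarrow> (g has_derivative D) (at z)" for D
    using has_derivative_transform_within_open[OF _ assms(1,2)] assms(3) by metis
  then have "frechet_derivative f (at z) = frechet_derivative g (at z)"
    by (simp add: frechet_derivative_def)
  then show "d_z f z = d_z g z" "d_zbar f z = d_zbar g z" by (simp_all add: d_z_def d_zbar_def)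
qed

lemma d_z_add:
  assumes "f differentiable at z" "g differentiable at z"
  shows "d_z (\<lambda>w. f w + g w) z = d_z f z + d_z g z"
    "d_zbar (\<lambda>w. f w + g w) z = d_zbar f z + d_zbar g z"
proof -
  obtain F G where F: "(f has_derivative F) (at z)" and G: "(g has_derivative G) (at z)"
    using assms by (auto simp: differentiable_def)
  show "d_z (\<lambda>w. f w + g w) z = d_z f z + d_z g z"
    "d_zbar (\<lambda>w. f w + g w) z = d_zbar f z + d_zbar g z"
    by (simp_all add: d_z_eq[OF F] d_z_eq[OF G] d_z_eq[OF has_derivative_add[OF F G]] field_simps)
qed

lemma d_z_mult:
  assumes "f differentiable at z" "g differentiable at z"
  shows "d_z (\<lambda>w. f w * g w) z = d_z f z * g z + f z * d_z g z"
    "d_zbar (\<lambda>w. f w * g w) z = d_zbar f z * g z + f z * d_zbar g z"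
proof -
  obtain F G where F: "(f has_derivative F) (at z)" and G: "(g has_derivative G) (at z)"
    using assms by (auto simp: differentiable_def)
  show "d_z (\<lambda>w. f w * g w) z = d_z f z * g z + f z * d_z g z"
    "d_zbar (\<lambda>w. f w * g w) z = d_zbar f z * g z + f z * d_zbar g z"
    by (simp_all add: d_z_eq[OF F] d_z_eq[OF G] d_z_eq[OF has_derivative_mult[OF F G]] field_simps)
qed

lemma d_z_cnj:
  assumes "f differentiable at z"
  shows "d_z (\<lambda>w. cnj (f w)) z = cnj (d_zbar f z)" "d_zbar (\<lambda>w. cnj (f w)) z = cnj (d_z f z)"
proof -
  obtain F where F: "(f has_derivative F) (at z)" using assms by (auto simp: differentiable_def)
  note G = bounded_linear.has_derivative[OF bounded_linear_cnj F]
  show "d_z (\<lambda>w. cnj (f w)) z = cnj (d_zbar f z)" "d_zbar (\<lambda>w. cnj (f w)) z = cnj (d_z f z)"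
    by (simp_all add: d_z_eq[OF F] d_z_eq[OF G])
qed

lemma d_zbar_holomorphic:
  assumes "g holomorphic_on U" "open U" "z \<in> U"
  shows "d_zbar g z = 0" "g differentiable at z"
proof -
  have g: "(g has_derivative (*) (deriv g z)) (at z)"
    using holomorphic_derivI[OF assms] by (simp add: has_field_derivative_def)
  show "d_zbar g z = 0" by (simp add: d_z_eq[OF g] algebra_simps)
  show "g differentiable at z" using g by (auto simp: differentiable_def)
qed

lemma d_z_const [simp]: "d_z (\<lambda>_. c) z = 0" "d_zbar (\<lambda>_. c) z = 0"
  by (simp_all add: d_z_def d_zbar_def)

lemma C_on_d_z:
  assumes "open U" "C_on (Suc n) U f"
  shows "C_on n U (d_z f)" "C_on n U (d_zbar f)"
proof -
  have f: "C_on n U (deriv_dir 1 f)" "C_on n U (deriv_dir \<i> f)" using assms(2) by auto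
  have "C_on n U (\<lambda>z. (deriv_dir 1 f z - \<i> * deriv_dir \<i> f z) / 2)"
    by (intro C_on_divide C_on_diff C_on_mult C_on_const f assms(1)) auto
  then show "C_on n U (d_z f)" by (simp add: d_z_def[abs_def])
  have "C_on n U (\<lambda>z. (deriv_dir 1 f z + \<i> * deriv_dir \<i> f z) / 2)"
    by (intro C_on_divide C_on_add C_on_mult C_on_const f assms(1)) auto
  then show "C_on n U (d_zbar f)" by (simp add: d_zbar_def[abs_def])
qed

section \<open>The Laplacian of real functions\<close>

definition laplacian :: "(complex \<Rightarrow> real) \<Rightarrow> complex \<Rightarrow> real" where
  "laplacian f z = deriv_dir 1 (deriv_dir 1 f) z + deriv_dir \<i> (deriv_dir \<i> f) z"

lemma deriv_dir_linear_comb: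
  assumes "f differentiable at z" "g differentiable at z"
  shows "deriv_dir v (\<lambda>w. a * f w + b * g w) z = a * deriv_dir v f z + b * (deriv_dir v g z :: 'b :: real_normed_algebra)"
proof -
  have "((\<lambda>w. a * f w + b * g w) has_derivative
      (\<lambda>v. a * frechet_derivative f (at z) v + b * frechet_derivative g (at z) v)) (at z)"
    using assms by (intro has_derivative_add has_derivative_mult_right) (simp_all add: frechet_derivative_works)
  then show ?thesis by (rule has_derivative_frechet_derivative_eq)
qed

text \<open>In both orders the two mixed derivatives occur with opposite signs and cancel by
  \<open>deriv_dir_commute\<close>.\<close>

lemma d_z_d_zbar:
  fixes f :: "complex \<Rightarrow> complex"
  assumes "open U" "z \<in> U" "C_on 2 U f"
  shows "d_zbar (d_z f) z = (deriv_dir 1 (deriv_dir 1 f) z + deriv_dir \<i> (deriv_dir \<i> f) z) / 4"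
    and "d_z (d_zbar f) z = (deriv_dir 1 (deriv_dir 1 f) z + deriv_dir \<i> (deriv_dir \<i> f) z) / 4"
proof -
  note c = assms(3)[unfolded numeral_2_eq_2 C_on.simps]
  have d: "deriv_dir 1 f differentiable at z" "deriv_dir \<i> f differentiable at z" using c assms(2) by auto
  have e: "d_z f = (\<lambda>w. (1/2) * deriv_dir 1 f w + (- \<i>/2) * deriv_dir \<i> f w)"
    "d_zbar f = (\<lambda>w. (1/2) * deriv_dir 1 f w + (\<i>/2) * deriv_dir \<i> f w)"
    by (auto simp: d_z_def d_zbar_def field_simps)
  note s = deriv_dir_commute[OF assms]
  show "d_zbar (d_z f) z = (deriv_dir 1 (deriv_dir 1 f) z + deriv_dir \<i> (deriv_dir \<i> f) z) / 4"
    unfolding e(1) unfolding d_zbar_def deriv_dir_linear_comb[OF d] s by (simp add: field_simps)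
  show "d_z (d_zbar f) z = (deriv_dir 1 (deriv_dir 1 f) z + deriv_dir \<i> (deriv_dir \<i> f) z) / 4"
    unfolding e(2) unfolding d_z_def deriv_dir_linear_comb[OF d] s by (simp add: field_simps)
qed

lemma deriv_dir_of_real:
  assumes "open U" "z \<in> U" "C_on 2 U f" and v: "v = 1 \<or> v = \<i>"
  shows "deriv_dir v (deriv_dir v (\<lambda>w. complex_of_real (f w))) z = of_real (deriv_dir v (deriv_dir v f) z)"
proof -
  note c = assms(3)[unfolded numeral_2_eq_2 C_on.simps]
  have d: "deriv_dir v f differentiable at z" using c v assms(2) by auto
  have "(deriv_dir v (\<lambda>w. complex_of_real (f w)) has_derivative (\<lambda>u. of_real (deriv_dir u (deriv_dir v f) z))) (at z)"
    by (rule has_derivative_transform_within_open[OF _ assms(1,2), of "\<lambda>w. of_real (deriv_dir v f w)"])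
      (use d c in \<open>auto simp: frechet_derivative_bounded_linear[OF bounded_linear_of_real] frechet_derivative_works
        intro!: bounded_linear.has_derivative[OF bounded_linear_of_real]\<close>)
  then show ?thesis by (rule has_derivative_frechet_derivative_eq)
qed

lemma d_zbar_d_z_of_real:
  assumes "open U" "z \<in> U" "C_on 2 U f"
  shows "d_zbar (d_z (\<lambda>w. complex_of_real (f w))) z = of_real (laplacian f z / 4)"
  using d_z_d_zbar(1)[OF assms(1,2) C_on_of_real[OF assms(1) assms(3)]] deriv_dir_of_real[OF assms]
  by (simp add: laplacian_def)

lemma laplacian_cong:
  assumes "open U" "z \<in> U" "\<And>w. w \<in> U \<Longrightarrow> f w = g w"
  shows "laplacian f z = laplacian g z"
proof -
  have *: "frechet_derivative p (at w) = frechet_derivative q (at w)"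
    if "w \<in> U" "\<And>w. w \<in> U \<Longrightarrow> p w = q w" for p q :: "complex \<Rightarrow> real" and w
  proof -
    have "(p has_derivative D) (at w) \<longleftrightarrow> (q has_derivative D) (at w)" for D
      using has_derivative_transform_within_open[OF _ assms(1) that(1)] that(2) by metis
    then show ?thesis by (simp add: frechet_derivative_def)
  qed
  have "deriv_dir v f w = deriv_dir v g w" if "w \<in> U" for v w
    using *[OF that assms(3)] by simp
  then have "frechet_derivative (deriv_dir v f) (at z) = frechet_derivative (deriv_dir v g) (at z)" for v
    by (intro *[OF assms(2)]) auto
  then show ?thesis by (simp add: laplacian_def)
qed

text \<open>Serves sums and scalar multiples at once. Later uses set coefficients to
  \<open>1\<close> or \<open>0\<close>, which explains the explicit factors \<open>1 *\<close> in
  the functions to which it is applied.\<close>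

lemma laplacian_linear_comb:
  assumes "open U" "z \<in> U" "C_on 2 U f" "C_on 2 U g"
  shows "laplacian (\<lambda>w. a * f w + b * g w) z = a * laplacian f z + b * laplacian g z"
proof -
  note c = assms(3,4)[unfolded numeral_2_eq_2 C_on.simps]
  have "deriv_dir v (deriv_dir v (\<lambda>w. a * f w + b * g w)) z
      = a * deriv_dir v (deriv_dir v f) z + b * deriv_dir v (deriv_dir v g) z" if "v = 1 \<or> v = \<i>" for v
  proof -
    have d: "deriv_dir v f differentiable at z" "deriv_dir v g differentiable at z" using c that assms(2) by auto
    have "((\<lambda>w. a * deriv_dir v f w + b * deriv_dir v g w) has_derivative
       (\<lambda>u. a * deriv_dir u (deriv_dir v f) z + b * deriv_dir u (deriv_dir v g) z)) (at z)"
      using d by (intro has_derivative_add has_derivative_mult_right) (simp_all add: frechet_derivative_works)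
    then have "(deriv_dir v (\<lambda>w. a * f w + b * g w) has_derivative
       (\<lambda>u. a * deriv_dir u (deriv_dir v f) z + b * deriv_dir u (deriv_dir v g) z)) (at z)"
      by (rule has_derivative_transform_within_open[OF _ assms(1,2)]) (use c in \<open>auto simp: deriv_dir_linear_comb\<close>)
    then show ?thesis by (rule has_derivative_frechet_derivative_eq)
  qed
  then show ?thesis by (simp add: laplacian_def algebra_simps)
qed

lemma C_on_laplacian:
  assumes "open U" "C_on (Suc (Suc n)) U f"
  shows "C_on n U (laplacian f)"
  unfolding laplacian_def[abs_def] using assms by (intro C_on_add) auto

lemma smooth_on_laplacian: "open U \<Longrightarrow> smooth_on U f \<Longrightarrow> smooth_on U (laplacian f)"
  unfolding smooth_on_def using C_on_laplacian by blast

lemma smooth_on_imp_C_on: "smooth_on U f \<Longrightarrow> C_on n U f"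
  by (simp add: smooth_on_def)

lemma smooth_on_cong:
  "open U \<Longrightarrow> (\<And>z. z \<in> U \<Longrightarrow> f z = g z) \<Longrightarrow> smooth_on U f \<longleftrightarrow> smooth_on U g"
  unfolding smooth_on_def using C_on_cong[of U f g] C_on_cong[of U g f] by (metis (full_types))

lemma smooth_on_differentiable: "smooth_on U f \<Longrightarrow> z \<in> U \<Longrightarrow> f differentiable at z"
  using smooth_on_imp_C_on[of U f 1] by simp

lemma smooth_on_subset: "smooth_on U f \<Longrightarrow> V \<subseteq> U \<Longrightarrow> smooth_on V f"
  by (auto simp: smooth_on_def intro: C_on_subset)

lemma smooth_on_const: "smooth_on U (\<lambda>_. c)"
  by (simp add: smooth_on_def)

lemma smooth_on_local: "(\<And>z. z \<in> U \<Longrightarrow> \<exists>V. open V \<and> z \<in> V \<and> smooth_on V f) \<Longrightarrow> smooth_on U f"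
  unfolding smooth_on_def by (meson C_on_local)

context
  fixes U :: "complex set" assumes U: "open U"
begin

lemma smooth_on_add: "smooth_on U f \<Longrightarrow> smooth_on U g \<Longrightarrow> smooth_on U (\<lambda>z. f z + g z)"
  and smooth_on_mult: "smooth_on U p \<Longrightarrow> smooth_on U q \<Longrightarrow> smooth_on U (\<lambda>z. p z * q z :: 'b::real_normed_algebra)"
  and smooth_on_divide: "smooth_on U p' \<Longrightarrow> smooth_on U q' \<Longrightarrow> (\<And>z. z \<in> U \<Longrightarrow> q' z \<noteq> 0) \<Longrightarrow> smooth_on U (\<lambda>z. p' z / q' z :: 'c::real_normed_field)"
  and smooth_on_cnj: "smooth_on U r \<Longrightarrow> smooth_on U (\<lambda>z. cnj (r z))"
  and smooth_on_Re: "smooth_on U r \<Longrightarrow> smooth_on U (\<lambda>z. Re (r z))"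
  and smooth_on_of_real: "smooth_on U s \<Longrightarrow> smooth_on U (\<lambda>z. of_real (s z) :: complex)"
  and smooth_on_exp: "smooth_on U s \<Longrightarrow> smooth_on U (\<lambda>z. exp (s z))"
  and smooth_on_ln: "smooth_on U s \<Longrightarrow> (\<And>z. z \<in> U \<Longrightarrow> s z > 0) \<Longrightarrow> smooth_on U (\<lambda>z. ln (s z))"
  and smooth_on_d_z: "smooth_on U r \<Longrightarrow> smooth_on U (d_z r)"
  and smooth_on_d_zbar: "smooth_on U r \<Longrightarrow> smooth_on U (d_zbar r)"
  and smooth_on_holomorphic: "r holomorphic_on U \<Longrightarrow> smooth_on U r"
  using U by (simp_all add: smooth_on_def C_on_add C_on_mult C_on_divide C_on_cnj C_on_Re C_on_of_real
      C_on_exp C_on_ln C_on_d_z C_on_holomorphic del: C_on.simps)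

end

section \<open>The Chern connection in a chart\<close>

locale holomorphic_bundle =
  fixes L :: "'e line_bundle"
  assumes holomorphic: "holomorphic_line_bundle L"
begin

lemmas bundle_axioms = holomorphic[unfolded holomorphic_line_bundle_def]
lemmas fibre_axioms = conjunct1[OF bundle_axioms]
  and open_axiom = conjunct1[OF conjunct2[OF bundle_axioms]]
  and chart_axioms = conjunct1[OF conjunct2[OF conjunct2[OF bundle_axioms]]]
  and cover_axiom = conjunct1[OF conjunct2[OF conjunct2[OF conjunct2[OF bundle_axioms]]]]
  and transition_axiom = conjunct2[OF conjunct2[OF conjunct2[OF conjunct2[OF bundle_axioms]]]]

lemma vadd_in: "e \<in> fibre L z \<Longrightarrow> e' \<in> fibre L z \<Longrightarrow> vadd L e e' \<in> fibre L z"
  and vscale_in: "e \<in> fibre L z \<Longrightarrow> vscale L c e \<in> fibre L z"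
  using fibre_axioms by blast+

lemma chart_open: "(U, \<psi>) \<in> charts L \<Longrightarrow> open U"
  using open_axiom by blast

lemma
  assumes "(U, \<psi>) \<in> charts L" "z \<in> U"
  shows chart_bij: "bij_betw \<psi> (fibre L z) UNIV"
    and chart_vzero: "\<psi> (vzero L z) = 0"
    and chart_vadd: "e \<in> fibre L z \<Longrightarrow> e' \<in> fibre L z \<Longrightarrow> \<psi> (vadd L e e') = \<psi> e + \<psi> e'"
    and chart_vscale: "e \<in> fibre L z \<Longrightarrow> \<psi> (vscale L c e) = c * \<psi> e"
  using bspec[OF bspec[OF chart_axioms assms(1), simplified] assms(2)] by blast+

lemma chart_cover: "\<exists>c\<in>charts L. z \<in> fst c"
proof -
  have "z \<in> (\<Union>(U, \<psi>)\<in>charts L. U)"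
    using cover_axiom by simp
  then show ?thesis by force
qed

lemma chart_transition:
  assumes "(U, \<psi>) \<in> charts L" "(V, \<psi>') \<in> charts L"
  obtains g where "g holomorphic_on (U \<inter> V)"
    "\<And>z. z \<in> U \<inter> V \<Longrightarrow> g z \<noteq> 0" "\<And>z e. z \<in> U \<inter> V \<Longrightarrow> e \<in> fibre L z \<Longrightarrow> \<psi>' e = g z * \<psi> e"
proof -
  have "\<exists>g. g holomorphic_on (U \<inter> V) \<and> (\<forall>z\<in>U \<inter> V. g z \<noteq> 0 \<and> (\<forall>e\<in>fibre L z. \<psi>' e = g z * \<psi> e))"
    using bspec[OF bspec[OF transition_axiom assms(1), simplified] assms(2)] by simp
  then show ?thesis using that by blast
qed

lemma chart_inject:
  assumes "(U, \<psi>) \<in> charts L" "z \<in> U" "e \<in> fibre L z" "e' \<in> fibre L z" "\<psi> e = \<psi> e'"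
  shows "e = e'"
  using chart_bij[OF assms(1,2)] assms(3-) by (auto simp: bij_betw_def dest: inj_onD)

text \<open>With \<open>c = 1\<close> and varying \<open>z\<close> this is the local holomorphic
  frame that belongs to the chart.\<close>

definition lift :: "('e \<Rightarrow> complex) \<Rightarrow> complex \<Rightarrow> complex \<Rightarrow> 'e" where
  "lift \<psi> z c = inv_into (fibre L z) \<psi> c"

lemma
  assumes "(U, \<psi>) \<in> charts L" "z \<in> U"
  shows lift_in: "lift \<psi> z c \<in> fibre L z" and chart_lift: "\<psi> (lift \<psi> z c) = c"
  using chart_bij[OF assms] unfolding lift_def
  by (auto simp: bij_betw_def inv_into_into f_inv_into_f)

definition metric_coeff :: "('e \<Rightarrow> 'e \<Rightarrow> complex) \<Rightarrow> ('e \<Rightarrow> complex) \<Rightarrow> complex \<Rightarrow> real" where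
  "metric_coeff H \<psi> z = Re (H (lift \<psi> z 1) (lift \<psi> z 1))"

text \<open>The definition asks for smoothness in every chart. One chart around each point is
  enough, because the coordinates in two charts differ by a holomorphic, hence smooth,
  factor.\<close>

lemma smooth_sectionI:
  assumes "open V" "\<And>z. z \<in> V \<Longrightarrow> s z \<in> fibre L z"
    "\<And>z. z \<in> V \<Longrightarrow> \<exists>U \<psi>. (U, \<psi>) \<in> charts L \<and> z \<in> U \<and> smooth_on (U \<inter> V) (\<lambda>z. \<psi> (s z))"
  shows "smooth_section L V s"
proof -
  have "smooth_on (U \<inter> V) (\<lambda>z. \<psi> (s z))" if U: "(U, \<psi>) \<in> charts L" for U \<psi>
  proof (rule smooth_on_local)
    fix z assume z: "z \<in> U \<inter> V"
    then obtain U' \<psi>' where U': "(U', \<psi>') \<in> charts L" "z \<in> U'" "smooth_on (U' \<inter> V) (\<lambda>z. \<psi>' (s z))"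
      using assms(3) by blast
    obtain g where g: "g holomorphic_on (U' \<inter> U)" "\<And>z. z \<in> U' \<inter> U \<Longrightarrow> g z \<noteq> 0"
      "\<And>z e. z \<in> U' \<inter> U \<Longrightarrow> e \<in> fibre L z \<Longrightarrow> \<psi> e = g z * \<psi>' e"
      using chart_transition[OF U'(1) U] by metis
    define W where "W = U' \<inter> U \<inter> V"
    have W: "open W" using U' U chart_open assms(1) by (auto simp: W_def)
    have "smooth_on W (\<lambda>z. g z * \<psi>' (s z))"
      by (intro smooth_on_mult W smooth_on_holomorphic holomorphic_on_subset[OF g(1)] smooth_on_subset[OF U'(3)])
        (auto simp: W_def)
    then have "smooth_on W (\<lambda>z. \<psi> (s z))"
      using smooth_on_cong[OF W, of "\<lambda>z. \<psi> (s z)" "\<lambda>z. g z * \<psi>' (s z)"] g(3) assms(2) by (auto simp: W_def)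
    then show "\<exists>V. open V \<and> z \<in> V \<and> smooth_on V (\<lambda>z. \<psi> (s z))"
      using W z U' by (auto simp: W_def)
  qed
  then show ?thesis using assms(1,2) by (auto simp: smooth_section_def)
qed

lemma smooth_section_subset:
  assumes "smooth_section L V s" "open W" "W \<subseteq> V"
  shows "smooth_section L W s"
  unfolding smooth_section_def
proof (intro conjI ballI)
  show "open W" by fact
  show "s z \<in> fibre L z" if "z \<in> W" for z using assms that by (auto simp: smooth_section_def)
  fix c assume "c \<in> charts L"
  moreover obtain U \<psi> where c: "c = (U, \<psi>)" by (cases c)
  ultimately have "smooth_on (U \<inter> V) (\<lambda>z. \<psi> (s z))" using assms by (auto simp: smooth_section_def)
  then show "case c of (U, \<psi>) \<Rightarrow> smooth_on (U \<inter> W) (\<lambda>z. \<psi> (s z))"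
    unfolding c using assms(3) by (auto elim: smooth_on_subset)
qed

lemma
  assumes "smooth_section L V s"
  shows smooth_section_open: "open V"
    and smooth_section_in: "z \<in> V \<Longrightarrow> s z \<in> fibre L z"
    and smooth_section_chart: "(U, \<psi>) \<in> charts L \<Longrightarrow> smooth_on (U \<inter> V) (\<lambda>z. \<psi> (s z))"
  using assms by (auto simp: smooth_section_def)

lemma smooth_section_frame:
  assumes "(U, \<psi>) \<in> charts L"
  shows "smooth_section L U (\<lambda>z. lift \<psi> z 1)"
proof (rule smooth_sectionI)
  fix z assume "z \<in> U"
  moreover have "smooth_on (U \<inter> U) (\<lambda>z. \<psi> (lift \<psi> z 1))"
    using smooth_on_cong[of U "\<lambda>z. \<psi> (lift \<psi> z 1)" "\<lambda>_. 1"] smooth_on_const assms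
    by (simp add: chart_open chart_lift)
  ultimately show "\<exists>U' \<psi>'. (U', \<psi>') \<in> charts L \<and> z \<in> U' \<and> smooth_on (U' \<inter> U) (\<lambda>z. \<psi>' (lift \<psi> z 1))"
    using assms by blast
qed (use assms in \<open>auto simp: chart_open lift_in\<close>)

lemma chart_expand:
  assumes "(U, \<psi>) \<in> charts L" "z \<in> U" "u \<in> fibre L z"
  shows "u = vscale L (\<psi> u) (lift \<psi> z 1)"
  using assms by (intro chart_inject[OF assms(1,2)])
    (auto simp: chart_vscale[OF assms(1,2)] chart_lift lift_in vscale_in)

text \<open>A sesquilinear form on a line is determined by the squared length of one basis vector.
  Conjugate linearity in the second argument comes from Hermitian symmetry.\<close>

lemma hermitian_chart:
  assumes "hermitian_structure L H" "(U, \<psi>) \<in> charts L" "z \<in> U" "u \<in> fibre L z" "v \<in> fibre L z"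
  shows "H u v = \<psi> u * cnj (\<psi> v) * of_real (metric_coeff H \<psi> z)"
proof -
  let ?e = "lift \<psi> z 1"
  have e: "?e \<in> fibre L z" using assms lift_in by blast
  have sc: "H (vscale L c u) v = c * H u v" and sy: "H v u = cnj (H u v)"
    if "u \<in> fibre L z" "v \<in> fibre L z" for u v c
    using assms(1) that unfolding hermitian_structure_def by blast+
  have "H ?e ?e = of_real (metric_coeff H \<psi> z)"
    using sy[OF e e] by (simp add: metric_coeff_def complex_eq_iff)
  moreover have "H u v = \<psi> u * cnj (\<psi> v * H ?e ?e)"
    using sc[OF e, of v "\<psi> u"] sc[OF e e, of "\<psi> v"] sy[of v ?e] assms(4,5) e
      chart_expand[OF assms(2,3), of u] chart_expand[OF assms(2,3), of v] by metis
  ultimately show ?thesis by simp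
qed

lemma metric_coeff_pos:
  assumes "hermitian_structure L H" "(U, \<psi>) \<in> charts L" "z \<in> U"
  shows "metric_coeff H \<psi> z > 0"
proof -
  have "lift \<psi> z 1 \<noteq> vzero L z" using chart_lift[OF assms(2,3), of 1] chart_vzero[OF assms(2,3)] by auto
  then show ?thesis using assms lift_in[OF assms(2,3)]
    unfolding hermitian_structure_def metric_coeff_def by blast
qed

lemma smooth_metric_coeff:
  assumes "hermitian_structure L H" "(U, \<psi>) \<in> charts L"
  shows "smooth_on U (metric_coeff H \<psi>)"
  unfolding metric_coeff_def[abs_def] using assms smooth_section_frame[OF assms(2)]
  by (intro smooth_on_Re) (auto simp: hermitian_structure_def intro: chart_open)

section \<open>Existence and uniqueness of the Chern connection\<close>

text \<open>In a chart with metric coefficient \<open>h\<close> the (1,0)-part of the Chern connection is \<open>h\<inverse> \<circ> \<partial> \<circ> h\<close>.\<close>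

definition D10 :: "('e \<Rightarrow> 'e \<Rightarrow> complex) \<Rightarrow> ('e \<Rightarrow> complex) \<Rightarrow> (complex \<Rightarrow> 'e) \<Rightarrow> complex \<Rightarrow> complex" where
  "D10 H \<psi> s z = d_z (\<lambda>w. \<psi> (s w) * of_real (metric_coeff H \<psi> w)) z / of_real (metric_coeff H \<psi> z)"

lemma
  assumes "chern_connection L H D1 D2" "smooth_section L V s"
  shows smooth_section_D1: "smooth_section L V (D1 s)" and smooth_section_D2: "smooth_section L V (D2 s)"
proof -
  have "connection L D1 D2" using assms(1) unfolding chern_connection_def by (rule conjunct1)
  note * = mp[OF spec[OF spec[OF this[unfolded connection_def]]] assms(2)]
  show "smooth_section L V (D1 s)" using * by (rule conjunct1)
  show "smooth_section L V (D2 s)" using conjunct2[OF *] by (rule conjunct1)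
qed

lemma hermitian_smooth:
  "hermitian_structure L H \<Longrightarrow> smooth_section L V s \<Longrightarrow> smooth_section L V t \<Longrightarrow> smooth_on V (\<lambda>z. H (s z) (t z))"
  unfolding hermitian_structure_def by (elim conjE) (simp only: simp_thms)

text \<open>Uniqueness of the Chern connection. The (0,1)-part is prescribed; the (1,0)-part is
  found by testing metric compatibility against the frame \<open>e\<close>, whose coordinate is
  constant, so that the term with \<open>D2 e\<close> drops out.\<close>

lemma chern_connection_chart:
  assumes H: "hermitian_structure L H" and D: "chern_connection L H D1 D2"
    and s: "smooth_section L V s" and c: "(U, \<psi>) \<in> charts L" and z: "z \<in> U" "z \<in> V"
  shows "\<psi> (D2 s z) = d_zbar (\<lambda>w. \<psi> (s w)) z" "\<psi> (D1 s z) = D10 H \<psi> s z"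
proof -
  have D2: "\<psi> (D2 s z) = d_zbar (\<lambda>w. \<psi> (s w)) z" if "smooth_section L V s" "z \<in> V" for V s
    using D that c z(1) unfolding chern_connection_def by fast
  then show "\<psi> (D2 s z) = d_zbar (\<lambda>w. \<psi> (s w)) z" using s z by blast
  define e where "e = (\<lambda>w. lift \<psi> w 1)"
  define W where "W = U \<inter> V"
  have W: "open W" "z \<in> W" using c s z by (auto simp: W_def chart_open smooth_section_open)
  have e: "smooth_section L W e" and s': "smooth_section L W s"
    using smooth_section_frame[OF c] s W(1) smooth_section_subset by (auto simp: W_def e_def)
  have in1: "D1 s z \<in> fibre L z" "D2 e z \<in> fibre L z"
    using smooth_section_D1[OF D s'] smooth_section_D2[OF D e] W by (auto intro: smooth_section_in)
  have in2: "e z \<in> fibre L z" "s z \<in> fibre L z" using e s' W by (auto intro: smooth_section_in)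
  have "\<psi> (D2 e z) = d_zbar (\<lambda>w. 1) z"
    unfolding D2[OF e W(2)] by (rule d_z_cong[OF W]) (use c in \<open>auto simp: e_def W_def chart_lift\<close>)
  then have e0: "\<psi> (D2 e z) = 0" by simp
  note h = hermitian_chart[OF H c]
  have "d_z (\<lambda>w. H (s w) (e w)) z = H (D1 s z) (e z) + H (s z) (D2 e z)"
    using D s' e W unfolding chern_connection_def by blast
  also have "\<dots> = \<psi> (D1 s z) * of_real (metric_coeff H \<psi> z)"
    using c z(1) by (simp add: h[OF z(1)] in1[unfolded e_def] in2[unfolded e_def] e0[unfolded e_def] e_def chart_lift lift_in)
  also have "d_z (\<lambda>w. H (s w) (e w)) z = d_z (\<lambda>w. \<psi> (s w) * of_real (metric_coeff H \<psi> w)) z"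
    by (rule d_z_cong[OF W]) (use c s' in \<open>auto simp: h e_def chart_lift lift_in W_def smooth_section_in\<close>)
  finally show "\<psi> (D1 s z) = D10 H \<psi> s z"
    using metric_coeff_pos[OF H c z(1)] by (simp add: D10_def field_simps)
qed

text \<open>The transition function \<open>g\<close> is holomorphic, so \<open>d_zbar\<close>
  commutes with it. The metric coefficient changes by \<open>|g|^2\<close>, hence the coordinate
  times the coefficient changes by \<open>cnj (1 / g)\<close>, which is antiholomorphic and commutes
  with \<open>d_z\<close>.\<close>

lemma D10_transition:
  assumes H: "hermitian_structure L H" and s: "smooth_section L V s"
    and c: "(U, \<psi>) \<in> charts L" "(U', \<psi>') \<in> charts L" and z: "z \<in> U" "z \<in> U'" "z \<in> V"
    and e: "e \<in> fibre L z"
  shows "\<psi> e = d_zbar (\<lambda>w. \<psi> (s w)) z \<Longrightarrow> \<psi>' e = d_zbar (\<lambda>w. \<psi>' (s w)) z"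
    and "\<psi> e = D10 H \<psi> s z \<Longrightarrow> \<psi>' e = D10 H \<psi>' s z"
proof -
  obtain g where g: "g holomorphic_on (U \<inter> U')" "\<And>z. z \<in> U \<inter> U' \<Longrightarrow> g z \<noteq> 0"
      "\<And>z e. z \<in> U \<inter> U' \<Longrightarrow> e \<in> fibre L z \<Longrightarrow> \<psi>' e = g z * \<psi> e"
    using chart_transition[OF c] by metis
  define W where "W = U \<inter> U' \<inter> V"
  have W: "open W" "z \<in> W"
    using chart_open[OF c(1)] chart_open[OF c(2)] smooth_section_open[OF s] z by (auto simp: W_def)
  have gW: "g holomorphic_on W" using g(1) by (rule holomorphic_on_subset) (auto simp: W_def)
  note gz = d_zbar_holomorphic[OF gW W]
  have sW: "s w \<in> fibre L w" if "w \<in> W" for w using s that by (auto simp: W_def smooth_section_in)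
  have sd: "(\<lambda>w. \<psi> (s w)) differentiable at z"
    using smooth_section_chart[OF s c(1)] z by (auto intro: smooth_on_differentiable)
  have "d_zbar (\<lambda>w. \<psi>' (s w)) z = d_zbar (\<lambda>w. g w * \<psi> (s w)) z"
    by (rule d_z_cong[OF W]) (use g sW in \<open>auto simp: W_def\<close>)
  also have "\<dots> = g z * d_zbar (\<lambda>w. \<psi> (s w)) z"
    by (simp add: d_z_mult[OF gz(2) sd] gz(1))
  finally show "\<psi> e = d_zbar (\<lambda>w. \<psi> (s w)) z \<Longrightarrow> \<psi>' e = d_zbar (\<lambda>w. \<psi>' (s w)) z"
    using g(3) e z by simp
  have h: "of_real (metric_coeff H \<psi> w) = g w * cnj (g w) * of_real (metric_coeff H \<psi>' w)" if "w \<in> U \<inter> U'" for w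
    using hermitian_chart[OF H c(2), of w "lift \<psi> w 1" "lift \<psi> w 1"]
      hermitian_chart[OF H c(1), of w "lift \<psi> w 1" "lift \<psi> w 1"] g(3)[OF that] c that
    by (simp add: chart_lift lift_in)
  have gi: "(\<lambda>w. cnj (inverse (g w))) differentiable at z" "d_z (\<lambda>w. cnj (inverse (g w))) z = 0"
  proof -
    have "(\<lambda>w. inverse (g w)) holomorphic_on W" using g(2) by (intro holomorphic_intros gW) (auto simp: W_def)
    note i = d_zbar_holomorphic[OF this W]
    show "(\<lambda>w. cnj (inverse (g w))) differentiable at z"
      using i(2) bounded_linear.has_derivative[OF bounded_linear_cnj] unfolding differentiable_def by blast
    show "d_z (\<lambda>w. cnj (inverse (g w))) z = 0" by (simp only: d_z_cnj[OF i(2)] i(1) complex_cnj_zero)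
  qed
  have hd: "(\<lambda>w. \<psi> (s w) * of_real (metric_coeff H \<psi> w)) differentiable at z"
  proof -
    have "smooth_on W (\<lambda>w. \<psi> (s w) * of_real (metric_coeff H \<psi> w))"
      using smooth_section_chart[OF s c(1)] smooth_metric_coeff[OF H c(1)]
      by (intro smooth_on_mult smooth_on_of_real W(1)) (auto simp: W_def elim: smooth_on_subset)
    then show ?thesis using W(2) by (rule smooth_on_differentiable)
  qed
  have "d_z (\<lambda>w. \<psi>' (s w) * of_real (metric_coeff H \<psi>' w)) z
      = d_z (\<lambda>w. cnj (inverse (g w)) * (\<psi> (s w) * of_real (metric_coeff H \<psi> w))) z"
    by (rule d_z_cong[OF W]) (use g sW h in \<open>auto simp: W_def field_simps\<close>)
  also have "\<dots> = cnj (inverse (g z)) * d_z (\<lambda>w. \<psi> (s w) * of_real (metric_coeff H \<psi> w)) z"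
    by (simp only: d_z_mult[OF gi(1) hd] gi(2) mult_zero_left add_0_left)
  finally have "D10 H \<psi>' s z = g z * D10 H \<psi> s z"
    using g(2)[of z] z h[of z] metric_coeff_pos[OF H c(1) z(1)] metric_coeff_pos[OF H c(2) z(2)]
    by (simp add: D10_def field_simps)
  then show "\<psi> e = D10 H \<psi> s z \<Longrightarrow> \<psi>' e = D10 H \<psi>' s z"
    using g(3) e z by simp
qed

definition chart_at :: "complex \<Rightarrow> complex set \<times> ('e \<Rightarrow> complex)" where
  "chart_at z = (SOME c. c \<in> charts L \<and> z \<in> fst c)"

lemma chart_at: "(fst (chart_at z), snd (chart_at z)) \<in> charts L" "z \<in> fst (chart_at z)"
proof -
  have "chart_at z \<in> charts L \<and> z \<in> fst (chart_at z)"
    unfolding chart_at_def by (rule someI_ex) (use chart_cover in blast)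
  then show "(fst (chart_at z), snd (chart_at z)) \<in> charts L" "z \<in> fst (chart_at z)" by simp_all
qed

text \<open>The operators are defined pointwise through a chosen chart. By
  \<open>D10_transition\<close> they have the same local formula in every chart, and each axiom is
  then checked in one fixed chart around the point.\<close>

lemma chern_connection_exists:
  assumes H: "hermitian_structure L H"
  shows "\<exists>D1 D2. chern_connection L H D1 D2"
proof -
  define D1 where "D1 s z = lift (snd (chart_at z)) z (D10 H (snd (chart_at z)) s z)" for s z
  define D2 where "D2 s z = lift (snd (chart_at z)) z (d_zbar (\<lambda>w. snd (chart_at z) (s w)) z)" for s z
  have D1_in: "D1 s z \<in> fibre L z" and D2_in: "D2 s z \<in> fibre L z" for s z
    using lift_in[OF chart_at] by (auto simp: D1_def D2_def)
  have D1: "\<psi> (D1 s z) = D10 H \<psi> s z" and D2: "\<psi> (D2 s z) = d_zbar (\<lambda>w. \<psi> (s w)) z"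
    if "smooth_section L V s" "(U, \<psi>) \<in> charts L" "z \<in> U" "z \<in> V" for s V U \<psi> z
    using D10_transition[OF H that(1) chart_at(1) that(2) chart_at(2) that(3,4)] D1_in D2_in
      chart_lift[OF chart_at] by (simp_all add: D1_def D2_def)
  have sD: "smooth_section L V (D1 s)" "smooth_section L V (D2 s)" if s: "smooth_section L V s" for V s
  proof -
    have V: "open V" using s by (rule smooth_section_open)
    have "smooth_on (U \<inter> V) (\<lambda>z. \<psi> (D1 s z)) \<and> smooth_on (U \<inter> V) (\<lambda>z. \<psi> (D2 s z))"
      if c: "(U, \<psi>) \<in> charts L" for U \<psi>
    proof -
      have W: "open (U \<inter> V)" using V chart_open[OF c] by auto
      have h: "smooth_on (U \<inter> V) (\<lambda>w. complex_of_real (metric_coeff H \<psi> w))"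
        using smooth_metric_coeff[OF H c] by (intro smooth_on_of_real W) (auto elim: smooth_on_subset)
      have "smooth_on (U \<inter> V) (\<lambda>z. d_zbar (\<lambda>w. \<psi> (s w)) z)"
        by (intro smooth_on_d_zbar W smooth_section_chart[OF s c])
      moreover have "smooth_on (U \<inter> V) (D10 H \<psi> s)" unfolding D10_def[abs_def]
        by (intro smooth_on_divide smooth_on_d_z smooth_on_mult W smooth_section_chart[OF s c] h)
          (use metric_coeff_pos[OF H c] in force)
      ultimately show ?thesis
        using smooth_on_cong[OF W, of "\<lambda>z. \<psi> (D1 s z)" "D10 H \<psi> s"] D1[OF s c]
          smooth_on_cong[OF W, of "\<lambda>z. \<psi> (D2 s z)" "\<lambda>z. d_zbar (\<lambda>w. \<psi> (s w)) z"] D2[OF s c] by auto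
    qed
    then show "smooth_section L V (D1 s)" "smooth_section L V (D2 s)"
      using V D1_in D2_in by (auto simp: smooth_section_def)
  qed
  \<comment> \<open>All pointwise axioms are verified here in a single chart: additivity and
    Leibniz' rule for both operators (\<open>1\<close> to \<open>4\<close>), then metric
    compatibility (\<open>5\<close> and \<open>6\<close>).\<close>
  {
    fix V s t z and f :: "complex \<Rightarrow> complex"
    assume s: "smooth_section L V s" and t: "smooth_section L V t" and z: "z \<in> V"
      and f: "smooth_on V f"
    obtain U \<psi> where c: "(U, \<psi>) \<in> charts L" "z \<in> U" using chart_at by metis
    define W where "W = U \<inter> V"
    have W: "open W" "z \<in> W" using c s z by (auto simp: W_def chart_open smooth_section_open)
    define h where "h = (\<lambda>w. complex_of_real (metric_coeff H \<psi> w))"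
    define \<sigma> where "\<sigma> = (\<lambda>w. \<psi> (s w))"
    define \<tau> where "\<tau> = (\<lambda>w. \<psi> (t w))"
    have sm: "smooth_on W \<sigma>" "smooth_on W \<tau>" "smooth_on W h" "smooth_on W f"
      using smooth_section_chart[OF s c(1)] smooth_section_chart[OF t c(1)] f smooth_metric_coeff[OF H c(1)]
      by (auto simp: W_def \<sigma>_def \<tau>_def h_def elim: smooth_on_subset intro!: smooth_on_of_real W[unfolded W_def])
    have hz: "h z \<noteq> 0" using metric_coeff_pos[OF H c] by (simp add: h_def)
    have inW: "s w \<in> fibre L w" "t w \<in> fibre L w" if "w \<in> W" for w
      using that s t by (auto simp: W_def smooth_section_in)
    have add: "\<psi> (vadd L (s w) (t w)) = \<sigma> w + \<tau> w" and scale: "\<psi> (vscale L (f w) (s w)) = f w * \<sigma> w"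
      if "w \<in> W" for w
      using that c inW[OF that] by (auto simp: W_def \<sigma>_def \<tau>_def chart_vadd chart_vscale)
    have s_add: "smooth_section L W (\<lambda>w. vadd L (s w) (t w))"
    proof (rule smooth_sectionI[OF W(1)])
      have "smooth_on (U \<inter> W) (\<lambda>w. \<psi> (vadd L (s w) (t w)))"
        using smooth_on_cong[OF W(1) add] smooth_on_add[OF W(1) sm(1,2)] by (simp add: W_def Int_assoc[symmetric])
      then show "\<exists>U \<psi>. (U, \<psi>) \<in> charts L \<and> z \<in> U \<and> smooth_on (U \<inter> W) (\<lambda>w. \<psi> (vadd L (s w) (t w)))" if "z \<in> W" for z
        using c(1) that by (intro exI[of _ U] exI[of _ \<psi>]) (simp add: W_def)
    qed (use inW vadd_in in auto)
    have s_scale: "smooth_section L W (\<lambda>w. vscale L (f w) (s w))"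
    proof (rule smooth_sectionI[OF W(1)])
      have "smooth_on (U \<inter> W) (\<lambda>w. \<psi> (vscale L (f w) (s w)))"
        using smooth_on_cong[OF W(1) scale] smooth_on_mult[OF W(1) sm(4,1)] by (simp add: W_def Int_assoc[symmetric])
      then show "\<exists>U \<psi>. (U, \<psi>) \<in> charts L \<and> z \<in> U \<and> smooth_on (U \<inter> W) (\<lambda>w. \<psi> (vscale L (f w) (s w)))" if "z \<in> W" for z
        using c(1) that by (intro exI[of _ U] exI[of _ \<psi>]) (simp add: W_def)
    qed (use inW vscale_in in auto)
    note d = smooth_on_differentiable[OF _ W(2)]
    have \<sigma>h: "smooth_on W (\<lambda>w. \<sigma> w * h w)" and \<tau>h: "smooth_on W (\<lambda>w. \<tau> w * h w)"
      using smooth_on_mult[OF W(1)] sm by auto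
    have D1s: "\<psi> (D1 s z) = d_z (\<lambda>w. \<sigma> w * h w) z / h z" "\<psi> (D2 s z) = d_zbar \<sigma> z"
      using D1[OF s c z] D2[OF s c z] by (simp_all add: D10_def \<sigma>_def h_def)
    have D1t: "\<psi> (D1 t z) = d_z (\<lambda>w. \<tau> w * h w) z / h z" "\<psi> (D2 t z) = d_zbar \<tau> z"
      using D1[OF t c z] D2[OF t c z] by (simp_all add: D10_def \<tau>_def h_def)
    note inj = chart_inject[OF c]
    have 1: "D1 (\<lambda>w. vadd L (s w) (t w)) z = vadd L (D1 s z) (D1 t z)"
    proof (rule inj)
      have "\<psi> (D1 (\<lambda>w. vadd L (s w) (t w)) z) = d_z (\<lambda>w. \<psi> (vadd L (s w) (t w)) * h w) z / h z"
        using D1[OF s_add c W(2)] by (simp add: D10_def h_def)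
      also have "d_z (\<lambda>w. \<psi> (vadd L (s w) (t w)) * h w) z = d_z (\<lambda>w. \<sigma> w * h w + \<tau> w * h w) z"
        by (rule d_z_cong[OF W]) (simp add: add algebra_simps)
      also have "\<dots> = d_z (\<lambda>w. \<sigma> w * h w) z + d_z (\<lambda>w. \<tau> w * h w) z" by (intro d_z_add d \<sigma>h \<tau>h)
      finally show "\<psi> (D1 (\<lambda>w. vadd L (s w) (t w)) z) = \<psi> (vadd L (D1 s z) (D1 t z))"
        using D1_in by (simp add: chart_vadd[OF c] D1s D1t add_divide_distrib)
    qed (simp_all add: D1_in vadd_in)
    have 2: "D2 (\<lambda>w. vadd L (s w) (t w)) z = vadd L (D2 s z) (D2 t z)"
    proof (rule inj)
      have "\<psi> (D2 (\<lambda>w. vadd L (s w) (t w)) z) = d_zbar (\<lambda>w. \<sigma> w + \<tau> w) z"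
        unfolding D2[OF s_add c W(2)] by (rule d_z_cong[OF W]) (simp add: add)
      also have "\<dots> = d_zbar \<sigma> z + d_zbar \<tau> z" by (intro d_z_add d sm)
      finally show "\<psi> (D2 (\<lambda>w. vadd L (s w) (t w)) z) = \<psi> (vadd L (D2 s z) (D2 t z))"
        using D2_in by (simp add: chart_vadd[OF c] D1s D1t)
    qed (simp_all add: D2_in vadd_in)
    have 3: "D1 (\<lambda>w. vscale L (f w) (s w)) z = vadd L (vscale L (d_z f z) (s z)) (vscale L (f z) (D1 s z))"
    proof (rule inj)
      have "\<psi> (D1 (\<lambda>w. vscale L (f w) (s w)) z) = d_z (\<lambda>w. \<psi> (vscale L (f w) (s w)) * h w) z / h z"
        using D1[OF s_scale c W(2)] by (simp add: D10_def h_def)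
      also have "d_z (\<lambda>w. \<psi> (vscale L (f w) (s w)) * h w) z = d_z (\<lambda>w. f w * (\<sigma> w * h w)) z"
        by (rule d_z_cong[OF W]) (simp add: scale algebra_simps)
      also have "\<dots> = d_z f z * (\<sigma> z * h z) + f z * d_z (\<lambda>w. \<sigma> w * h w) z" by (intro d_z_mult d sm \<sigma>h)
      finally show "\<psi> (D1 (\<lambda>w. vscale L (f w) (s w)) z) = \<psi> (vadd L (vscale L (d_z f z) (s z)) (vscale L (f z) (D1 s z)))"
        using D1_in inW[OF W(2)] hz by (simp add: chart_vadd[OF c] chart_vscale[OF c] vscale_in D1s \<sigma>_def field_simps)
    qed (use inW[OF W(2)] in \<open>simp_all add: D1_in vadd_in vscale_in\<close>)
    have 4: "D2 (\<lambda>w. vscale L (f w) (s w)) z = vadd L (vscale L (d_zbar f z) (s z)) (vscale L (f z) (D2 s z))"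
    proof (rule inj)
      have "\<psi> (D2 (\<lambda>w. vscale L (f w) (s w)) z) = d_zbar (\<lambda>w. f w * \<sigma> w) z"
        unfolding D2[OF s_scale c W(2)] by (rule d_z_cong[OF W]) (simp add: scale)
      also have "\<dots> = d_zbar f z * \<sigma> z + f z * d_zbar \<sigma> z" by (intro d_z_mult d sm)
      finally show "\<psi> (D2 (\<lambda>w. vscale L (f w) (s w)) z) = \<psi> (vadd L (vscale L (d_zbar f z) (s z)) (vscale L (f z) (D2 s z)))"
        using D2_in inW[OF W(2)] by (simp add: chart_vadd[OF c] chart_vscale[OF c] vscale_in D1s \<sigma>_def)
    qed (use inW[OF W(2)] in \<open>simp_all add: D2_in vadd_in vscale_in\<close>)
    \<comment> \<open>The factor \<open>h\<close> is attached to \<open>\<sigma>\<close> or to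
      \<open>\<tau>\<close> depending on which section receives the (1,0)-derivative, since that
      derivative acts on the coordinate times \<open>h\<close>.\<close>
    have Hst: "H (s w) (t w) = \<sigma> w * h w * cnj (\<tau> w)" "H (s w) (t w) = \<sigma> w * cnj (\<tau> w * h w)" if "w \<in> W" for w
      using hermitian_chart[OF H c(1)] inW[OF that] that by (auto simp: W_def \<sigma>_def \<tau>_def h_def)
    have cnj_sm: "smooth_on W (\<lambda>w. cnj (\<tau> w))" "smooth_on W (\<lambda>w. cnj (\<tau> w * h w))"
      by (intro smooth_on_cnj W sm \<tau>h)+
    note Hz = hermitian_chart[OF H c]
    have "d_z (\<lambda>w. H (s w) (t w)) z = d_z (\<lambda>w. \<sigma> w * h w * cnj (\<tau> w)) z"
      by (rule d_z_cong[OF W]) (simp add: Hst(1))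
    also have "\<dots> = d_z (\<lambda>w. \<sigma> w * h w) z * cnj (\<tau> z) + \<sigma> z * h z * cnj (d_zbar \<tau> z)"
      using d_z_mult(1)[OF d[OF \<sigma>h] d[OF cnj_sm(1)]] by (simp only: d_z_cnj(1)[OF d[OF sm(2)]])
    also have "\<dots> = H (D1 s z) (t z) + H (s z) (D2 t z)"
      using hz inW[OF W(2)] by (simp add: Hz D1_in D2_in D1s D1t h_def[symmetric] \<sigma>_def[symmetric] \<tau>_def[symmetric])
        (simp add: h_def \<sigma>_def \<tau>_def)
    finally have 5: "d_z (\<lambda>w. H (s w) (t w)) z = H (D1 s z) (t z) + H (s z) (D2 t z)" .
    have "d_zbar (\<lambda>w. H (s w) (t w)) z = d_zbar (\<lambda>w. \<sigma> w * cnj (\<tau> w * h w)) z"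
      by (rule d_z_cong[OF W]) (simp only: Hst(2))
    also have "\<dots> = d_zbar \<sigma> z * cnj (\<tau> z * h z) + \<sigma> z * cnj (d_z (\<lambda>w. \<tau> w * h w) z)"
      using d_z_mult(2)[OF d[OF sm(1)] d[OF cnj_sm(2)]] by (simp only: d_z_cnj(2)[OF d[OF \<tau>h]])
    also have "\<dots> = H (D2 s z) (t z) + H (s z) (D1 t z)"
      using hz inW[OF W(2)] by (simp add: Hz D1_in D2_in D1s D1t h_def \<sigma>_def \<tau>_def)
    finally have 6: "d_zbar (\<lambda>w. H (s w) (t w)) z = H (D2 s z) (t z) + H (s z) (D1 t z)" .
    note 1 2 3 4 5 6
  }
  note * = this
  have "connection L D1 D2"
    unfolding connection_def
  proof (intro allI impI conjI ballI)
    fix V s assume s: "smooth_section L V s"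
    show "smooth_section L V (D1 s)" "smooth_section L V (D2 s)" using sD[OF s] .
    fix z assume z: "z \<in> V"
    show "D1 (\<lambda>w. vadd L (s w) (t w)) z = vadd L (D1 s z) (D1 t z)"
      "D2 (\<lambda>w. vadd L (s w) (t w)) z = vadd L (D2 s z) (D2 t z)" if "smooth_section L V t" for t
      using *(1,2)[OF s that z smooth_on_const] .
    show "D1 (\<lambda>w. vscale L (f w) (s w)) z = vadd L (vscale L (d_z f z) (s z)) (vscale L (f z) (D1 s z))"
      "D2 (\<lambda>w. vscale L (f w) (s w)) z = vadd L (vscale L (d_zbar f z) (s z)) (vscale L (f z) (D2 s z))"
      if "smooth_on V f" for f
      using *(3,4)[OF s s z that] .
  qed
  moreover have "\<forall>(U, \<psi>)\<in>charts L. \<forall>z\<in>U \<inter> V. \<psi> (D2 s z) = d_zbar (\<lambda>w. \<psi> (s w)) z" if "smooth_section L V s" for V s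
    using D2[OF that] by blast
  ultimately have "chern_connection L H D1 D2"
    unfolding chern_connection_def using *(5,6)[OF _ _ _ smooth_on_const] by (intro conjI allI impI ballI) blast+
  then show ?thesis by blast
qed

text \<open>Evaluating the commutator on the frame forces \<open>F = - d_zbar \<theta>\<close>, and
  the same function works for every section. As \<open>\<theta>\<close> is \<open>d_z\<close> of the
  logarithm of the metric coefficient, a quarter of a Laplacian appears.\<close>

lemma chern_curvature_chart:
  assumes H: "hermitian_structure L H" and c: "(U, \<psi>) \<in> charts L" "z \<in> U"
  shows "chern_curvature L H z = of_real (- laplacian (\<lambda>w. ln (metric_coeff H \<psi> w)) z / 4)"
proof -
  \<comment> \<open>The connection form in the frame of the chart:
    \<open>D1 e = \<theta> e\<close>.\<close>
  define \<theta> where "\<theta> \<psi> w = d_z (\<lambda>w. complex_of_real (metric_coeff H \<psi> w)) w / of_real (metric_coeff H \<psi> w)" for \<psi> w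
  have h_smooth: "smooth_on U (\<lambda>w. complex_of_real (metric_coeff H \<psi> w))" if "(U, \<psi>) \<in> charts L" for U \<psi>
    using smooth_metric_coeff[OF H that] chart_open[OF that] by (intro smooth_on_of_real)
  have h_nz: "complex_of_real (metric_coeff H \<psi> w) \<noteq> 0" if "(U, \<psi>) \<in> charts L" "w \<in> U" for U \<psi> w
    using metric_coeff_pos[OF H that] by simp
  have \<theta>_smooth: "smooth_on U (\<theta> \<psi>)" if "(U, \<psi>) \<in> charts L" for U \<psi>
    unfolding \<theta>_def[abs_def] using h_nz[OF that] chart_open[OF that] h_smooth[OF that]
    by (intro smooth_on_divide smooth_on_d_z) auto
  \<comment> \<open>On the frame \<open>D2 e = 0\<close>, so the commutator reduces to minus
    \<open>D2 (D1 e)\<close>. The claim covers every chart and every candidate \<open>F\<close>,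
    which gives both the uniqueness in the definite description and the independence of the
    chart.\<close>
  have unique: "F z = - d_zbar (\<theta> \<psi>) z"
    if D: "chern_connection L H D1 D2"
      and F: "\<forall>V s. smooth_section L V s \<longrightarrow> (\<forall>z\<in>V. D1 (D2 s) z = vadd L (D2 (D1 s) z) (vscale L (F z) (s z)))"
      and c: "(U, \<psi>) \<in> charts L" "z \<in> U" for D1 D2 F U \<psi> z
  proof -
    define e where "e = (\<lambda>w. lift \<psi> w 1)"
    have U: "open U" using chart_open c by blast
    have e: "smooth_section L U e" "smooth_section L U (D1 e)" "smooth_section L U (D2 e)"
      using smooth_section_frame[OF c(1)] smooth_section_D1[OF D] smooth_section_D2[OF D] unfolding e_def by blast+
    have D11: "smooth_section L U (D2 (D1 e))" using smooth_section_D2[OF D] e by blast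
    note C = chern_connection_chart[OF H D _ c(1)]
    have e1: "\<psi> (e w) = 1" if "w \<in> U" for w using that c by (simp add: e_def chart_lift)
    have D2e: "\<psi> (D2 e w) = 0" if "w \<in> U" for w
      unfolding C(1)[OF e(1) that that] using d_z_cong(2)[OF U that e1] by simp
    have D1e: "\<psi> (D1 e w) = \<theta> \<psi> w" if "w \<in> U" for w
      unfolding C(2)[OF e(1) that that] D10_def \<theta>_def
      using d_z_cong(1)[OF U that, of "\<lambda>w. \<psi> (e w) * of_real (metric_coeff H \<psi> w)"] e1 by simp
    have "\<psi> (D1 (D2 e) z) = 0"
      unfolding C(2)[OF e(3) c(2) c(2)] D10_def
      using d_z_cong(1)[OF U c(2), of "\<lambda>w. \<psi> (D2 e w) * of_real (metric_coeff H \<psi> w)" "\<lambda>_. 0"] D2e by simp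
    moreover have "\<psi> (D2 (D1 e) z) = d_zbar (\<theta> \<psi>) z"
      unfolding C(1)[OF e(2) c(2) c(2)] by (rule d_z_cong[OF U c(2)]) (rule D1e)
    moreover have "\<psi> (D1 (D2 e) z) = \<psi> (D2 (D1 e) z) + F z * \<psi> (e z)"
      using F e(1) c D11 by (simp add: chart_vadd[OF c] chart_vscale[OF c] vscale_in smooth_section_in)
    ultimately show ?thesis using e1[OF c(2)] by (simp add: add_eq_0_iff)
  qed
  define F where "F z = - d_zbar (\<theta> (snd (chart_at z))) z" for z
  obtain D1 D2 where D: "chern_connection L H D1 D2" using chern_connection_exists[OF H] by blast
  have exF: "D1 (D2 s) z = vadd L (D2 (D1 s) z) (vscale L (F z) (s z))"
    if s: "smooth_section L V s" and z: "z \<in> V" for V s z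
  proof -
    obtain U \<psi> where c: "(U, \<psi>) \<in> charts L" "z \<in> U" and Fz: "F z = - d_zbar (\<theta> \<psi>) z"
      using chart_at[of z] F_def by metis
    define W where "W = U \<inter> V"
    have W: "open W" "z \<in> W" using c s z by (auto simp: W_def chart_open smooth_section_open)
    have Ds: "smooth_section L V (D1 s)" "smooth_section L V (D2 s)"
      "smooth_section L V (D1 (D2 s))" "smooth_section L V (D2 (D1 s))"
      using smooth_section_D1[OF D] smooth_section_D2[OF D] s by blast+
    note C = chern_connection_chart[OF H D _ c(1)]
    define h where "h = (\<lambda>w. complex_of_real (metric_coeff H \<psi> w))"
    define \<sigma> where "\<sigma> = (\<lambda>w. \<psi> (s w))"
    have sm: "smooth_on W \<sigma>" "smooth_on W h" "smooth_on W (\<theta> \<psi>)"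
      using smooth_section_chart[OF s c(1)] h_smooth[OF c(1)] \<theta>_smooth[OF c(1)]
      by (auto simp: W_def \<sigma>_def h_def elim: smooth_on_subset)
    have sm2: "smooth_on W (d_z \<sigma>)" "smooth_on W (d_zbar \<sigma>)" "smooth_on W (\<lambda>w. \<sigma> w * \<theta> \<psi> w)"
      using sm W by (auto intro: smooth_on_d_z smooth_on_d_zbar smooth_on_mult)
    note d = smooth_on_differentiable[OF _ W(2)]
    have hz: "h w \<noteq> 0" if "w \<in> W" for w using that h_nz[OF c(1)] by (auto simp: W_def h_def)
    have \<theta>: "\<theta> \<psi> w = d_z h w / h w" for w by (simp add: \<theta>_def h_def)
    have "\<psi> (D1 (D2 s) z) = d_z (\<lambda>w. \<psi> (D2 s w) * h w) z / h z"
      unfolding C(2)[OF Ds(2) c(2) z] D10_def h_def ..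
    also have "d_z (\<lambda>w. \<psi> (D2 s w) * h w) z = d_z (\<lambda>w. d_zbar \<sigma> w * h w) z"
      by (rule d_z_cong[OF W]) (simp add: C(1)[OF s] W_def \<sigma>_def)
    also have "\<dots> = d_z (d_zbar \<sigma>) z * h z + d_zbar \<sigma> z * d_z h z" by (intro d_z_mult d sm sm2)
    finally have 1: "\<psi> (D1 (D2 s) z) = d_z (d_zbar \<sigma>) z + d_zbar \<sigma> z * \<theta> \<psi> z"
      using hz[OF W(2)] by (simp add: \<theta> field_simps)
    have "\<psi> (D2 (D1 s) z) = d_zbar (\<lambda>w. d_z \<sigma> w + \<sigma> w * \<theta> \<psi> w) z"
      unfolding C(1)[OF Ds(1) c(2) z]
    proof (rule d_z_cong[OF W])
      fix w assume w: "w \<in> W"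
      have "\<psi> (D1 s w) = d_z (\<lambda>w. \<sigma> w * h w) w / h w"
        using w C(2)[OF s, of w] by (simp add: W_def D10_def h_def \<sigma>_def)
      also have "d_z (\<lambda>w. \<sigma> w * h w) w = d_z \<sigma> w * h w + \<sigma> w * d_z h w"
        by (intro d_z_mult smooth_on_differentiable[OF _ w] sm)
      finally show "\<psi> (D1 s w) = d_z \<sigma> w + \<sigma> w * \<theta> \<psi> w" using hz[OF w] by (simp add: \<theta> field_simps)
    qed
    also have "\<dots> = d_zbar (d_z \<sigma>) z + d_zbar (\<lambda>w. \<sigma> w * \<theta> \<psi> w) z" by (intro d_z_add d sm2)
    also have "d_zbar (\<lambda>w. \<sigma> w * \<theta> \<psi> w) z = d_zbar \<sigma> z * \<theta> \<psi> z + \<sigma> z * d_zbar (\<theta> \<psi>) z" by (intro d_z_mult d sm)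
    finally have 2: "\<psi> (D2 (D1 s) z) = d_zbar (d_z \<sigma>) z + (d_zbar \<sigma> z * \<theta> \<psi> z + \<sigma> z * d_zbar (\<theta> \<psi>) z)" .
    \<comment> \<open>The first-order terms of \<open>1\<close> and \<open>2\<close> already agree;
      symmetry of second derivatives removes the second-order ones and leaves only
      \<open>\<sigma> * d_zbar \<theta>\<close>.\<close>
    have "d_zbar (d_z \<sigma>) z = d_z (d_zbar \<sigma>) z"
      using d_z_d_zbar[OF W smooth_on_imp_C_on[OF sm(1)]] by (rule trans[OF _ sym])
    then have "\<psi> (D1 (D2 s) z) = \<psi> (vadd L (D2 (D1 s) z) (vscale L (F z) (s z)))"
      using Ds(4) s z by (simp add: chart_vadd[OF c] chart_vscale[OF c] vscale_in smooth_section_in 1 2 Fz \<sigma>_def)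
    then show ?thesis
      using Ds s z by (intro chart_inject[OF c]) (auto simp: smooth_section_in vadd_in vscale_in)
  qed
  have "chern_curvature L H = F"
    unfolding chern_curvature_def
  proof (rule the_equality)
    show "\<exists>D1 D2. chern_connection L H D1 D2 \<and> (\<forall>V s. smooth_section L V s \<longrightarrow>
        (\<forall>z\<in>V. D1 (D2 s) z = vadd L (D2 (D1 s) z) (vscale L (F z) (s z))))"
      using D exF by blast
    fix G assume "\<exists>D1 D2. chern_connection L H D1 D2 \<and> (\<forall>V s. smooth_section L V s \<longrightarrow>
        (\<forall>z\<in>V. D1 (D2 s) z = vadd L (D2 (D1 s) z) (vscale L (G z) (s z))))"
    then obtain D1' D2' where D': "chern_connection L H D1' D2'" "\<forall>V s. smooth_section L V s \<longrightarrow>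
        (\<forall>z\<in>V. D1' (D2' s) z = vadd L (D2' (D1' s) z) (vscale L (G z) (s z)))" by blast
    show "G = F" using unique[OF D' chart_at] by (auto simp: F_def)
  qed
  \<comment> \<open>Applying \<open>unique\<close> to \<open>F\<close> itself passes from the chosen
    chart at \<open>z\<close> to the given one.\<close>
  then have "chern_curvature L H z = - d_zbar (\<theta> \<psi>) z"
    using unique[OF D _ c, of F] exF by simp
  also have "d_zbar (\<theta> \<psi>) z = d_zbar (d_z (\<lambda>w. complex_of_real (ln (metric_coeff H \<psi> w)))) z"
  proof (rule d_z_cong[OF chart_open[OF c(1)] c(2)])
    fix w assume w: "w \<in> U"
    obtain G where G: "(metric_coeff H \<psi> has_derivative G) (at w)"
      using smooth_on_differentiable[OF smooth_metric_coeff[OF H c(1)] w] by (auto simp: differentiable_def)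
    have p: "0 < metric_coeff H \<psi> w" using metric_coeff_pos[OF H c(1) w] .
    note G1 = bounded_linear.has_derivative[OF bounded_linear_of_real[where 'a=complex] G]
    note G2 = bounded_linear.has_derivative[OF bounded_linear_of_real[where 'a=complex] has_derivative_ln[OF p G]]
    show "\<theta> \<psi> w = d_z (\<lambda>w. complex_of_real (ln (metric_coeff H \<psi> w))) w"
      using p by (simp add: \<theta>_def d_z_eq(1)[OF G1] d_z_eq(1)[OF G2] field_simps)
  qed
  also have "\<dots> = of_real (laplacian (\<lambda>w. ln (metric_coeff H \<psi> w)) z / 4)"
    using smooth_on_ln[OF chart_open[OF c(1)] smooth_metric_coeff[OF H c(1)] metric_coeff_pos[OF H c(1)]]
    by (intro d_zbar_d_z_of_real[OF chart_open[OF c(1)] c(2)] smooth_on_imp_C_on)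
  finally show ?thesis by simp
qed

lemma chern_curvature_real_smooth:
  assumes H: "hermitian_structure L H"
  shows "of_real (Re (chern_curvature L H z)) = chern_curvature L H z"
    and "smooth_on UNIV (\<lambda>z. Re (chern_curvature L H z))"
proof -
  show "of_real (Re (chern_curvature L H z)) = chern_curvature L H z"
    using chern_curvature_chart[OF H chart_at] by (metis Re_complex_of_real)
  show "smooth_on UNIV (\<lambda>z. Re (chern_curvature L H z))"
  proof (rule smooth_on_local)
    fix z
    obtain U \<psi> where c: "(U, \<psi>) \<in> charts L" "z \<in> U" using chart_at by metis
    note U = chart_open[OF c(1)]
    have "smooth_on U (\<lambda>z. (- 1 / 4) * laplacian (\<lambda>w. ln (metric_coeff H \<psi> w)) z)"
      by (intro smooth_on_mult smooth_on_const smooth_on_laplacian smooth_on_ln U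
          smooth_metric_coeff[OF H c(1)] metric_coeff_pos[OF H c(1)])
    then have "smooth_on U (\<lambda>z. Re (chern_curvature L H z))"
      using smooth_on_cong[OF U, of "\<lambda>z. Re (chern_curvature L H z)"] chern_curvature_chart[OF H c(1)] by simp
    then show "\<exists>V. open V \<and> z \<in> V \<and> smooth_on V (\<lambda>z. Re (chern_curvature L H z))"
      using U c by blast
  qed
qed

lemma smooth_norm_sq:
  assumes "hermitian_structure L H" "smooth_section L UNIV s"
  shows "smooth_on UNIV (norm_sq H s)"
  unfolding norm_sq_def[abs_def] using hermitian_smooth[OF assms(1) assms(2) assms(2)] by (rule smooth_on_Re[OF open_UNIV])

lemma norm_sq_nonneg:
  assumes "hermitian_structure L H" "smooth_section L UNIV s"
  shows "0 \<le> norm_sq H s z"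
  using hermitian_chart[OF assms(1) chart_at, of "s z" z "s z"] smooth_section_in[OF assms(2), of z]
    metric_coeff_pos[OF assms(1) chart_at, of z]
  by (simp add: norm_sq_def complex_mult_cnj)

section \<open>Conformal change of the Hermitian structure\<close>

definition conformal :: "(complex \<Rightarrow> real) \<Rightarrow> ('e \<Rightarrow> 'e \<Rightarrow> complex) \<Rightarrow> 'e \<Rightarrow> 'e \<Rightarrow> complex" where
  "conformal f K e e' = of_real (exp (f (proj L e))) * K e e'"

lemma conformal_fibre: "e \<in> fibre L z \<Longrightarrow> conformal f K e e' = of_real (exp (f z)) * K e e'"
  by (simp add: conformal_def fibre_def)

lemma hermitian_conformal:
  assumes K: "hermitian_structure L K" and f: "smooth_on UNIV f"
  shows "hermitian_structure L (conformal f K)"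
  unfolding hermitian_structure_def
proof (intro conjI allI ballI impI)
  fix z u v c assume uv: "u \<in> fibre L z" "v \<in> fibre L z"
  have k: "K v u = cnj (K u v)" "K (vscale L c u) v = c * K u v" "u \<noteq> vzero L z \<Longrightarrow> Re (K u u) > 0"
    using K uv unfolding hermitian_structure_def by blast+
  show "conformal f K v u = cnj (conformal f K u v)" using uv k by (simp add: conformal_fibre[of _ z])
  show "conformal f K (vscale L c u) v = c * conformal f K u v"
    using uv k vscale_in[OF uv(1)] by (simp add: conformal_fibre[of _ z])
  show "0 < Re (conformal f K u u)" if "u \<noteq> vzero L z" using uv k(3)[OF that] by (simp add: conformal_fibre[of _ z])
  fix w assume w: "w \<in> fibre L z"
  have "K (vadd L u w) v = K u v + K w v" using K uv w unfolding hermitian_structure_def by blast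
  then show "conformal f K (vadd L u w) v = conformal f K u v + conformal f K w v"
    using uv w vadd_in[OF uv(1) w] by (simp add: conformal_fibre[of _ z] distrib_left)
next
  fix V s t assume s: "smooth_section L V s" and t: "smooth_section L V t"
  have V: "open V" using s by (rule smooth_section_open)
  have "smooth_on V (\<lambda>z. K (s z) (t z))" using K s t unfolding hermitian_structure_def by blast
  then have "smooth_on V (\<lambda>z. of_real (exp (f z)) * K (s z) (t z))"
    by (intro smooth_on_mult smooth_on_of_real smooth_on_exp V smooth_on_subset[OF f]) auto
  then show "smooth_on V (\<lambda>z. conformal f K (s z) (t z))"
    using smooth_on_cong[OF V, of "\<lambda>z. conformal f K (s z) (t z)"] by (simp add: conformal_fibre[OF smooth_section_in[OF s]])
qed

text \<open>The metric coefficient is multiplied by \<open>exp f\<close>, so its logarithm gains the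
  summand \<open>f\<close>.\<close>

lemma chern_curvature_conformal:
  assumes K: "hermitian_structure L K" and f: "smooth_on UNIV f"
  shows "chern_curvature L (conformal f K) z = chern_curvature L K z - of_real (laplacian f z / 4)"
proof -
  obtain U \<psi> where c: "(U, \<psi>) \<in> charts L" "z \<in> U" using chart_at by metis
  note U = chart_open[OF c(1)]
  have sm: "smooth_on U (\<lambda>w. ln (metric_coeff K \<psi> w))"
    by (intro smooth_on_ln U smooth_metric_coeff[OF K c(1)] metric_coeff_pos[OF K c(1)])
  have "laplacian (\<lambda>w. ln (metric_coeff (conformal f K) \<psi> w)) z = laplacian (\<lambda>w. 1 * f w + 1 * ln (metric_coeff K \<psi> w)) z"
  proof (rule laplacian_cong[OF U c(2)])
    fix w assume w: "w \<in> U"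
    have "metric_coeff (conformal f K) \<psi> w = exp (f w) * metric_coeff K \<psi> w"
      using lift_in[OF c(1) w] by (simp add: metric_coeff_def conformal_fibre[of _ w])
    then show "ln (metric_coeff (conformal f K) \<psi> w) = 1 * f w + 1 * ln (metric_coeff K \<psi> w)"
      using metric_coeff_pos[OF K c(1) w] by (simp add: ln_mult)
  qed
  also have "\<dots> = laplacian f z + laplacian (\<lambda>w. ln (metric_coeff K \<psi> w)) z"
    using laplacian_linear_comb[OF U c(2), of f "\<lambda>w. ln (metric_coeff K \<psi> w)" 1 1]
      smooth_on_imp_C_on[OF smooth_on_subset[OF f]] smooth_on_imp_C_on[OF sm] by simp
  finally have e: "laplacian (\<lambda>w. ln (metric_coeff (conformal f K) \<psi> w)) z
    = laplacian f z + laplacian (\<lambda>w. ln (metric_coeff K \<psi> w)) z" .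
  show ?thesis
    unfolding chern_curvature_chart[OF K c] chern_curvature_chart[OF hermitian_conformal[OF K f] c] e
      of_real_diff[symmetric] by (simp add: field_simps)
qed

lemma norm_sq_conformal:
  "smooth_section L UNIV s \<Longrightarrow> norm_sq (conformal f K) s z = exp (f z) * norm_sq K s z"
  by (simp add: norm_sq_def conformal_fibre[OF smooth_section_in])

end

section \<open>Integrable weights on the plane\<close>

text \<open>The condition \<open>a < 1\<close> controls the singularity at the origin,
  \<open>1 < a + 2 * b\<close> the tail. The comparison function drops the second factor up to
  \<open>1\<close> and replaces \<open>1 + x^2\<close> by \<open>x^2\<close> beyond; the negative
  half-line follows by reflection.\<close>

lemma integrable_powr_weight:
  assumes "0 \<le> a" "a < 1" "0 \<le> b" "1 < a + 2 * b"
  shows "integrable lborel (\<lambda>x::real. \<bar>x\<bar> powr (-a) * (1 + x\<^sup>2) powr (-b))"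
proof -
  define g where "g x = indicator {0..1} x * x powr (-a) + indicator {1..} x * x powr (-(a + 2 * b))" for x :: real
  have "integrable lborel (\<lambda>x::real. indicator {0..1} x * x powr (-a))"
  proof -
    have "(\<lambda>x::real. x powr (-a)) absolutely_integrable_on {0..1}"
      by (intro nonnegative_absolutely_integrable_1 integrable_on_powr_from_0) (use assms in auto)
    then show ?thesis by (simp add: set_integrable_def integrable_completion)
  qed
  moreover have "integrable lborel (\<lambda>x::real. indicator {1..} x * x powr (-(a + 2 * b)))"
  proof -
    have "(\<lambda>x::real. x powr (-(a + 2 * b))) integrable_on {1..}"
      using has_integral_powr_to_inf[of "-(a + 2 * b)" 1] assms by (auto simp: integrable_on_def)
    then have "(\<lambda>x::real. x powr (-(a + 2 * b))) absolutely_integrable_on {1..}"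
      by (intro nonnegative_absolutely_integrable_1) auto
    then show ?thesis by (simp add: set_integrable_def integrable_completion)
  qed
  ultimately have g: "integrable lborel g" unfolding g_def[abs_def] by (rule Bochner_Integration.integrable_add)
  have g': "integrable lborel (\<lambda>x. g (- x))" using lborel_integrable_real_affine[OF g, of "-1" 0] by simp
  have g0: "0 \<le> g x" for x by (simp add: g_def)
  have pos: "\<bar>x\<bar> powr (-a) * (1 + x\<^sup>2) powr (-b) \<le> g x" if "x > 0" for x :: real
  proof (cases "x \<le> 1")
    case True
    have "(1 + x\<^sup>2) powr (-b) \<le> 1" using powr_mono[of "-b" 0 "1 + x\<^sup>2"] assms
      by (metis le_add_same_cancel1 neg_le_0_iff_le powr_zero_eq_one zero_le_power2 add_pos_nonneg less_numeral_extra(1) order_less_irrefl)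
    then have "\<bar>x\<bar> powr (-a) * (1 + x\<^sup>2) powr (-b) \<le> \<bar>x\<bar> powr (-a)" by (intro mult_left_le) auto
    then show ?thesis using True that by (auto simp: g_def indicator_def)
  next
    case False
    have "(1 + x\<^sup>2) powr (-b) \<le> (x\<^sup>2) powr (-b)" using that assms by (intro powr_mono2') auto
    also have "(x\<^sup>2) powr (-b) = x powr (- (2 * b))" using that by (simp add: powr_powr flip: powr_numeral)
    finally have "\<bar>x\<bar> powr (-a) * (1 + x\<^sup>2) powr (-b) \<le> x powr (-a) * x powr (- (2 * b))"
      using that by (intro mult_mono) auto
    then show ?thesis using False by (simp add: g_def flip: powr_add)
  qed
  \<comment> \<open>The case \<open>x = 0\<close> is trivial because \<open>0 powr (-a)\<close> is
    \<open>0\<close>.\<close>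
  have "norm (\<bar>x\<bar> powr (-a) * (1 + x\<^sup>2) powr (-b)) \<le> norm (g x + g (- x))" for x :: real
  proof (cases "x = 0")
    case False
    then consider "x > 0" | "- x > 0" by linarith
    then show ?thesis using pos[of x] pos[of "-x"] g0[of x] g0[of "- x"] by cases auto
  qed auto
  then show ?thesis
    by (intro Bochner_Integration.integrable_bound[OF Bochner_Integration.integrable_add[OF g g']]) auto
qed

text \<open>By definition \<open>lborel\<close> on the plane is the image of a product of real
  Lebesgue measures under the coordinates, here indexed by \<open>1\<close> and
  \<open>\<i>\<close>.\<close>

lemma integrable_complex_product:
  fixes f g :: "real \<Rightarrow> real"
  assumes "integrable lborel f" "integrable lborel g"
  shows "integrable lborel (\<lambda>z::complex. f (Re z) * g (Im z))"
proof -
  have [measurable]: "f \<in> borel_measurable borel" "g \<in> borel_measurable borel"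
    using assms by (auto dest: borel_measurable_integrable)
  interpret product_sigma_finite "\<lambda>_::complex. lborel :: real measure" by standard
  have B: "(Basis :: complex set) = {1, \<i>}" by (simp add: Basis_complex_def)
  have "integrable (Pi\<^sub>M {1, \<i>} (\<lambda>_::complex. lborel :: real measure)) (\<lambda>x. \<Prod>i\<in>{1, \<i>}. (if i = 1 then f else g) (x i))"
    by (rule product_integrable_prod) (use assms in auto)
  then have "integrable (Pi\<^sub>M Basis (\<lambda>_::complex. interval_measure (\<lambda>x. x)))
      (\<lambda>x. f (Re (\<Sum>b\<in>Basis. x b *\<^sub>R b)) * g (Im (\<Sum>b\<in>Basis. x b *\<^sub>R b)))"
    by (simp add: B lborel_eq_real[symmetric])
  then show ?thesis
    by (subst lborel_def, subst integrable_distr_eq) auto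
qed

text \<open>The axes are hyperplanes, hence null. Off them \<open>2 |x| |y| \<le> |t|^2\<close> may
  be raised to a negative power.\<close>

lemma AE_Re_Im_nonzero: "AE z in lborel. Re z \<noteq> 0 \<and> Im z \<noteq> 0"
proof -
  have *: "AE z in lborel. v \<bullet> z \<noteq> 0" if "v \<noteq> 0" for v :: complex
  proof -
    have "{z. v \<bullet> z = 0} \<in> null_sets lebesgue"
      using negligible_hyperplane[of v 0] that by (simp add: negligible_iff_null_sets)
    then have "AE z in lebesgue. v \<bullet> z \<noteq> 0" using AE_not_in by force
    then show ?thesis by (simp add: AE_completion_iff)
  qed
  show ?thesis using *[of 1] *[of \<i>] by (simp add: inner_complex_def)
qed

text \<open>The factor \<open>c\<^sup>2\<close> is the Jacobian of a dilation in two real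
  dimensions.\<close>

lemma
  fixes f :: "complex \<Rightarrow> 'b::{banach, second_countable_topology}"
  assumes "c \<noteq> 0" and [measurable]: "f \<in> borel_measurable borel"
  shows integrable_affine: "integrable lborel (\<lambda>x. f (a + c *\<^sub>R x)) \<longleftrightarrow> integrable lborel f"
    and integral_affine: "(\<integral>x. f x \<partial>lborel) = c\<^sup>2 *\<^sub>R (\<integral>x. f (a + c *\<^sub>R x) \<partial>lborel)"
proof -
  have eq: "(lborel :: complex measure) = density (distr lborel borel (\<lambda>x. a + c *\<^sub>R x)) (\<lambda>_. ennreal (c\<^sup>2))"
    using lborel_affine[OF assms(1), of a] by (simp add: DIM_complex)
  have "integrable lborel f \<longleftrightarrow> integrable lborel (\<lambda>x. c\<^sup>2 *\<^sub>R f (a + c *\<^sub>R x))"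
    by (subst eq, subst integrable_density) (auto simp: integrable_distr_eq)
  then show "integrable lborel (\<lambda>x. f (a + c *\<^sub>R x)) \<longleftrightarrow> integrable lborel f"
    using assms(1) integrable_scaleR_right[of "inverse (c\<^sup>2)" lborel "\<lambda>x. c\<^sup>2 *\<^sub>R f (a + c *\<^sub>R x)"]
      integrable_scaleR_right[of "c\<^sup>2" lborel "\<lambda>x. f (a + c *\<^sub>R x)"] by auto
  show "(\<integral>x. f x \<partial>lborel) = c\<^sup>2 *\<^sub>R (\<integral>x. f (a + c *\<^sub>R x) \<partial>lborel)"
    by (subst eq, subst integral_density) (auto simp: integral_distr)
qed

lemma
  fixes f :: "complex \<Rightarrow> 'b::{banach, second_countable_topology}"
  assumes "f \<in> borel_measurable borel"
  shows integrable_reflect: "integrable lborel (\<lambda>t. f (x - t)) \<longleftrightarrow> integrable lborel f"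
    and integral_reflect: "(\<integral>t. f (x - t) \<partial>lborel) = (\<integral>t. f t \<partial>lborel)"
  using integrable_affine[of "-1" f x] integral_affine[of "-1" f x] assms by simp_all

abbreviation jap :: "complex \<Rightarrow> real" where
  "jap t \<equiv> 1 + (cmod t)\<^sup>2"

lemma jap_ge_1: "jap t \<ge> 1" and jap_pos: "jap t > 0" and jap_nz: "jap t \<noteq> 0"
  by (simp_all add: add_pos_nonneg less_imp_neq[symmetric])

lemma jap_split: "(1 + (Re t)\<^sup>2) * (1 + (Im t)\<^sup>2) \<le> (jap t)\<^sup>2"
  unfolding cmod_power2 power2_eq_square[of "1 + _"] by (intro mult_mono) auto

text \<open>
  By \<open>2 |x| |y| \<le> |t|\<^sup>2\<close> and \<open>(1 + x\<^sup>2) (1 + y\<^sup>2) \<le> (1 + |t|\<^sup>2)\<^sup>2\<close> for \<open>t = x + \<i> y\<close>, the weight is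
  dominated by a product of functions of one variable.
\<close>

lemma integrable_singular_weight:
  assumes "0 \<le> a" "a < 2" "0 \<le> b" "2 < a + 2 * b"
  shows "integrable lborel (\<lambda>t. cmod t powr (-a) * jap t powr (-b))"
proof -
  let ?f = "\<lambda>x::real. \<bar>x\<bar> powr (-(a/2)) * (1 + x\<^sup>2) powr (-(b/2))"
  have f: "integrable lborel ?f" using assms by (intro integrable_powr_weight) auto
  show ?thesis
  proof (rule Bochner_Integration.integrable_bound)
    show "integrable lborel (\<lambda>z. (2 powr (-(a/2))) * (?f (Re z) * ?f (Im z)))"
      by (intro integrable_mult_right integrable_complex_product f)
    show "(\<lambda>t. cmod t powr (-a) * jap t powr (-b)) \<in> borel_measurable lborel" by simp
    show "AE t in lborel. norm (cmod t powr (-a) * jap t powr (-b)) \<le> norm ((2 powr (-(a/2))) * (?f (Re t) * ?f (Im t)))"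
      using AE_Re_Im_nonzero
    proof eventually_elim
      case (elim t)
      have p: "0 < \<bar>Re t\<bar> * \<bar>Im t\<bar>" using elim by simp
      have "2 * (\<bar>Re t\<bar> * \<bar>Im t\<bar>) \<le> (cmod t)\<^sup>2"
        using sum_squares_bound[of "\<bar>Re t\<bar>" "\<bar>Im t\<bar>"] by (simp add: cmod_power2)
      then have "((cmod t)\<^sup>2) powr (-(a/2)) \<le> (2 * (\<bar>Re t\<bar> * \<bar>Im t\<bar>)) powr (-(a/2))"
        using p assms by (intro powr_mono2') auto
      also have "((cmod t)\<^sup>2) powr (-(a/2)) = cmod t powr (-a)"
        using elim by (simp add: powr_powr flip: powr_numeral)
      finally have 1: "cmod t powr (-a) \<le> 2 powr (-(a/2)) * (\<bar>Re t\<bar> powr (-(a/2)) * \<bar>Im t\<bar> powr (-(a/2)))"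
        by (simp add: powr_mult)
      have "((jap t)\<^sup>2) powr (-(b/2)) \<le> ((1 + (Re t)\<^sup>2) * (1 + (Im t)\<^sup>2)) powr (-(b/2))"
        using jap_split[of t] assms by (intro powr_mono2') (auto intro!: mult_pos_pos add_pos_nonneg)
      also have "((jap t)\<^sup>2) powr (-(b/2)) = jap t powr (-b)"
        using jap_pos[of t] by (simp add: powr_powr flip: powr_numeral)
      finally have 2: "jap t powr (-b) \<le> (1 + (Re t)\<^sup>2) powr (-(b/2)) * (1 + (Im t)\<^sup>2) powr (-(b/2))"
        by (simp add: powr_mult)
      have "cmod t powr (-a) * jap t powr (-b) \<le> 2 powr (-(a/2)) * (?f (Re t) * ?f (Im t))"
        using mult_mono[OF 1 2] by (simp add: mult_ac)
      then show ?case by (simp add: abs_mult)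
    qed
  qed
qed

lemma integrable_jap_powr: "1 < q \<Longrightarrow> integrable lborel (\<lambda>t. jap t powr (-q))"
proof -
  assume q: "1 < q"
  have "integrable lborel (\<lambda>t. cmod t powr (-0) * jap t powr (-q))"
    using q by (intro integrable_singular_weight) auto
  \<comment> \<open>The factor \<open>cmod t powr (-0)\<close> equals \<open>1\<close> except at the
    origin, where \<open>powr\<close> yields \<open>0\<close>; hence only almost everywhere
    equality.\<close>
  then show ?thesis
    by (rule integrable_cong_AE_imp) (use AE_lborel_singleton[of 0] in \<open>auto elim: eventually_mono\<close>)
qed

text \<open>Up to a bounded function this is the kernel \<open>1/|t|\<close>; unlike the latter it is integrable.\<close>

definition sing :: "complex \<Rightarrow> real" where
  "sing t = 1 / (cmod t * jap t)"

lemma sing_nonneg: "0 \<le> sing t" by (simp add: sing_def)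

lemma sing_measurable [measurable]: "sing \<in> borel_measurable borel"
  unfolding sing_def[abs_def] by measurable

lemma integrable_sing: "integrable lborel sing"
proof -
  have "integrable lborel (\<lambda>t. cmod t powr (-1) * jap t powr (-1))"
    by (intro integrable_singular_weight) auto
  moreover have "(\<lambda>t. cmod t powr (-1) * jap t powr (-1)) = sing"
    by (auto simp: sing_def powr_minus divide_inverse jap_pos fun_eq_iff)
  ultimately show ?thesis by simp
qed

text \<open>Outside the unit disc the summand \<open>1\<close> suffices; inside it
  \<open>jap t \<le> 2\<close>.\<close>

lemma inverse_norm_le_sing: "1 / cmod t \<le> 2 * sing t + 1"
proof (cases "t = 0 \<or> cmod t \<ge> 1")
  case True
  then have "1 / cmod t \<le> 1" by (auto simp: divide_le_eq)
  then show ?thesis using sing_nonneg[of t] by linarith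
next
  case False
  then have "0 < cmod t" "(cmod t)\<^sup>2 \<le> 1" by (auto simp: power_le_one)
  then have "1 / cmod t * 1 \<le> 1 / cmod t * (2 / jap t)"
    using jap_pos[of t] by (intro mult_left_mono) (simp_all add: pos_le_divide_eq)
  then show ?thesis by (simp add: sing_def)
qed

section \<open>Convolution and differentiation\<close>

text \<open>The bound on the derivative makes each \<open>f y t\<close> Lipschitz in
  \<open>y\<close> with constant \<open>b t\<close> on the ball, so the normalised remainders are
  dominated by \<open>2 * b\<close> and tend to \<open>0\<close> pointwise.\<close>

lemma has_derivative_integral:
  fixes f :: "complex \<Rightarrow> 'a \<Rightarrow> 'b::{banach, second_countable_topology}"
  assumes r: "0 < r"
    and int: "\<And>y. y \<in> ball x r \<Longrightarrow> integrable M (f y)"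
    and der: "\<And>y t. y \<in> ball x r \<Longrightarrow> ((\<lambda>y. f y t) has_derivative f' y t) (at y)"
    and bd: "\<And>y t v. y \<in> ball x r \<Longrightarrow> norm (f' y t v) \<le> b t * norm v"
    and b: "integrable M b"
    and meas: "\<And>v. (\<lambda>t. f' x t v) \<in> borel_measurable M"
  shows "((\<lambda>y. \<integral>t. f y t \<partial>M) has_derivative (\<lambda>v. \<integral>t. f' x t v \<partial>M)) (at x)"
proof -
  have x: "x \<in> ball x r" using r by simp
  have b0: "0 \<le> b t" for t using bd[OF x, of t 1] order_trans[OF norm_ge_zero] by fastforce
  have int': "integrable M (\<lambda>t. f' x t v)" for v
    by (rule Bochner_Integration.integrable_bound[OF integrable_mult_left[OF b, of "norm v"]])
      (use meas bd[OF x] b0 in \<open>auto simp: abs_mult\<close>)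
  have lin: "bounded_linear (f' x t)" for t using der[OF x] by (rule has_derivative_bounded_linear)
  have "bounded_linear (\<lambda>v. \<integral>t. f' x t v \<partial>M)"
  proof (rule bounded_linear_intro)
    show "(\<integral>t. f' x t (v + w) \<partial>M) = (\<integral>t. f' x t v \<partial>M) + (\<integral>t. f' x t w \<partial>M)" for v w
      by (simp add: linear_add[OF bounded_linear.linear[OF lin]] int')
    show "(\<integral>t. f' x t (c *\<^sub>R v) \<partial>M) = c *\<^sub>R (\<integral>t. f' x t v \<partial>M)" for c v
      by (simp add: linear_scale[OF bounded_linear.linear[OF lin]])
    show "norm (\<integral>t. f' x t v \<partial>M) \<le> norm v * (\<integral>t. b t \<partial>M)" for v
    proof -
      have "norm (\<integral>t. f' x t v \<partial>M) \<le> (\<integral>t. b t * norm v \<partial>M)"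
        proof -
        have "norm (\<integral>t. f' x t v \<partial>M) \<le> (\<integral>t. norm (f' x t v) \<partial>M)" by (rule integral_norm_bound)
        also have "\<dots> \<le> (\<integral>t. b t * norm v \<partial>M)"
          by (rule integral_mono[OF integrable_norm[OF int']]) (use b bd[OF x] in auto)
        finally show ?thesis .
      qed
      then show ?thesis by (simp add: mult.commute)
    qed
  qed
  moreover have "((\<lambda>y. norm ((\<integral>t. f y t \<partial>M) - (\<integral>t. f x t \<partial>M) - (\<integral>t. f' x t (y - x) \<partial>M)) / norm (y - x)) \<longlongrightarrow> 0) (at x within ball x r)"
    unfolding tendsto_at_iff_sequentially
  proof (intro allI impI)
    fix X :: "nat \<Rightarrow> complex" assume X: "\<forall>i. X i \<in> ball x r - {x}" and lim: "X \<longlonglongrightarrow> x"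
    define q where "q i t = (f (X i) t - f x t - f' x t (X i - x)) /\<^sub>R norm (X i - x)" for i t
    have Xb: "X i \<in> ball x r" and Xn: "norm (X i - x) > 0" for i using X by auto
    have "(\<lambda>i. \<integral>t. q i t \<partial>M) \<longlonglongrightarrow> (\<integral>t. 0 \<partial>M)"
    proof (rule integral_dominated_convergence[where w = "\<lambda>t. 2 * b t"])
      show "q i \<in> borel_measurable M" for i
        unfolding q_def[abs_def]
        using borel_measurable_integrable[OF int[OF Xb]] borel_measurable_integrable[OF int[OF x]] meas by simp
      show "AE t in M. norm (q i t) \<le> 2 * b t" for i
      proof (rule AE_I2)
        fix t
        have "norm (f (X i) t - f x t) \<le> b t * norm (X i - x)"
        proof (rule differentiable_bound[OF convex_ball _ _ Xb x, where f' = "\<lambda>y. f' y t"])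
          show "((\<lambda>y. f y t) has_derivative f' y t) (at y within ball x r)" if "y \<in> ball x r" for y
            using der[OF that] by (rule has_derivative_at_withinI)
          show "onorm (f' y t) \<le> b t" if "y \<in> ball x r" for y
            using bd[OF that] b0 by (intro onorm_bound)
        qed
        moreover have "norm (f' x t (X i - x)) \<le> b t * norm (X i - x)" by (rule bd[OF x])
        ultimately have "norm (f (X i) t - f x t - f' x t (X i - x)) \<le> 2 * b t * norm (X i - x)"
          using norm_triangle_ineq4[of "f (X i) t - f x t" "f' x t (X i - x)"] by linarith
        then show "norm (q i t) \<le> 2 * b t" using Xn[of i] by (simp add: q_def divide_simps mult.commute)
      qed
      show "AE t in M. (\<lambda>i. q i t) \<longlonglongrightarrow> 0"
      proof (rule AE_I2)
        fix t
        have "((\<lambda>y. norm (f y t - f x t - f' x t (y - x)) / norm (y - x)) \<longlongrightarrow> 0) (at x within ball x r)"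
          using has_derivative_at_withinI[OF der[OF x], of t "ball x r"] unfolding has_derivative_iff_norm by blast
        then have "(\<lambda>i. norm (f (X i) t - f x t - f' x t (X i - x)) / norm (X i - x)) \<longlonglongrightarrow> 0"
          unfolding tendsto_at_iff_sequentially using X lim by (auto simp: o_def)
        then have "(\<lambda>i. norm (q i t)) \<longlonglongrightarrow> 0" by (simp add: q_def divide_inverse_commute)
        then show "(\<lambda>i. q i t) \<longlonglongrightarrow> 0" by (rule tendsto_norm_zero_cancel)
      qed
    qed (use b in auto)
    then have "(\<lambda>i. norm (\<integral>t. q i t \<partial>M)) \<longlonglongrightarrow> 0" using tendsto_norm_zero by fastforce
    moreover have "norm (\<integral>t. q i t \<partial>M) = norm ((\<integral>t. f (X i) t \<partial>M) - (\<integral>t. f x t \<partial>M) - (\<integral>t. f' x t (X i - x) \<partial>M)) / norm (X i - x)" for i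
      unfolding q_def using int[OF Xb] int[OF x] int' by (simp add: divide_inverse_commute)
    ultimately show "((\<lambda>y. norm ((\<integral>t. f y t \<partial>M) - (\<integral>t. f x t \<partial>M) - (\<integral>t. f' x t (y - x) \<partial>M)) / norm (y - x)) \<circ> X) \<longlonglongrightarrow> 0"
      by (simp add: o_def)
  qed
  ultimately have "((\<lambda>y. \<integral>t. f y t \<partial>M) has_derivative (\<lambda>v. \<integral>t. f' x t v \<partial>M)) (at x within ball x r)"
    unfolding has_derivative_iff_norm by blast
  then show ?thesis using x by (simp add: at_within_open[OF _ open_ball])
qed

definition conv :: "(complex \<Rightarrow> real) \<Rightarrow> (complex \<Rightarrow> real) \<Rightarrow> complex \<Rightarrow> real" where
  "conv k \<rho> x = (\<integral>t. k (x - t) * \<rho> t \<partial>lborel)"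

lemma conv_commute:
  assumes [measurable]: "k \<in> borel_measurable borel" "\<rho> \<in> borel_measurable borel"
  shows "conv k \<rho> x = conv \<rho> k x"
proof -
  have [measurable]: "(\<lambda>t. k (x - t) * \<rho> t) \<in> borel_measurable borel" by measurable
  show ?thesis
    using integral_reflect[of "\<lambda>t. k (x - t) * \<rho> t" x] by (simp add: conv_def mult.commute)
qed

text \<open>For regular kernels: the derivative falls on the kernel, and its bound times the
  absolute density is the dominating function.\<close>

lemma conv_has_derivative_left:
  assumes int: "\<And>x. integrable lborel (\<lambda>t. k (x - t) * \<rho> t)"
    and k: "\<And>s. (k has_derivative k' s) (at s)" "\<And>s v. \<bar>k' s v\<bar> \<le> B * norm v"
    and [measurable]: "\<And>v. (\<lambda>s. k' s v) \<in> borel_measurable borel"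
    and \<rho>: "integrable lborel \<rho>"
  shows "(conv k \<rho> has_derivative (\<lambda>v. conv (\<lambda>s. k' s v) \<rho> x)) (at x)"
  unfolding conv_def[abs_def]
proof (rule has_derivative_integral[where r = 1 and b = "\<lambda>t. B * \<bar>\<rho> t\<bar>" and f' = "\<lambda>x t v. k' (x - t) v * \<rho> t"])
  have [measurable]: "\<rho> \<in> borel_measurable borel" using \<rho> by (auto dest: borel_measurable_integrable)
  show "((\<lambda>y. k (y - t) * \<rho> t) has_derivative (\<lambda>v. k' (y - t) v * \<rho> t)) (at y)" for y t
  proof -
    have "((\<lambda>y. y - t) has_derivative (\<lambda>v. v)) (at y)" by (auto intro!: derivative_eq_intros)
    from has_derivative_compose[OF this k(1)] show ?thesis by (rule has_derivative_mult_left)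
  qed
  show "norm (k' (y - t) v * \<rho> t) \<le> B * \<bar>\<rho> t\<bar> * norm v" for y t v
    using mult_right_mono[OF k(2)[of "y - t" v], of "\<bar>\<rho> t\<bar>"] by (simp add: abs_mult mult_ac)
  show "integrable lborel (\<lambda>t. B * \<bar>\<rho> t\<bar>)" using \<rho> by simp
  show "(\<lambda>t. k' (x - t) v * \<rho> t) \<in> borel_measurable lborel" for v by measurable
qed (use int in auto)

lemma deriv_dir_eq_0:
  assumes "open U" "z \<in> U" "\<And>w. w \<in> U \<Longrightarrow> f w = 0"
  shows "deriv_dir v f z = 0"
proof -
  have "(f has_derivative (\<lambda>_. 0)) (at z)"
    by (rule has_derivative_transform_within_open[OF _ assms(1,2), of "\<lambda>_. 0"]) (use assms in auto)
  then show ?thesis by (rule has_derivative_frechet_derivative_eq)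
qed

lemma outside_deriv_dir:
  assumes "\<And>t. cmod t > R \<Longrightarrow> \<rho> t = 0" "cmod z > R"
  shows "deriv_dir v \<rho> z = 0"
proof (rule deriv_dir_eq_0[of "- cball 0 R"])
  show "open (- cball (0::complex) R)" by (intro open_Compl) simp
qed (use assms in auto)

lemma compact_support_bounded:
  fixes \<rho> :: "complex \<Rightarrow> real"
  assumes "continuous_on UNIV \<rho>" "\<And>t. cmod t > R \<Longrightarrow> \<rho> t = 0"
  obtains B where "B \<ge> 0" "\<And>t. \<bar>\<rho> t\<bar> \<le> B"
proof -
  have "bounded (\<rho> ` cball 0 R)"
    by (intro compact_imp_bounded compact_continuous_image continuous_on_subset[OF assms(1)]) auto
  then obtain B where "B > 0" "\<And>t. cmod t \<le> R \<Longrightarrow> \<bar>\<rho> t\<bar> \<le> B"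
    by (auto simp: bounded_pos)
  then have "\<bar>\<rho> t\<bar> \<le> B" for t using assms(2)[of t] by (cases "cmod t \<le> R") auto
  then show thesis using that[of B] \<open>B > 0\<close> by auto
qed

text \<open>For singular but locally integrable kernels: after commuting the convolution, the
  derivative falls on a differentiable density of compact support.\<close>

lemma conv_has_derivative_right:
  assumes \<rho>: "C_on 1 UNIV \<rho>" "\<And>t. cmod t > R \<Longrightarrow> \<rho> t = 0"
    and k [measurable]: "k \<in> borel_measurable borel"
    and k_loc: "\<And>r. integrable lborel (\<lambda>t. indicator (cball 0 r) t * k t)"
  shows "(conv k \<rho> has_derivative (\<lambda>v. conv k (deriv_dir v \<rho>) x)) (at x)"
proof -
  have c: "\<And>z. \<rho> differentiable (at z)" "continuous_on UNIV (deriv_dir 1 \<rho>)" "continuous_on UNIV (deriv_dir \<i> \<rho>)"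
    using \<rho>(1) by (simp_all add: One_nat_def)
  have c0: "continuous_on UNIV \<rho>" by (rule C_on_imp_continuous[OF \<rho>(1)])
  have d: "(\<rho> has_derivative frechet_derivative \<rho> (at z)) (at z)" for z
    using c(1) by (simp add: frechet_derivative_works)
  have comb: "deriv_dir v \<rho> z = Re v * deriv_dir 1 \<rho> z + Im v * deriv_dir \<i> \<rho> z" for v z
    using has_derivative_frechet_linear[OF d, of z v] by simp
  have [measurable]: "\<rho> \<in> borel_measurable borel" "deriv_dir 1 \<rho> \<in> borel_measurable borel"
      "deriv_dir \<i> \<rho> \<in> borel_measurable borel"
    using c c0 by (auto intro: borel_measurable_continuous_onI)
  have dm [measurable]: "deriv_dir v \<rho> \<in> borel_measurable borel" for v
  proof -
    have e: "deriv_dir v \<rho> = (\<lambda>z. Re v * deriv_dir 1 \<rho> z + Im v * deriv_dir \<i> \<rho> z)"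
      by (rule ext) (rule comb)
    show ?thesis unfolding e
      by (intro borel_measurable_add borel_measurable_times borel_measurable_const) fact+
  qed
  obtain B0 where B0: "B0 \<ge> 0" "\<And>t. \<bar>\<rho> t\<bar> \<le> B0" using compact_support_bounded[OF c0 \<rho>(2)] by blast
  have supp': "deriv_dir v \<rho> t = 0" if "cmod t > R" for v t
    using \<rho>(2) that by (rule outside_deriv_dir)
  obtain B1 where B1: "B1 \<ge> 0" "\<And>t. \<bar>deriv_dir 1 \<rho> t\<bar> \<le> B1"
    by (rule compact_support_bounded[OF c(2) supp']) auto
  obtain B2 where B2: "B2 \<ge> 0" "\<And>t. \<bar>deriv_dir \<i> \<rho> t\<bar> \<le> B2"
    by (rule compact_support_bounded[OF c(3) supp']) auto
  have bound: "\<bar>deriv_dir v \<rho> t\<bar> \<le> (B1 + B2) * norm v" for v t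
  proof -
    have "\<bar>deriv_dir v \<rho> t\<bar> \<le> \<bar>Re v\<bar> * \<bar>deriv_dir 1 \<rho> t\<bar> + \<bar>Im v\<bar> * \<bar>deriv_dir \<i> \<rho> t\<bar>"
      unfolding comb[of t v] by (rule order_trans[OF abs_triangle_ineq]) (simp add: abs_mult)
    also have "\<dots> \<le> norm v * B1 + norm v * B2"
      by (intro add_mono mult_mono B1 B2 abs_Re_le_cmod abs_Im_le_cmod) auto
    finally show ?thesis by (simp add: algebra_simps)
  qed
  \<comment> \<open>For \<open>y\<close> within distance \<open>1\<close> of \<open>x\<close>, the
    function \<open>t \<mapsto> \<rho> (y - t)\<close> vanishes outside the ball of radius
    \<open>r\<close>, so local integrability of the kernel is enough.\<close>
  define r where "r = cmod x + 1 + R"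
  have supp: "cmod (y - t) > R" if "y \<in> ball x 1" "t \<notin> cball 0 r" for y t
  proof -
    have "cmod y < cmod x + 1" using that(1) norm_triangle_ineq2[of y x] by (simp add: dist_norm norm_minus_commute)
    moreover have "cmod t > r" using that(2) by simp
    ultimately show ?thesis using norm_triangle_ineq2[of t y] by (simp add: r_def norm_minus_commute)
  qed
  have "((\<lambda>y. \<integral>t. \<rho> (y - t) * k t \<partial>lborel) has_derivative (\<lambda>v. \<integral>t. deriv_dir v \<rho> (x - t) * k t \<partial>lborel)) (at x)"
  proof (rule has_derivative_integral[where r = 1 and f' = "\<lambda>x t v. deriv_dir v \<rho> (x - t) * k t"
        and b = "\<lambda>t. (B1 + B2) * \<bar>indicator (cball 0 r) t * k t\<bar>"])
    show "integrable lborel (\<lambda>t. \<rho> (y - t) * k t)" if y: "y \<in> ball x 1" for y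
    proof (rule Bochner_Integration.integrable_bound[OF integrable_mult_right[OF k_loc[of r], of B0]])
      have "\<bar>\<rho> (y - t) * k t\<bar> \<le> \<bar>B0 * (indicator (cball 0 r) t * k t)\<bar>" for t
      proof (cases "t \<in> cball 0 r")
        case True
        then show ?thesis using B0(1) mult_right_mono[OF B0(2)[of "y - t"], of "\<bar>k t\<bar>"] by (simp add: abs_mult)
      next
        case False
        then show ?thesis using \<rho>(2)[OF supp[OF y False]] by simp
      qed
      then show "AE t in lborel. norm (\<rho> (y - t) * k t) \<le> norm (B0 * (indicator (cball 0 r) t * k t))" by simp
    qed measurable
    show "((\<lambda>y. \<rho> (y - t) * k t) has_derivative (\<lambda>v. deriv_dir v \<rho> (y - t) * k t)) (at y)" for y t
    proof -
      have "((\<lambda>y. y - t) has_derivative (\<lambda>v. v)) (at y)" by (auto intro!: derivative_eq_intros)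
      from has_derivative_compose[OF this d] show ?thesis by (rule has_derivative_mult_left)
    qed
    show "norm (deriv_dir v \<rho> (y - t) * k t) \<le> (B1 + B2) * \<bar>indicator (cball 0 r) t * k t\<bar> * norm v"
      if y: "y \<in> ball x 1" for y t v
    proof (cases "t \<in> cball 0 r")
      case True
      then show ?thesis using mult_right_mono[OF bound[of "y - t" v], of "\<bar>k t\<bar>"] by (simp add: abs_mult mult_ac)
    next
      case False
      then show ?thesis using supp'[OF supp[OF y False]] by simp
    qed
    show "integrable lborel (\<lambda>t. (B1 + B2) * \<bar>indicator (cball 0 r) t * k t\<bar>)"
      by (intro integrable_mult_right integrable_abs k_loc)
    show "(\<lambda>t. deriv_dir v \<rho> (x - t) * k t) \<in> borel_measurable lborel" for v
      using measurable_compose[OF _ dm, of "\<lambda>t. x - t" lborel v] by simp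
  qed auto
  then show ?thesis
    unfolding conv_commute[OF k \<open>\<rho> \<in> borel_measurable borel\<close>, abs_def] conv_commute[OF k dm]
    by (simp add: conv_def[abs_def])
qed

section \<open>The logarithmic potential\<close>

text \<open>
  \<open>reg_log 0 s\<close> is \<open>ln |s|\<close>, with the junk value \<open>0\<close> at \<open>s = 0\<close>; for \<open>d > 0\<close> it is smooth.
\<close>

definition reg_log :: "real \<Rightarrow> complex \<Rightarrow> real" where
  "reg_log d s = ln ((cmod s)\<^sup>2 + d) / 2"

abbreviation half_log :: "complex \<Rightarrow> real" where
  "half_log t \<equiv> ln (jap t) / 2"

definition log_potential :: "(complex \<Rightarrow> real) \<Rightarrow> complex \<Rightarrow> real" where
  "log_potential = conv (reg_log 0)"

text \<open>The rate counts powers of \<open>1 + |t|^2\<close>, so the threshold of integrability on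
  the plane is \<open>q = 1\<close>. Measurability is included to make this the only assumption on
  densities.\<close>

definition decays :: "real \<Rightarrow> real \<Rightarrow> (complex \<Rightarrow> real) \<Rightarrow> bool" where
  "decays q M \<rho> \<longleftrightarrow> \<rho> \<in> borel_measurable borel \<and> (\<forall>t. \<bar>\<rho> t\<bar> \<le> M * jap t powr (-q))"

lemma decays_measurable: "decays q M \<rho> \<Longrightarrow> \<rho> \<in> borel_measurable borel"
  and decays_bound: "decays q M \<rho> \<Longrightarrow> \<bar>\<rho> t\<bar> \<le> M * jap t powr (-q)"
  by (auto simp: decays_def)

lemma decays_nonneg: "decays q M \<rho> \<Longrightarrow> 0 \<le> M"
  using decays_bound[of q M \<rho> 0] by simp

lemma jap_powr_le_1: "0 \<le> q \<Longrightarrow> jap t powr (-q) \<le> 1"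
  using powr_mono[of "-q" 0 "jap t"] jap_ge_1[of t] by (simp add: jap_nz)

lemma decays_le: "0 \<le> q \<Longrightarrow> decays q M \<rho> \<Longrightarrow> \<bar>\<rho> t\<bar> \<le> M"
  using decays_bound[of q M \<rho> t] mult_left_le[OF jap_powr_le_1[of q t] decays_nonneg[of q M \<rho>]] by simp

lemma decays_integrable:
  assumes "1 < q" "decays q M \<rho>"
  shows "integrable lborel \<rho>"
proof (rule Bochner_Integration.integrable_bound)
  show "integrable lborel (\<lambda>t. M * jap t powr (-q))"
    by (intro integrable_mult_right integrable_jap_powr assms)
  show "\<rho> \<in> borel_measurable lborel" using decays_measurable[OF assms(2)] by simp
  show "AE t in lborel. norm (\<rho> t) \<le> norm (M * jap t powr (-q))"
    using decays_bound[OF assms(2)] decays_nonneg[OF assms(2)] by simp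
qed

section \<open>Growth of the logarithmic kernel\<close>

lemma half_log_nonneg: "0 \<le> half_log t"
  using jap_ge_1[of t] by simp

text \<open>Lets an arbitrarily small power absorb a logarithm.\<close>

lemma half_log_le_powr:
  assumes "0 < \<eta>"
  shows "half_log t \<le> jap t powr \<eta> / (2 * \<eta>)"
proof -
  have "\<eta> * ln (jap t) = ln (jap t powr \<eta>)" using jap_pos[of t] by (simp add: ln_powr)
  also have "\<dots> \<le> jap t powr \<eta>" using jap_pos[of t] by (intro ln_bound) simp
  finally show ?thesis using assms by (simp add: field_simps)
qed

text \<open>A form of Peetre's inequality, which the logarithm makes additive in
  \<open>half_log_diff_le\<close>.\<close>

lemma jap_diff_le: "jap (x - t) \<le> 2 * (jap x * jap t)"
proof -
  have "(cmod (x - t))\<^sup>2 \<le> (cmod x + cmod t)\<^sup>2" by (intro power_mono norm_triangle_ineq4) auto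
  also have "\<dots> \<le> 2 * (cmod x)\<^sup>2 + 2 * (cmod t)\<^sup>2"
    using sum_squares_bound[of "cmod x" "cmod t"] by (simp add: power2_sum)
  finally have "(cmod (x - t))\<^sup>2 \<le> 2 * (cmod x)\<^sup>2 + 2 * (cmod t)\<^sup>2" .
  moreover have "0 \<le> (cmod t)\<^sup>2 * (cmod x)\<^sup>2" by simp
  moreover have "2 * (jap x * jap t) = 2 + 2 * (cmod x)\<^sup>2 + 2 * (cmod t)\<^sup>2 + 2 * ((cmod t)\<^sup>2 * (cmod x)\<^sup>2)"
    by (simp add: algebra_simps)
  ultimately show ?thesis by linarith
qed

lemma half_log_diff_le: "half_log (x - t) \<le> 1 + half_log x + half_log t"
proof -
  have "ln (jap (x - t)) \<le> ln (2 * (jap x * jap t))" using jap_diff_le jap_pos by (intro ln_mono) auto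
  also have "\<dots> = ln 2 + ln (jap x) + ln (jap t)" using jap_pos by (simp add: ln_mult jap_nz)
  finally show ?thesis using ln_bound[of "2::real"] by (simp add: field_simps)
qed

text \<open>Subtracting the value \<open>half_log x\<close> leaves growth in \<open>t\<close> only,
  plus a singularity at \<open>t = x\<close>. The latter is estimated crudely by
  \<open>1 / |x - t|\<close>, which is still integrable there, and all bounds are uniform in
  \<open>d\<close>.\<close>

lemma reg_log_diff_half_log:
  assumes "0 \<le> d" "d \<le> 1" "x \<noteq> t"
  shows "\<bar>reg_log d (x - t) - half_log x\<bar> \<le> 1 + half_log t + 1 / cmod (x - t)"
proof -
  define s where "s = x - t"
  have s: "s \<noteq> 0" "cmod s > 0" using assms by (auto simp: s_def)
  have up: "reg_log d s \<le> half_log s" unfolding reg_log_def using s assms(1,2)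
    by (intro divide_right_mono ln_mono) (auto simp: add_pos_nonneg)
  have low: "reg_log 0 s \<le> reg_log d s" unfolding reg_log_def using s assms(1)
    by (intro divide_right_mono ln_mono) (auto simp: add_pos_nonneg)
  have "half_log s \<le> reg_log 0 s + 1 / cmod s"
  proof -
    \<comment> \<open>The right-hand side is \<open>(|s| + 1)^2\<close>. Taking logarithms leaves
      \<open>ln (1 + 1 / |s|) \<le> 1 / |s|\<close> as the error.\<close>
    have "jap s \<le> (cmod s)\<^sup>2 * (1 + 1 / cmod s)\<^sup>2"
      using s by (simp add: power_mult_distrib[symmetric] distrib_left power2_sum)
    then have "ln (jap s) \<le> ln ((cmod s)\<^sup>2 * (1 + 1 / cmod s)\<^sup>2)" using jap_pos by (intro ln_mono) auto
    also have "\<dots> = ln ((cmod s)\<^sup>2) + 2 * ln (1 + 1 / cmod s)"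
    proof -
      have "1 + 1 / cmod s > 0" using s by (intro add_pos_pos) auto
      then show ?thesis using s by (subst ln_mult) (auto simp: ln_realpow)
    qed
    also have "\<dots> \<le> ln ((cmod s)\<^sup>2) + 2 * (1 / cmod s)"
      using s ln_add_one_self_le_self[of "1 / cmod s"] by simp
    finally show ?thesis by (simp add: reg_log_def)
  qed
  moreover have "half_log x \<le> 1 + half_log s + half_log t"
    using half_log_diff_le[of s "-t"] by (simp add: s_def)
  ultimately have "\<bar>reg_log d s - half_log x\<bar> \<le> 1 + half_log t + 1 / cmod s"
    using up low half_log_diff_le[of x t] s unfolding abs_le_iff s_def[symmetric]
    by (smt (verit) divide_pos_pos)
  then show ?thesis by (simp add: s_def)
qed

lemma reg_log_measurable [measurable]: "reg_log d \<in> borel_measurable borel"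
  unfolding reg_log_def[abs_def] by measurable

lemma log_weight_integrable:
  assumes "1 < q"
  shows "integrable lborel (\<lambda>t. (2 + half_log t) * jap t powr (-q))"
proof -
  \<comment> \<open>Half of the surplus decay: the logarithm costs \<open>\<eta>\<close>, and
    \<open>q - \<eta>\<close> still exceeds \<open>1\<close>.\<close>
  define \<eta> where "\<eta> = (q - 1) / 2"
  have \<eta>: "0 < \<eta>" "1 < q - \<eta>" using assms by (auto simp: \<eta>_def field_simps)
  have "integrable lborel (\<lambda>t. 2 * jap t powr (-q) + (1 / (2 * \<eta>)) * jap t powr (-(q - \<eta>)))"
    by (intro Bochner_Integration.integrable_add integrable_mult_right integrable_jap_powr \<eta> assms)
  then show ?thesis
  proof (rule Bochner_Integration.integrable_bound)
    have "norm ((2 + half_log t) * jap t powr (-q)) \<le> norm (2 * jap t powr (-q) + (1 / (2 * \<eta>)) * jap t powr (-(q - \<eta>)))" for t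
    proof -
      have "half_log t * jap t powr (-q) \<le> jap t powr \<eta> / (2 * \<eta>) * jap t powr (-q)"
        by (intro mult_right_mono half_log_le_powr \<eta>) auto
      also have "\<dots> = (1 / (2 * \<eta>)) * jap t powr (-(q - \<eta>))" by (simp add: powr_add[symmetric])
      finally have "(2 + half_log t) * jap t powr (-q) \<le> 2 * jap t powr (-q) + (1 / (2 * \<eta>)) * jap t powr (-(q - \<eta>))"
        by (simp add: distrib_right)
      moreover have "0 \<le> (2 + half_log t) * jap t powr (-q)" using half_log_nonneg[of t] by simp
      ultimately show ?thesis by simp
    qed
    then show "AE t in lborel. norm ((2 + half_log t) * jap t powr (-q)) \<le> norm (2 * jap t powr (-q) + (1 / (2 * \<eta>)) * jap t powr (-(q - \<eta>)))" by simp
  qed measurable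
qed

lemma sing_reflect: "integrable lborel (\<lambda>t. sing (x - t))" "(\<integral>t. sing (x - t) \<partial>lborel) = (\<integral>t. sing t \<partial>lborel)"
  using integrable_reflect[of sing x] integral_reflect[of sing x] integrable_sing by simp_all

text \<open>The total mass of the dominating function in \<open>reg_log_estimate\<close>. It depends
  on neither \<open>x\<close> nor \<open>d\<close>, because integrating \<open>sing (x - t)\<close>
  is translation invariant.\<close>

definition log_constant :: "real \<Rightarrow> real" where
  "log_constant q = (\<integral>t. (2 + half_log t) * jap t powr (-q) \<partial>lborel) + 2 * (\<integral>t. sing t \<partial>lborel)"

text \<open>The singular part of \<open>1 / |x - t|\<close> is paired with the sup bound of the
  density, the bounded part with its decay.\<close>

lemma decays_inverse_norm:
  assumes "1 < q" "decays q M \<rho>"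
  shows "1 / cmod (x - t) * \<bar>\<rho> t\<bar> \<le> M * (2 * sing (x - t) + jap t powr (-q))"
proof -
  have "1 / cmod (x - t) * \<bar>\<rho> t\<bar> \<le> (2 * sing (x - t) + 1) * \<bar>\<rho> t\<bar>"
    by (intro mult_right_mono inverse_norm_le_sing) auto
  also have "\<dots> \<le> 2 * sing (x - t) * M + M * jap t powr (-q)"
    using mult_left_mono[OF decays_le[OF _ assms(2), of t], of "2 * sing (x - t)"] decays_bound[OF assms(2), of t]
      assms(1) sing_nonneg[of "x - t"] by (simp add: distrib_right)
  finally show ?thesis by (simp add: algebra_simps)
qed

lemma reg_log_decays:
  assumes "1 < q" "decays q M \<rho>" "0 \<le> d" "d \<le> 1"
  shows "AE t in lborel. \<bar>(reg_log d (x - t) - half_log x) * \<rho> t\<bar> \<le> M * ((2 + half_log t) * jap t powr (-q) + 2 * sing (x - t))"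
  using AE_lborel_singleton[of x]
proof eventually_elim
  case (elim t)
  have M: "0 \<le> M" using assms decays_nonneg by blast
  have "\<bar>(reg_log d (x - t) - half_log x) * \<rho> t\<bar> \<le> (1 + half_log t + 1 / cmod (x - t)) * \<bar>\<rho> t\<bar>"
    unfolding abs_mult using elim assms by (intro mult_right_mono reg_log_diff_half_log) auto
  also have "\<dots> \<le> (1 + half_log t) * (M * jap t powr (-q)) + M * (2 * sing (x - t) + jap t powr (-q))"
    using mult_left_mono[OF decays_bound[OF assms(2), of t], of "1 + half_log t"] half_log_nonneg[of t]
      decays_inverse_norm[OF assms(1,2), of x t] by (simp add: distrib_right)
  finally show ?case by (simp add: algebra_simps)
qed

text \<open>Replacing the kernel by \<open>half_log x\<close> produces the leading term, the mass of
  the density times \<open>half_log x\<close>; the remainder is bounded uniformly in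
  \<open>x\<close>. The sign of the mass therefore decides the direction of growth.\<close>

lemma
  assumes "1 < q" "decays q M \<rho>" "0 \<le> d" "d \<le> 1"
  shows reg_log_integrable: "integrable lborel (\<lambda>t. reg_log d (x - t) * \<rho> t)"
    and reg_log_estimate: "\<bar>conv (reg_log d) \<rho> x - half_log x * (\<integral>t. \<rho> t \<partial>lborel)\<bar> \<le> log_constant q * M"
proof -
  have [measurable]: "\<rho> \<in> borel_measurable borel" using assms(2) by (rule decays_measurable)
  let ?D = "\<lambda>t. M * ((2 + half_log t) * jap t powr (-q) + 2 * sing (x - t))"
  have D: "integrable lborel ?D"
    by (intro integrable_mult_right Bochner_Integration.integrable_add log_weight_integrable sing_reflect assms)
  have 1: "integrable lborel (\<lambda>t. (reg_log d (x - t) - half_log x) * \<rho> t)"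
  proof (rule Bochner_Integration.integrable_bound[OF D])
    show "AE t in lborel. norm ((reg_log d (x - t) - half_log x) * \<rho> t) \<le> norm (?D t)"
      using reg_log_decays[OF assms, of x] by eventually_elim auto
  qed measurable
  have 2: "integrable lborel (\<lambda>t. half_log x * \<rho> t)" using decays_integrable[OF assms(1,2)] by simp
  from Bochner_Integration.integrable_add[OF 1 2]
  show i: "integrable lborel (\<lambda>t. reg_log d (x - t) * \<rho> t)" by (simp add: algebra_simps)
  have "conv (reg_log d) \<rho> x - half_log x * (\<integral>t. \<rho> t \<partial>lborel) = (\<integral>t. (reg_log d (x - t) - half_log x) * \<rho> t \<partial>lborel)"
    using i 2 by (simp add: conv_def left_diff_distrib)
  also have "\<bar>\<dots>\<bar> \<le> (\<integral>t. ?D t \<partial>lborel)"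
  proof -
    have "\<bar>\<integral>t. (reg_log d (x - t) - half_log x) * \<rho> t \<partial>lborel\<bar> \<le> (\<integral>t. \<bar>(reg_log d (x - t) - half_log x) * \<rho> t\<bar> \<partial>lborel)"
      by (rule integral_abs_bound)
    also have "\<dots> \<le> (\<integral>t. ?D t \<partial>lborel)"
      by (rule integral_mono_AE[OF integrable_abs[OF 1] D reg_log_decays[OF assms]])
    finally show ?thesis .
  qed
  finally show "\<bar>conv (reg_log d) \<rho> x - half_log x * (\<integral>t. \<rho> t \<partial>lborel)\<bar> \<le> log_constant q * M"
    using log_weight_integrable[OF assms(1)] sing_reflect[of x]
    by (simp add: log_constant_def mult.commute[of _ M])
qed

lemma indicator_decays: "decays 2 ((1 + r\<^sup>2)\<^sup>2) (indicator (cball 0 r))"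
proof -
  have "\<bar>indicator (cball 0 r) t\<bar> \<le> (1 + r\<^sup>2)\<^sup>2 * jap t powr (-2)" for t :: complex
  proof (cases "t \<in> cball 0 r")
    case True
    then have "(jap t)\<^sup>2 \<le> (1 + r\<^sup>2)\<^sup>2" by (auto intro!: power_mono add_pos_nonneg less_imp_le[OF jap_pos])
    then show ?thesis using True jap_pos[of t] by (simp add: powr_minus divide_simps)
  qed simp
  then show ?thesis by (simp add: decays_def borel_measurable_indicator)
qed

lemma reg_log_0_locally_integrable: "integrable lborel (\<lambda>t. indicator (cball 0 r) t * reg_log 0 t)"
proof -
  from reg_log_integrable[OF _ indicator_decays, of 0 0]
  have "integrable lborel (\<lambda>t. reg_log 0 (0 - t) * indicator (cball 0 r) t)" by simp
  then show ?thesis by (simp add: reg_log_def mult.commute)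
qed

section \<open>Gradient and Hessian of the regularised logarithm\<close>

definition grad_log :: "real \<Rightarrow> complex \<Rightarrow> complex \<Rightarrow> real" where
  "grad_log d s v = (s \<bullet> v) / ((cmod s)\<^sup>2 + d)"

text \<open>Together with \<open>grad_log\<close> these are the derivatives of
  \<open>reg_log d\<close> for \<open>d > 0\<close>. At \<open>d = 0\<close> the gradient is of
  order \<open>1 / |s|\<close> and integrable near the origin, but the Hessian is of order
  \<open>1 / |s|^2\<close> and is not.\<close>

definition hess_log :: "real \<Rightarrow> complex \<Rightarrow> complex \<Rightarrow> complex \<Rightarrow> real" where
  "hess_log d s v w = (v \<bullet> w) / ((cmod s)\<^sup>2 + d) - 2 * (s \<bullet> v) * (s \<bullet> w) / ((cmod s)\<^sup>2 + d)\<^sup>2"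

lemma grad_log_measurable [measurable]: "(\<lambda>s. grad_log d s v) \<in> borel_measurable borel"
  unfolding grad_log_def[abs_def] by measurable

lemma hess_log_measurable [measurable]: "(\<lambda>s. hess_log d s v w) \<in> borel_measurable borel"
  unfolding hess_log_def[abs_def] by measurable

lemma reg_log_has_derivative:
  assumes "0 < d"
  shows "(reg_log d has_derivative grad_log d s) (at s)"
proof -
  have p: "0 < s \<bullet> s + d" using assms by (simp add: add_nonneg_pos)
  have "((\<lambda>s. s \<bullet> s + d) has_derivative (\<lambda>v. 2 * (s \<bullet> v))) (at s)"
    by (auto intro!: derivative_eq_intros simp: inner_commute)
  from has_derivative_mult_left[OF has_derivative_ln[OF p this], of "1 / 2"]
  have "((\<lambda>s. ln (s \<bullet> s + d) * (1 / 2)) has_derivative (\<lambda>v. 2 * (s \<bullet> v) * inverse (s \<bullet> s + d) * (1 / 2))) (at s)" .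
  moreover have "(\<lambda>s. ln (s \<bullet> s + d) * (1 / 2)) = reg_log d"
    by (rule ext) (simp add: reg_log_def power2_norm_eq_inner)
  moreover have "(\<lambda>v. 2 * (s \<bullet> v) * inverse (s \<bullet> s + d) * (1 / 2)) = grad_log d s"
    unfolding grad_log_def power2_norm_eq_inner divide_inverse by (rule ext) simp
  ultimately show ?thesis by simp
qed

lemma grad_log_has_derivative:
  assumes "0 < d"
  shows "((\<lambda>s. grad_log d s v) has_derivative hess_log d s v) (at s)"
proof -
  have p: "s \<bullet> s + d \<noteq> 0" using assms inner_ge_zero[of s] by linarith
  have 1: "((\<lambda>s. s \<bullet> v) has_derivative (\<lambda>w. w \<bullet> v)) (at s)" by (auto intro!: derivative_eq_intros)
  have 2: "((\<lambda>s. s \<bullet> s + d) has_derivative (\<lambda>w. 2 * (s \<bullet> w))) (at s)"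
    by (auto intro!: derivative_eq_intros simp: inner_commute)
  from has_derivative_divide[OF 1 2 p]
  have "((\<lambda>s. (s \<bullet> v) / (s \<bullet> s + d)) has_derivative
     (\<lambda>w. - (s \<bullet> v) * (inverse (s \<bullet> s + d) * (2 * (s \<bullet> w)) * inverse (s \<bullet> s + d)) + (w \<bullet> v) / (s \<bullet> s + d))) (at s)" .
  moreover have "(\<lambda>w. - (s \<bullet> v) * (inverse (s \<bullet> s + d) * (2 * (s \<bullet> w)) * inverse (s \<bullet> s + d)) + (w \<bullet> v) / (s \<bullet> s + d)) = hess_log d s v"
    by (simp add: hess_log_def fun_eq_iff power2_norm_eq_inner inner_commute[of v] divide_inverse)
      (simp add: power2_eq_square)
  ultimately show ?thesis by (simp add: grad_log_def[abs_def] power2_norm_eq_inner)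
qed

lemma norm_grad_log_le:
  assumes "0 \<le> d"
  shows "\<bar>grad_log d s v\<bar> \<le> norm v * (1 / cmod s)"
proof (cases "s = 0")
  case False
  have "\<bar>s \<bullet> v\<bar> \<le> cmod s * cmod v" by (rule Cauchy_Schwarz_ineq2)
  then have "\<bar>grad_log d s v\<bar> \<le> cmod s * cmod v / (cmod s)\<^sup>2"
    unfolding grad_log_def abs_divide using assms False by (intro frac_le) auto
  then show ?thesis using False by (simp add: power2_eq_square)
qed (simp add: grad_log_def)

text \<open>Degenerates as \<open>d\<close> tends to \<open>0\<close>; it serves only to
  differentiate under the integral for a fixed \<open>d\<close>.\<close>

lemma grad_log_bound:
  assumes "0 < d"
  shows "\<bar>grad_log d s v\<bar> \<le> (1 + 1 / d) * norm v"
proof -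
  have p: "0 < (cmod s)\<^sup>2 + d" using assms by (simp add: add_nonneg_pos)
  have "cmod s \<le> (cmod s)\<^sup>2 + 1"
    using sum_squares_bound[of "cmod s" 1] norm_ge_zero[of s] unfolding power_one by linarith
  also have "\<dots> \<le> (1 + 1 / d) * ((cmod s)\<^sup>2 + d)" using assms by (simp add: field_simps)
  finally have "cmod s * norm v \<le> (1 + 1 / d) * ((cmod s)\<^sup>2 + d) * norm v" by (intro mult_right_mono) auto
  moreover have "\<bar>s \<bullet> v\<bar> \<le> cmod s * cmod v" by (rule Cauchy_Schwarz_ineq2)
  ultimately show ?thesis using p by (simp add: grad_log_def abs_divide pos_divide_le_eq mult_ac)
qed

lemma hess_log_bound:
  assumes "0 < d"
  shows "\<bar>hess_log d s v w\<bar> \<le> 3 / d * norm v * norm w"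
proof -
  let ?D = "(cmod s)\<^sup>2 + d"
  have p: "0 < ?D" "d \<le> ?D" using assms by (simp_all add: add_nonneg_pos)
  have 1: "\<bar>(v \<bullet> w) / ?D\<bar> \<le> norm v * norm w / d"
    unfolding abs_divide using Cauchy_Schwarz_ineq2[of v w] p assms by (intro frac_le) auto
  have "\<bar>(s \<bullet> v) * (s \<bullet> w)\<bar> \<le> (cmod s * norm v) * (cmod s * norm w)"
    unfolding abs_mult by (intro mult_mono Cauchy_Schwarz_ineq2) auto
  also have "\<dots> \<le> ?D * (norm v * norm w)"
    using assms mult_right_mono[of "(cmod s)\<^sup>2" ?D "norm v * norm w"] by (simp add: power2_eq_square mult_ac)
  finally have "\<bar>2 * (s \<bullet> v) * (s \<bullet> w) / ?D\<^sup>2\<bar> \<le> 2 * (?D * (norm v * norm w)) / ?D\<^sup>2"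
    unfolding abs_divide by (simp add: abs_mult divide_right_mono)
  also have "\<dots> = 2 * (norm v * norm w) / ?D" using p by (simp add: power2_eq_square)
  also have "\<dots> \<le> 2 * (norm v * norm w) / d" by (intro divide_left_mono mult_pos_pos p assms) simp
  finally have "\<bar>2 * (s \<bullet> v) * (s \<bullet> w) / ?D\<^sup>2\<bar> \<le> 2 * (norm v * norm w) / d" .
  with 1 show ?thesis unfolding hess_log_def
    using abs_triangle_ineq4[of "(v \<bullet> w) / ?D" "2 * (s \<bullet> v) * (s \<bullet> w) / ?D\<^sup>2"] by (simp add: add_divide_distrib[symmetric])
qed

text \<open>For \<open>s \<noteq> 0\<close> this is \<open>1 / |s| - |s| / (|s|^2 + d)\<close>, the
  difference of the lengths of the gradients at \<open>0\<close> and at \<open>d\<close>.\<close>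

definition kernel_error :: "real \<Rightarrow> complex \<Rightarrow> real" where
  "kernel_error d s = d / (cmod s * ((cmod s)\<^sup>2 + d))"

lemma kernel_error_measurable [measurable]: "kernel_error d \<in> borel_measurable borel"
  unfolding kernel_error_def[abs_def] by measurable

lemma grad_log_diff:
  assumes "0 \<le> d"
  shows "\<bar>grad_log d s v - grad_log 0 s v\<bar> \<le> norm v * kernel_error d s"
proof (cases "s = 0")
  case False
  then have p: "0 < (cmod s)\<^sup>2" "0 < (cmod s)\<^sup>2 + d" using assms by (auto simp: add_pos_nonneg)
  have "grad_log 0 s v - grad_log d s v = (s \<bullet> v) * (d / ((cmod s)\<^sup>2 * ((cmod s)\<^sup>2 + d)))"
    using p by (simp add: grad_log_def field_simps)
  then have "\<bar>grad_log d s v - grad_log 0 s v\<bar> = \<bar>s \<bullet> v\<bar> * (d / ((cmod s)\<^sup>2 * ((cmod s)\<^sup>2 + d)))"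
    using p assms by (simp add: abs_minus_commute[of "grad_log d s v"] abs_mult)
  also have "\<dots> \<le> (cmod s * norm v) * (d / ((cmod s)\<^sup>2 * ((cmod s)\<^sup>2 + d)))"
    using p assms by (intro mult_right_mono Cauchy_Schwarz_ineq2) auto
  also have "\<dots> = norm v * kernel_error d s"
    using False by (simp add: kernel_error_def power2_eq_square)
  finally show ?thesis .
qed (simp add: grad_log_def kernel_error_def)

text \<open>The error increases with \<open>d\<close> and equals \<open>sing\<close> at
  \<open>d = 1\<close>, which is thus an integrable majorant for all smaller parameters.\<close>

lemma kernel_error_bounds:
  assumes "0 < d" "d \<le> 1"
  shows "0 \<le> kernel_error d s" "kernel_error d s \<le> sing s"
proof -
  have p: "0 < (cmod s)\<^sup>2 + d" using assms by (simp add: add_nonneg_pos)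
  show "0 \<le> kernel_error d s" using assms p by (simp add: kernel_error_def)
  have "d * jap s \<le> (cmod s)\<^sup>2 + d"
    using assms mult_left_le_one_le[of "(cmod s)\<^sup>2" d] by (simp add: distrib_left)
  then have "d \<le> ((cmod s)\<^sup>2 + d) / jap s" by (intro mult_imp_le_div_pos jap_pos)
  then have "d / ((cmod s)\<^sup>2 + d) \<le> 1 / jap s" using p by (intro mult_imp_div_pos_le) simp_all
  then have "1 / cmod s * (d / ((cmod s)\<^sup>2 + d)) \<le> 1 / cmod s * (1 / jap s)" by (intro mult_left_mono) auto
  then show "kernel_error d s \<le> sing s" by (simp add: kernel_error_def sing_def)
qed

section \<open>Removing the regularisation\<close>

definition reg_seq :: "nat \<Rightarrow> real" where "reg_seq n = inverse (real (Suc n))"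

lemma reg_seq: "0 < reg_seq n" "reg_seq n \<le> 1" "reg_seq \<longlonglongrightarrow> 0"
  using LIMSEQ_inverse_real_of_nat by (auto simp: reg_seq_def[abs_def] field_simps)

lemma kernel_error_integrable: "integrable lborel (kernel_error (reg_seq n))"
proof (rule Bochner_Integration.integrable_bound[OF integrable_sing])
  show "AE t in lborel. norm (kernel_error (reg_seq n) t) \<le> norm (sing t)"
    using kernel_error_bounds[OF reg_seq(1,2), of n] by (auto intro: order_trans[OF _ abs_ge_self])
qed simp

lemma kernel_error_tendsto: "(\<lambda>n. \<integral>s. kernel_error (reg_seq n) s \<partial>lborel) \<longlonglongrightarrow> 0"
proof -
  have "(\<lambda>n. \<integral>s. kernel_error (reg_seq n) s \<partial>lborel) \<longlonglongrightarrow> (\<integral>s. 0 \<partial>(lborel :: complex measure))"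
  proof (rule integral_dominated_convergence[OF _ _ integrable_sing])
    show "AE s in lborel. (\<lambda>n. kernel_error (reg_seq n) s) \<longlonglongrightarrow> 0"
      using AE_lborel_singleton[of 0]
    proof eventually_elim
      case (elim s)
      have "(\<lambda>n. kernel_error (reg_seq n) s) \<longlonglongrightarrow> 0 / (cmod s * ((cmod s)\<^sup>2 + 0))"
        unfolding kernel_error_def using elim by (intro tendsto_intros reg_seq(3)) auto
      then show ?case by simp
    qed
    show "AE s in lborel. norm (kernel_error (reg_seq n) s) \<le> sing s" for n
      using kernel_error_bounds[OF reg_seq(1,2), of n] by auto
  qed simp_all
  then show ?thesis by simp
qed

lemma grad_log_integrable:
  assumes "1 < q" "decays q M \<rho>" "0 \<le> d"
  shows "integrable lborel (\<lambda>t. grad_log d (x - t) v * \<rho> t)"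
proof (rule Bochner_Integration.integrable_bound)
  have [measurable]: "\<rho> \<in> borel_measurable borel" using assms(2) by (rule decays_measurable)
  show "(\<lambda>t. grad_log d (x - t) v * \<rho> t) \<in> borel_measurable lborel" by measurable
  show "integrable lborel (\<lambda>t. norm v * (M * (2 * sing (x - t) + jap t powr (-q))))"
    by (intro integrable_mult_right Bochner_Integration.integrable_add sing_reflect integrable_jap_powr assms)
  have "\<bar>grad_log d (x - t) v * \<rho> t\<bar> \<le> norm v * (M * (2 * sing (x - t) + jap t powr (-q)))" for t
  proof -
    have "\<bar>grad_log d (x - t) v * \<rho> t\<bar> \<le> norm v * (1 / cmod (x - t)) * \<bar>\<rho> t\<bar>"
      unfolding abs_mult by (intro mult_right_mono norm_grad_log_le assms) auto
    also have "\<dots> \<le> norm v * (M * (2 * sing (x - t) + jap t powr (-q)))"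
      unfolding mult.assoc[of "norm v"] by (intro mult_left_mono decays_inverse_norm assms) auto
    finally show ?thesis .
  qed
  then show "AE t in lborel. norm (grad_log d (x - t) v * \<rho> t) \<le> norm (norm v * (M * (2 * sing (x - t) + jap t powr (-q))))"
    by (intro AE_I2) (simp only: real_norm_def order_trans[OF _ abs_ge_self])
qed

text \<open>By translation invariance the bound does not depend on \<open>x\<close>, so the
  gradients converge uniformly on the plane.\<close>

lemma conv_grad_log_diff:
  assumes "1 < q" "decays q M \<rho>"
  shows "\<bar>conv (\<lambda>s. grad_log (reg_seq n) s v) \<rho> x - conv (\<lambda>s. grad_log 0 s v) \<rho> x\<bar>
    \<le> M * norm v * (\<integral>s. kernel_error (reg_seq n) s \<partial>lborel)"
proof -
  note d = reg_seq(1,2)[of n]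
  have i: "integrable lborel (\<lambda>t. grad_log (reg_seq n) (x - t) v * \<rho> t)" "integrable lborel (\<lambda>t. grad_log 0 (x - t) v * \<rho> t)"
    using d by (intro grad_log_integrable[OF assms]; simp)+
  have e: "integrable lborel (\<lambda>t. kernel_error (reg_seq n) (x - t))"
    using integrable_reflect[of "kernel_error (reg_seq n)" x] kernel_error_integrable by simp
  have "\<bar>conv (\<lambda>s. grad_log (reg_seq n) s v) \<rho> x - conv (\<lambda>s. grad_log 0 s v) \<rho> x\<bar>
    = \<bar>\<integral>t. grad_log (reg_seq n) (x - t) v * \<rho> t - grad_log 0 (x - t) v * \<rho> t \<partial>lborel\<bar>"
    using i by (simp add: conv_def)
  also have "\<dots> \<le> (\<integral>t. \<bar>grad_log (reg_seq n) (x - t) v * \<rho> t - grad_log 0 (x - t) v * \<rho> t\<bar> \<partial>lborel)"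
    by (rule integral_abs_bound)
  also have "\<dots> \<le> (\<integral>t. M * norm v * kernel_error (reg_seq n) (x - t) \<partial>lborel)"
  proof (rule integral_mono)
    fix t
    have "\<bar>grad_log (reg_seq n) (x - t) v * \<rho> t - grad_log 0 (x - t) v * \<rho> t\<bar>
      = \<bar>grad_log (reg_seq n) (x - t) v - grad_log 0 (x - t) v\<bar> * \<bar>\<rho> t\<bar>"
      by (simp add: left_diff_distrib[symmetric] abs_mult)
    also have "\<dots> \<le> norm v * kernel_error (reg_seq n) (x - t) * M"
      using d kernel_error_bounds[OF d] assms by (intro mult_mono grad_log_diff decays_le) auto
    finally show "\<bar>grad_log (reg_seq n) (x - t) v * \<rho> t - grad_log 0 (x - t) v * \<rho> t\<bar> \<le> M * norm v * kernel_error (reg_seq n) (x - t)"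
      by (simp add: mult_ac)
  qed (use i e in auto)
  also have "\<dots> = M * norm v * (\<integral>s. kernel_error (reg_seq n) s \<partial>lborel)"
    using integral_reflect[of "kernel_error (reg_seq n)" x] by simp
  finally show ?thesis .
qed

lemma conv_grad_log_tendsto:
  assumes "1 < q" "decays q M \<rho>"
  shows "(\<lambda>n. conv (\<lambda>s. grad_log (reg_seq n) s v) \<rho> x) \<longlonglongrightarrow> conv (\<lambda>s. grad_log 0 s v) \<rho> x"
proof (rule LIM_zero_cancel, rule tendsto_rabs_zero_cancel, rule tendsto_sandwich[OF _ _ tendsto_const])
  show "(\<lambda>n. M * norm v * (\<integral>s. kernel_error (reg_seq n) s \<partial>lborel)) \<longlonglongrightarrow> 0"
    using tendsto_mult_right_zero[OF kernel_error_tendsto] by simp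
qed (use conv_grad_log_diff[OF assms] in auto)

lemma conv_reg_log_tendsto:
  assumes "1 < q" "decays q M \<rho>"
  shows "(\<lambda>n. conv (reg_log (reg_seq n)) \<rho> x) \<longlonglongrightarrow> log_potential \<rho> x"
  unfolding log_potential_def conv_def
proof (rule integral_dominated_convergence)
  have [measurable]: "\<rho> \<in> borel_measurable borel" using assms(2) by (rule decays_measurable)
  show "(\<lambda>t. reg_log 0 (x - t) * \<rho> t) \<in> borel_measurable lborel"
    "(\<lambda>t. reg_log (reg_seq n) (x - t) * \<rho> t) \<in> borel_measurable lborel" for n by measurable
  let ?D = "\<lambda>t. M * ((2 + half_log t) * jap t powr (-q) + 2 * sing (x - t)) + half_log x * \<bar>\<rho> t\<bar>"
  show "integrable lborel ?D"
    by (intro integrable_mult_right Bochner_Integration.integrable_add log_weight_integrable sing_reflect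
        integrable_abs decays_integrable[OF assms] assms)
  show "AE t in lborel. norm (reg_log (reg_seq n) (x - t) * \<rho> t) \<le> ?D t" for n
    using reg_log_decays[OF assms less_imp_le[OF reg_seq(1)] reg_seq(2), of n x]
  proof eventually_elim
    case (elim t)
    have "reg_log (reg_seq n) (x - t) * \<rho> t = (reg_log (reg_seq n) (x - t) - half_log x) * \<rho> t + half_log x * \<rho> t"
      by (simp add: left_diff_distrib)
    then have "\<bar>reg_log (reg_seq n) (x - t) * \<rho> t\<bar> \<le> \<bar>(reg_log (reg_seq n) (x - t) - half_log x) * \<rho> t\<bar> + \<bar>half_log x * \<rho> t\<bar>"
      by (metis abs_triangle_ineq)
    also have "\<bar>half_log x * \<rho> t\<bar> = half_log x * \<bar>\<rho> t\<bar>" using half_log_nonneg[of x] by (simp only: abs_mult abs_of_nonneg)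
    finally show ?case using elim by simp
  qed
  show "AE t in lborel. (\<lambda>n. reg_log (reg_seq n) (x - t) * \<rho> t) \<longlonglongrightarrow> reg_log 0 (x - t) * \<rho> t"
    using AE_lborel_singleton[of x]
  proof eventually_elim
    case (elim t)
    then show ?case unfolding reg_log_def by (intro tendsto_intros reg_seq(3)) auto
  qed
qed

lemma conv_grad_log_has_derivative:
  assumes "1 < q" "decays q M \<rho>" "0 < d"
  shows "(conv (\<lambda>s. grad_log d s v) \<rho> has_derivative (\<lambda>w. conv (\<lambda>s. hess_log d s v w) \<rho> x)) (at x)"
proof (rule conv_has_derivative_left[where B = "3 / d * norm v"])
  show "integrable lborel (\<lambda>t. grad_log d (x - t) v * \<rho> t)" for x
    using assms by (intro grad_log_integrable) auto
  show "\<bar>hess_log d s v w\<bar> \<le> 3 / d * norm v * norm w" for s w by (rule hess_log_bound[OF assms(3)])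
qed (use assms in \<open>auto intro: grad_log_has_derivative decays_integrable\<close>)

text \<open>The singularity of the kernel moves with \<open>x\<close>, which rules out domination
  under the integral. Instead, the regularised potentials converge pointwise and their gradients
  uniformly, so the limit is differentiable with continuous gradient.\<close>

theorem log_potential_has_derivative:
  assumes "1 < q" "decays q M \<rho>"
  shows "(log_potential \<rho> has_derivative (\<lambda>v. conv (\<lambda>s. grad_log 0 s v) \<rho> x)) (at x)"
    and "continuous_on UNIV (conv (\<lambda>s. grad_log 0 s v) \<rho>)"
proof -
  let ?I = "\<lambda>n. \<integral>s. kernel_error (reg_seq n) s \<partial>lborel"
  have I0: "(\<lambda>n. M * ?I n) \<longlonglongrightarrow> 0" using tendsto_mult_right_zero[OF kernel_error_tendsto] by simp
  have M: "0 \<le> M" using assms decays_nonneg by blast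
  have "\<exists>g. \<forall>x\<in>UNIV. (\<lambda>n. conv (reg_log (reg_seq n)) \<rho> x) \<longlonglongrightarrow> g x \<and>
      (g has_derivative (\<lambda>v. conv (\<lambda>s. grad_log 0 s v) \<rho> x)) (at x within UNIV)"
  proof (rule has_derivative_sequence)
    show "(conv (reg_log (reg_seq n)) \<rho> has_derivative (\<lambda>v. conv (\<lambda>s. grad_log (reg_seq n) s v) \<rho> x)) (at x within UNIV)" for n x
      by (intro conv_has_derivative_left[where B = "1 + 1 / reg_seq n"] reg_log_integrable[OF assms]
          reg_log_has_derivative grad_log_bound grad_log_measurable decays_integrable[OF assms] less_imp_le[OF reg_seq(1)] reg_seq)
    show "\<forall>\<^sub>F n in sequentially. \<forall>x\<in>UNIV. \<forall>v. norm (conv (\<lambda>s. grad_log (reg_seq n) s v) \<rho> x - conv (\<lambda>s. grad_log 0 s v) \<rho> x) \<le> e * norm v"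
      if "0 < e" for e
      using order_tendstoD(2)[OF I0 that]
    proof eventually_elim
      case (elim n)
      show ?case
      proof (intro ballI allI)
        fix x v
        have "\<bar>conv (\<lambda>s. grad_log (reg_seq n) s v) \<rho> x - conv (\<lambda>s. grad_log 0 s v) \<rho> x\<bar> \<le> (M * ?I n) * norm v"
          using conv_grad_log_diff[OF assms, of n v x] by (simp add: mult_ac)
        also have "\<dots> \<le> e * norm v" using elim by (intro mult_right_mono) auto
        finally show "norm (conv (\<lambda>s. grad_log (reg_seq n) s v) \<rho> x - conv (\<lambda>s. grad_log 0 s v) \<rho> x) \<le> e * norm v" by simp
      qed
    qed
  qed (use conv_reg_log_tendsto[OF assms, of 0] in auto)
  then obtain g where g: "\<And>x. (\<lambda>n. conv (reg_log (reg_seq n)) \<rho> x) \<longlonglongrightarrow> g x"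
    "\<And>x. (g has_derivative (\<lambda>v. conv (\<lambda>s. grad_log 0 s v) \<rho> x)) (at x)" by auto
  have "g = log_potential \<rho>" using LIMSEQ_unique[OF g(1) conv_reg_log_tendsto[OF assms]] by blast
  then show "(log_potential \<rho> has_derivative (\<lambda>v. conv (\<lambda>s. grad_log 0 s v) \<rho> x)) (at x)" using g(2) by simp
  have "uniform_limit UNIV (\<lambda>n. conv (\<lambda>s. grad_log (reg_seq n) s v) \<rho>) (conv (\<lambda>s. grad_log 0 s v) \<rho>) sequentially"
    unfolding uniform_limit_iff
  proof (intro allI impI)
    fix e :: real assume "0 < e"
    have "(\<lambda>n. M * norm v * ?I n) \<longlonglongrightarrow> 0" using tendsto_mult_right_zero[OF kernel_error_tendsto] by simp
    from order_tendstoD(2)[OF this \<open>0 < e\<close>]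
    show "\<forall>\<^sub>F n in sequentially. \<forall>x\<in>UNIV. dist (conv (\<lambda>s. grad_log (reg_seq n) s v) \<rho> x) (conv (\<lambda>s. grad_log 0 s v) \<rho> x) < e"
      by eventually_elim (use conv_grad_log_diff[OF assms] in \<open>auto simp: dist_real_def intro: le_less_trans\<close>)
  qed
  moreover have "continuous_on UNIV (conv (\<lambda>s. grad_log (reg_seq n) s v) \<rho>)" for n
    using conv_grad_log_has_derivative[OF assms reg_seq(1)]
    by (intro continuous_at_imp_continuous_on ballI has_derivative_continuous)
  ultimately show "continuous_on UNIV (conv (\<lambda>s. grad_log 0 s v) \<rho>)"
    by (intro uniform_limit_theorem[of _ "\<lambda>n. conv (\<lambda>s. grad_log (reg_seq n) s v) \<rho>"]) auto
qed

lemma log_potential_C1: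
  assumes "1 < q" "decays q M \<rho>"
  shows "C_on 1 UNIV (log_potential \<rho>)"
  unfolding One_nat_def
  by (rule C_on_SucI[OF open_UNIV log_potential_has_derivative(1)[OF assms]])
    (simp_all add: log_potential_has_derivative(2)[OF assms])

lemma compact_support_decays:
  fixes \<rho> :: "complex \<Rightarrow> real"
  assumes "continuous_on UNIV \<rho>" "\<And>t. cmod t > R \<Longrightarrow> \<rho> t = 0"
  shows "\<exists>M. decays 2 M \<rho>"
proof -
  obtain B where B: "B \<ge> 0" "\<And>t. \<bar>\<rho> t\<bar> \<le> B" using compact_support_bounded[OF assms] by blast
  have "\<bar>\<rho> t\<bar> \<le> (B * (1 + R\<^sup>2)\<^sup>2) * jap t powr (-2)" for t
  proof (cases "cmod t \<le> R")
    case True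
    then have "(jap t)\<^sup>2 \<le> (1 + R\<^sup>2)\<^sup>2" by (auto intro!: power_mono add_pos_nonneg less_imp_le[OF jap_pos])
    then have "1 \<le> (1 + R\<^sup>2)\<^sup>2 * jap t powr (-2)" using jap_pos[of t] by (simp add: powr_minus divide_simps)
    then have "B * 1 \<le> B * ((1 + R\<^sup>2)\<^sup>2 * jap t powr (-2))" using B by (intro mult_left_mono)
    then show ?thesis using B(2)[of t] by (simp add: mult_ac)
  qed (use assms(2)[of t] B(1) in auto)
  then show ?thesis using assms(1) by (auto simp: decays_def intro: borel_measurable_continuous_onI)
qed

text \<open>For compactly supported densities the potential commutes with differentiation.\<close>

lemma log_potential_deriv_dir:
  assumes "C_on 1 UNIV \<rho>" "\<And>t. cmod t > R \<Longrightarrow> \<rho> t = 0"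
  shows "(log_potential \<rho> has_derivative (\<lambda>v. log_potential (deriv_dir v \<rho>) x)) (at x)"
  unfolding log_potential_def
  using assms reg_log_measurable reg_log_0_locally_integrable by (rule conv_has_derivative_right)

text \<open>The first \<open>n\<close> derivatives fall on the density; the additional one falls on
  the kernel by \<open>log_potential_C1\<close>, which asks only for measurability and
  decay.\<close>

lemma log_potential_C_compact:
  assumes "C_on n UNIV \<rho>" "\<And>t. cmod t > R \<Longrightarrow> \<rho> t = 0"
  shows "C_on (Suc n) UNIV (log_potential \<rho>)"
  using assms
proof (induction n arbitrary: \<rho>)
  case 0
  obtain M where "decays 2 M \<rho>" using compact_support_decays[of \<rho> R] 0 by auto
  then show ?case using log_potential_C1[of 2 M \<rho>] by (simp add: One_nat_def)
next
  case (Suc n)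
  have 1: "C_on 1 UNIV \<rho>" using C_on_le[OF Suc.prems(1), of 1] by simp
  have z: "deriv_dir v \<rho> t = 0" if "cmod t > R" for v t
    using Suc.prems(2) that by (rule outside_deriv_dir)
  show ?case
  proof (rule C_on_SucI[OF open_UNIV log_potential_deriv_dir[OF 1 Suc.prems(2)]])
    show "C_on (Suc n) UNIV (log_potential (deriv_dir 1 \<rho>))" "C_on (Suc n) UNIV (log_potential (deriv_dir \<i> \<rho>))"
      using Suc.prems(1) z by (intro Suc.IH; simp)+
  qed
qed

section \<open>The Poisson equation\<close>

text \<open>This constant is \<open>2 * pi\<close>, but only its positivity matters.\<close>

definition log_mass :: real where
  "log_mass = (\<integral>u. 2 / (jap u)\<^sup>2 \<partial>(lborel :: complex measure))"

lemma integrable_jap_square: "integrable lborel (\<lambda>u. 2 / (jap u)\<^sup>2)"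
proof -
  have "(\<lambda>u. 2 / (jap u)\<^sup>2) = (\<lambda>u. 2 * jap u powr (-2))"
    using jap_pos by (simp add: powr_minus divide_inverse fun_eq_iff)
  then show ?thesis using integrable_mult_right[OF integrable_jap_powr[of 2], of 2] by simp
qed

lemma log_mass_pos: "0 < log_mass"
proof -
  have nonneg: "0 \<le> 2 / (jap u)\<^sup>2" for u by simp
  have "log_mass \<noteq> 0"
  proof
    assume "log_mass = 0"
    then have "AE u in (lborel :: complex measure). 2 / (jap u)\<^sup>2 = 0"
      using integral_nonneg_eq_0_iff_AE[OF integrable_jap_square] nonneg by (simp add: log_mass_def)
    then have "AE u in (lborel :: complex measure). False" by eventually_elim (use jap_nz in simp)
    then show False by (simp add: AE_iff_null null_sets_def)
  qed
  moreover have "0 \<le> log_mass" unfolding log_mass_def by (intro Bochner_Integration.integral_nonneg nonneg)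
  ultimately show ?thesis by simp
qed

text \<open>The dilation \<open>t = sqrt d * u\<close> turns the kernel into the fixed profile
  \<open>2 / (jap u)^2\<close> and moves \<open>d\<close> into the argument of the density, where
  continuity applies.\<close>

lemma approximate_identity:
  assumes cont: "continuous_on UNIV \<rho>" and B: "\<And>t. \<bar>\<rho> t\<bar> \<le> B"
  shows "(\<lambda>n. conv (\<lambda>s. 2 * reg_seq n / ((cmod s)\<^sup>2 + reg_seq n)\<^sup>2) \<rho> x) \<longlonglongrightarrow> log_mass * \<rho> x"
proof -
  have [measurable]: "\<rho> \<in> borel_measurable borel" using cont by (rule borel_measurable_continuous_onI)
  have scale: "conv (\<lambda>s. 2 * d / ((cmod s)\<^sup>2 + d)\<^sup>2) \<rho> x = (\<integral>u. \<rho> (x - sqrt d *\<^sub>R u) * (2 / (jap u)\<^sup>2) \<partial>lborel)"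
    if d: "0 < d" for d
  proof -
    let ?k = "\<lambda>s. 2 * d / ((cmod s)\<^sup>2 + d)\<^sup>2"
    have "conv ?k \<rho> x = (\<integral>t. \<rho> (x - t) * ?k t \<partial>lborel)"
      by (subst conv_commute) (auto simp: conv_def)
    also have "\<dots> = (sqrt d)\<^sup>2 *\<^sub>R (\<integral>u. \<rho> (x - (0 + sqrt d *\<^sub>R u)) * ?k (0 + sqrt d *\<^sub>R u) \<partial>lborel)"
      using d by (intro integral_affine) auto
    also have "\<dots> = (\<integral>u. d * (\<rho> (x - sqrt d *\<^sub>R u) * ?k (sqrt d *\<^sub>R u)) \<partial>lborel)"
      using d by (simp only: add_0_left real_sqrt_pow2 less_imp_le real_scaleR_def integral_mult_right_zero)
    also have "\<dots> = (\<integral>u. \<rho> (x - sqrt d *\<^sub>R u) * (2 / (jap u)\<^sup>2) \<partial>lborel)"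
    proof (rule Bochner_Integration.integral_cong[OF refl])
      fix u
      have "(cmod (sqrt d *\<^sub>R u))\<^sup>2 + d = d * jap u" using d by (simp add: power_mult_distrib algebra_simps)
      then have "d * ?k (sqrt d *\<^sub>R u) = 2 / (jap u)\<^sup>2"
        using d by (simp add: power2_eq_square)
      then show "d * (\<rho> (x - sqrt d *\<^sub>R u) * ?k (sqrt d *\<^sub>R u)) = \<rho> (x - sqrt d *\<^sub>R u) * (2 / (jap u)\<^sup>2)"
        by (metis mult.left_commute)
    qed
    finally show ?thesis .
  qed
  have "(\<lambda>n. \<integral>u. \<rho> (x - sqrt (reg_seq n) *\<^sub>R u) * (2 / (jap u)\<^sup>2) \<partial>lborel) \<longlonglongrightarrow> (\<integral>u. \<rho> x * (2 / (jap u)\<^sup>2) \<partial>lborel)"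
  proof (rule integral_dominated_convergence)
    show "integrable lborel (\<lambda>u. B * (2 / (jap u)\<^sup>2))" by (intro integrable_mult_right integrable_jap_square)
    show "AE u in lborel. norm (\<rho> (x - sqrt (reg_seq n) *\<^sub>R u) * (2 / (jap u)\<^sup>2)) \<le> B * (2 / (jap u)\<^sup>2)" for n
    proof (rule AE_I2)
      fix u
      have "\<bar>\<rho> (x - sqrt (reg_seq n) *\<^sub>R u)\<bar> * (2 / (jap u)\<^sup>2) \<le> B * (2 / (jap u)\<^sup>2)"
        by (intro mult_right_mono B) simp
      then show "norm (\<rho> (x - sqrt (reg_seq n) *\<^sub>R u) * (2 / (jap u)\<^sup>2)) \<le> B * (2 / (jap u)\<^sup>2)"
        by (simp only: real_norm_def abs_mult abs_of_nonneg[OF divide_nonneg_nonneg[OF zero_le_numeral zero_le_power2]])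
    qed
    show "AE u in lborel. (\<lambda>n. \<rho> (x - sqrt (reg_seq n) *\<^sub>R u) * (2 / (jap u)\<^sup>2)) \<longlonglongrightarrow> \<rho> x * (2 / (jap u)\<^sup>2)"
    proof (intro AE_I2 tendsto_mult_right)
      fix u :: complex
      have "(\<lambda>n. x - sqrt (reg_seq n) *\<^sub>R u) \<longlonglongrightarrow> x - sqrt 0 *\<^sub>R u" by (intro tendsto_intros reg_seq(3))
      moreover have "isCont \<rho> x" using cont by (simp add: continuous_on_eq_continuous_at)
      ultimately show "(\<lambda>n. \<rho> (x - sqrt (reg_seq n) *\<^sub>R u)) \<longlonglongrightarrow> \<rho> x" using isCont_tendsto_compose by force
    qed
  qed measurable
  moreover have "(\<integral>u. \<rho> x * (2 / (jap u)\<^sup>2) \<partial>lborel) = log_mass * \<rho> x"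
    by (simp only: integral_mult_right_zero log_mass_def mult.commute)
  ultimately show ?thesis by (simp only: scale[OF reg_seq(1)])
qed

text \<open>This is the Laplacian of \<open>reg_log d\<close>: an integrable bump of mass
  \<open>log_mass\<close> for every \<open>d\<close>, concentrating at the origin.\<close>

lemma hess_log_trace:
  assumes "0 < d"
  shows "hess_log d s 1 1 + hess_log d s \<i> \<i> = 2 * d / ((cmod s)\<^sup>2 + d)\<^sup>2"
proof -
  define D where "D = (cmod s)\<^sup>2 + d"
  have "D > 0" using assms by (simp add: D_def add_nonneg_pos)
  have "hess_log d s 1 1 + hess_log d s \<i> \<i> = 2 / D - 2 * (cmod s)\<^sup>2 / D\<^sup>2"
    unfolding hess_log_def D_def[symmetric]
    by (simp add: inner_complex_def cmod_power2 power2_eq_square[of "Re s"] power2_eq_square[of "Im s"] add_divide_distrib diff_divide_distrib algebra_simps)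
  also have "\<dots> = 2 * d / D\<^sup>2"
    using \<open>D > 0\<close> by (simp add: field_simps power2_eq_square[of D]) (simp add: D_def algebra_simps)
  finally show ?thesis by (simp add: D_def)
qed

lemma hess_log_integrable:
  assumes "integrable lborel \<rho>" "0 < d"
  shows "integrable lborel (\<lambda>t. hess_log d (x - t) v w * \<rho> t)"
proof (rule Bochner_Integration.integrable_bound)
  have [measurable]: "\<rho> \<in> borel_measurable borel" using assms(1) by (auto dest: borel_measurable_integrable)
  show "(\<lambda>t. hess_log d (x - t) v w * \<rho> t) \<in> borel_measurable lborel" by measurable
  define c where "c = 3 / d * norm v * norm w"
  show "integrable lborel (\<lambda>t. c * \<rho> t)" using assms(1) by simp
  have "\<bar>hess_log d (x - t) v w\<bar> \<le> \<bar>c\<bar>" for t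
    using hess_log_bound[OF assms(2)] abs_ge_self order_trans unfolding c_def by blast
  then show "AE t in lborel. norm (hess_log d (x - t) v w * \<rho> t) \<le> norm (c * \<rho> t)"
    unfolding real_norm_def abs_mult by (intro AE_I2 mult_right_mono) auto
qed

lemma grad_log_locally_integrable:
  assumes "0 \<le> d"
  shows "integrable lborel (\<lambda>t. indicator (cball 0 r) t * grad_log d t v)"
proof -
  have "decays 2 ((1 + r\<^sup>2)\<^sup>2) (indicator (cball 0 r))" by (rule indicator_decays)
  from grad_log_integrable[OF _ this assms, of 0 v]
  have "integrable lborel (\<lambda>t. - (grad_log d (0 - t) v * indicator (cball 0 r) t))" by simp
  then show ?thesis by (simp add: grad_log_def mult.commute)
qed

text \<open>One derivative is put on the density and the other on the kernel. After regularisation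
  the first one returns to the kernel, and the trace of its Hessian is an approximate
  identity.\<close>

lemma laplacian_log_potential_compact:
  assumes \<rho>: "C_on 1 UNIV \<rho>" "\<And>t. cmod t > R \<Longrightarrow> \<rho> t = 0"
  shows "laplacian (log_potential \<rho>) x = log_mass * \<rho> x"
proof -
  have c0: "continuous_on UNIV \<rho>" by (rule C_on_imp_continuous[OF \<rho>(1)])
  have c1: "continuous_on UNIV (deriv_dir 1 \<rho>)" "continuous_on UNIV (deriv_dir \<i> \<rho>)"
    using \<rho>(1) by (simp_all add: One_nat_def)
  have supp: "deriv_dir v \<rho> t = 0" if "cmod t > R" for v t using \<rho>(2) that by (rule outside_deriv_dir)
  obtain M where M: "decays 2 M \<rho>" using compact_support_decays[OF c0 \<rho>(2)] by blast
  have \<rho>_int: "integrable lborel \<rho>" using decays_integrable[OF _ M] by simp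
  have dV: "deriv_dir v (log_potential \<rho>) = log_potential (deriv_dir v \<rho>)" for v
    by (rule ext) (rule has_derivative_frechet_derivative_eq[OF log_potential_deriv_dir[OF \<rho>]])
  have lim: "(\<lambda>n. conv (\<lambda>s. hess_log (reg_seq n) s v v) \<rho> x) \<longlonglongrightarrow> deriv_dir v (deriv_dir v (log_potential \<rho>)) x"
    if v: "continuous_on UNIV (deriv_dir v \<rho>)" for v
  proof -
    obtain M' where M': "decays 2 M' (deriv_dir v \<rho>)" using compact_support_decays[OF v supp] by blast
    have "deriv_dir v (deriv_dir v (log_potential \<rho>)) x = conv (\<lambda>s. grad_log 0 s v) (deriv_dir v \<rho>) x"
      unfolding dV by (rule has_derivative_frechet_derivative_eq[OF log_potential_has_derivative(1)[OF _ M']]) simp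
    \<comment> \<open>Integration by parts without boundary terms: both sides are derivatives of the
      same convolution, computed on the density and on the kernel, hence equal.\<close>
    moreover have "conv (\<lambda>s. grad_log (reg_seq n) s v) (deriv_dir v \<rho>) x = conv (\<lambda>s. hess_log (reg_seq n) s v v) \<rho> x" for n
    proof -
      have "(conv (\<lambda>s. grad_log (reg_seq n) s v) \<rho> has_derivative (\<lambda>w. conv (\<lambda>s. grad_log (reg_seq n) s v) (deriv_dir w \<rho>) x)) (at x)"
        using \<rho> grad_log_measurable grad_log_locally_integrable[OF less_imp_le[OF reg_seq(1)]]
        by (rule conv_has_derivative_right)
      from has_derivative_unique[OF this conv_grad_log_has_derivative[OF _ M reg_seq(1)]]
      show ?thesis by (auto dest: fun_cong)
    qed
    ultimately show ?thesis using conv_grad_log_tendsto[OF _ M', of v x] by simp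
  qed
  have "(\<lambda>n. conv (\<lambda>s. hess_log (reg_seq n) s 1 1) \<rho> x + conv (\<lambda>s. hess_log (reg_seq n) s \<i> \<i>) \<rho> x)
      \<longlonglongrightarrow> laplacian (log_potential \<rho>) x"
    unfolding laplacian_def by (intro tendsto_add lim c1)
  moreover have "conv (\<lambda>s. hess_log (reg_seq n) s 1 1) \<rho> x + conv (\<lambda>s. hess_log (reg_seq n) s \<i> \<i>) \<rho> x
      = conv (\<lambda>s. 2 * reg_seq n / ((cmod s)\<^sup>2 + reg_seq n)\<^sup>2) \<rho> x" for n
    unfolding conv_def
    by (subst Bochner_Integration.integral_add[symmetric])
      (simp_all only: hess_log_integrable[OF \<rho>_int reg_seq(1)] distrib_right[symmetric] hess_log_trace[OF reg_seq(1)])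
  ultimately have "(\<lambda>n. conv (\<lambda>s. 2 * reg_seq n / ((cmod s)\<^sup>2 + reg_seq n)\<^sup>2) \<rho> x) \<longlonglongrightarrow> laplacian (log_potential \<rho>) x"
    by simp
  moreover obtain B where "\<And>t. \<bar>\<rho> t\<bar> \<le> B" using compact_support_bounded[OF c0 \<rho>(2)] by blast
  ultimately show ?thesis using LIMSEQ_unique approximate_identity[OF c0, of B x] by blast
qed

text \<open>Away from the support the gradient of the potential in direction \<open>v\<close> is
  \<open>Re (v * G)\<close>, where the Cauchy transform \<open>G\<close> of the density is
  holomorphic. So the potential is smooth and harmonic there.\<close>

lemma log_potential_far:
  assumes q: "1 < q" and \<rho>: "decays q M \<rho>" and supp: "\<And>t. cmod t < R \<Longrightarrow> \<rho> t = 0" and r: "r < R"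
  shows "C_on n (ball 0 r) (log_potential \<rho>)"
    and "x \<in> ball 0 r \<Longrightarrow> laplacian (log_potential \<rho>) x = 0"
proof -
  have [measurable]: "\<rho> \<in> borel_measurable borel" using \<rho> by (rule decays_measurable)
  have \<rho>_int: "integrable lborel \<rho>" using q \<rho> by (rule decays_integrable)
  define G where "G x = (\<integral>t. of_real (\<rho> t) / (x - t) \<partial>lborel)" for x :: complex
  \<comment> \<open>The distance of the ball from the support, which keeps
    \<open>1 / (y - t)\<close> bounded wherever the density is nonzero.\<close>
  define e where "e = R - r"
  have e: "0 < e" using r by (simp add: e_def)
  have far: "e \<le> cmod (y - t)" if "y \<in> ball 0 r" "\<rho> t \<noteq> 0" for y t
  proof -
    have "R \<le> cmod t" using supp[of t] that(2) by force
    then show ?thesis using that(1) norm_triangle_ineq2[of t y] by (simp add: e_def norm_minus_commute)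
  qed
  have int: "integrable lborel (\<lambda>t. complex_of_real (\<rho> t) / (y - t))" if y: "y \<in> ball 0 r" for y
  proof (rule Bochner_Integration.integrable_bound)
    show "integrable lborel (\<lambda>t. \<rho> t / e)" using \<rho>_int by simp
    show "(\<lambda>t. complex_of_real (\<rho> t) / (y - t)) \<in> borel_measurable lborel" by measurable
    have "cmod (of_real (\<rho> t) / (y - t)) \<le> \<bar>\<rho> t / e\<bar>" for t
      using far[OF y, of t] e by (cases "\<rho> t = 0") (auto simp: norm_divide intro!: frac_le)
    then show "AE t in lborel. cmod (of_real (\<rho> t) / (y - t)) \<le> norm (\<rho> t / e)" by simp
  qed
  have hol: "G holomorphic_on ball 0 r"
    unfolding holomorphic_on_def
  proof
    fix x :: complex assume x: "x \<in> ball 0 r"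
    define \<epsilon> where "\<epsilon> = r - cmod x"
    have sub: "ball x \<epsilon> \<subseteq> ball 0 r" by (auto simp: \<epsilon>_def dist_norm) (smt (verit) norm_triangle_ineq2 norm_minus_commute)
    have "(G has_derivative (\<lambda>v. \<integral>t. - (of_real (\<rho> t) / (x - t)\<^sup>2) * v \<partial>lborel)) (at x)"
      unfolding G_def[abs_def]
    proof (rule has_derivative_integral[where r = \<epsilon> and f' = "\<lambda>x t v. - (of_real (\<rho> t) / (x - t)\<^sup>2) * v" and b = "\<lambda>t. \<bar>\<rho> t\<bar> / e\<^sup>2"])
      show "0 < \<epsilon>" using x by (simp add: \<epsilon>_def)
      show "((\<lambda>y. of_real (\<rho> t) / (y - t)) has_derivative (*) (- (of_real (\<rho> t) / (y - t)\<^sup>2))) (at y)"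
        if y: "y \<in> ball x \<epsilon>" for y t
      proof (cases "\<rho> t = 0")
        case False
        then have "y \<noteq> t" using far[of y t] y sub e by auto
        then have "((\<lambda>y. of_real (\<rho> t) / (y - t)) has_field_derivative - (of_real (\<rho> t) / (y - t)\<^sup>2)) (at y)"
          by (auto intro!: derivative_eq_intros simp: power2_eq_square)
        then show ?thesis by (simp add: has_field_derivative_def)
      next
        case True
        moreover have "(*) (0::complex) = (\<lambda>_. 0)" by auto
        ultimately show ?thesis by simp
      qed
      show "cmod (- (of_real (\<rho> t) / (y - t)\<^sup>2) * v) \<le> \<bar>\<rho> t\<bar> / e\<^sup>2 * cmod v" if y: "y \<in> ball x \<epsilon>" for y t v
      proof (cases "\<rho> t = 0")
        case False
        then have "e\<^sup>2 \<le> (cmod (y - t))\<^sup>2" using far[of y t] y sub e by (intro power_mono) auto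
        then have "\<bar>\<rho> t\<bar> / (cmod (y - t))\<^sup>2 \<le> \<bar>\<rho> t\<bar> / e\<^sup>2" using e by (intro frac_le) auto
        from mult_right_mono[OF this, of "cmod v"] show ?thesis by (simp add: norm_mult norm_divide norm_power)
      qed simp
      show "integrable lborel (\<lambda>t. \<bar>\<rho> t\<bar> / e\<^sup>2)" using \<rho>_int by simp
      show "(\<lambda>t. - (complex_of_real (\<rho> t) / (x - t)\<^sup>2) * v) \<in> borel_measurable lborel" for v by measurable
    qed (use sub int in auto)
    then have "(G has_derivative (*) (\<integral>t. - (of_real (\<rho> t) / (x - t)\<^sup>2) \<partial>lborel)) (at x)"
      by (simp only: integral_mult_left_zero)
    then show "G field_differentiable at x within ball 0 r"
      unfolding at_within_open[OF x open_ball] field_differentiable_def has_field_derivative_def by blast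
  qed
  have grad: "conv (\<lambda>s. grad_log 0 s v) \<rho> x = Re (v * G x)" if x: "x \<in> ball 0 r" for v x
  proof -
    have "grad_log 0 s v * p = Re (v * (of_real p / s))" for s p
    proof -
      have "v * (of_real p / s) = p *\<^sub>R (v / s)" by (simp add: scaleR_conv_of_real)
      then have "Re (v * (of_real p / s)) = Re (v / s) * p" by (simp only: scaleR_complex.sel mult.commute)
      also have "Re (v / s) = grad_log 0 s v"
        by (simp add: grad_log_def inner_complex_def Re_divide cmod_power2 mult.commute)
      finally show ?thesis by simp
    qed
    then have "conv (\<lambda>s. grad_log 0 s v) \<rho> x = (\<integral>t. Re (v * (of_real (\<rho> t) / (x - t))) \<partial>lborel)"
      by (simp only: conv_def)
    also have "\<dots> = Re (\<integral>t. v * (of_real (\<rho> t) / (x - t)) \<partial>lborel)"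
      using int[OF x] by (intro integral_Re integrable_mult_right)
    finally show ?thesis by (simp only: integral_mult_right_zero G_def)
  qed
  have dV: "(log_potential \<rho> has_derivative (\<lambda>v. Re (v * G x))) (at x)" if "x \<in> ball 0 r" for x
    using log_potential_has_derivative(1)[OF q \<rho>, of x] by (simp add: grad[OF that])
  have "C_on (Suc n) (ball 0 r) (log_potential \<rho>)"
    by (intro C_on_SucI[OF open_ball dV] C_on_Re C_on_mult C_on_const C_on_holomorphic hol open_ball)
  then show "C_on n (ball 0 r) (log_potential \<rho>)" by (rule C_on_SucD)
  show "laplacian (log_potential \<rho>) x = 0" if x: "x \<in> ball 0 r"
  proof -
    have "deriv_dir v (deriv_dir v (log_potential \<rho>)) x = Re (v * (deriv G x * v))" for v
    proof -
      have "(G has_derivative (*) (deriv G x)) (at x)"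
        using holomorphic_derivI[OF hol open_ball x] by (simp add: has_field_derivative_def)
      then have "((\<lambda>y. Re (v * G y)) has_derivative (\<lambda>w. Re (v * (deriv G x * w)))) (at x)"
        by (intro has_derivative_Re has_derivative_mult_right)
      then have "(deriv_dir v (log_potential \<rho>) has_derivative (\<lambda>w. Re (v * (deriv G x * w)))) (at x)"
        by (rule has_derivative_transform_within_open[OF _ open_ball x])
          (rule has_derivative_frechet_derivative_eq[OF dV, symmetric])
      then show ?thesis by (rule has_derivative_frechet_derivative_eq)
    qed
    \<comment> \<open>The factor \<open>v * v\<close> is \<open>1\<close> in the first direction and
      \<open>-1\<close> in the second, so the two terms cancel.\<close>
    then show ?thesis by (simp add: laplacian_def)
  qed
qed

section \<open>Cut-off functions and interior regularity\<close>

text \<open>Only \<open>s = 0\<close> is delicate. There Caratheodory's criterion applies with the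
  continuous quotient \<open>max 0 z ^ Suc n\<close>.\<close>

lemma DERIV_max_power:
  "((\<lambda>s::real. max 0 s ^ Suc (Suc n)) has_real_derivative real (Suc (Suc n)) * max 0 s ^ Suc n) (at s)"
proof -
  consider "s > 0" | "s < 0" | "s = 0" by linarith
  then show ?thesis
  proof cases
    case 1
    have "((\<lambda>s::real. s ^ Suc (Suc n)) has_real_derivative real (Suc (Suc n)) * max 0 s ^ Suc n) (at s)"
      using 1 DERIV_pow[of "Suc (Suc n)" s] by simp
    then show ?thesis by (rule has_field_derivative_transform_within_open[of _ _ _ "{0<..}"]) (use 1 in auto)
  next
    case 2
    have "((\<lambda>s::real. 0) has_real_derivative real (Suc (Suc n)) * max 0 s ^ Suc n) (at s)" using 2 by simp
    then show ?thesis by (rule has_field_derivative_transform_within_open[of _ _ _ "{..<0}"]) (use 2 in auto)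
  next
    case 3
    have "\<forall>z. max 0 z ^ Suc (Suc n) - max 0 s ^ Suc (Suc n) = max 0 z ^ Suc n * (z - s)"
      using 3 by (auto simp: max_def)
    moreover have "isCont (\<lambda>z::real. max 0 z ^ Suc n) s" by (intro continuous_intros)
    moreover have "max 0 s ^ Suc n = real (Suc (Suc n)) * max 0 s ^ Suc n" using 3 by simp
    ultimately show ?thesis unfolding CARAT_DERIV by (intro exI[of _ "\<lambda>z. max 0 z ^ Suc n"] conjI)
  qed
qed

lemma C_on_max_power: "C_on n UNIV (\<lambda>z. max 0 (a + b * (cmod z)\<^sup>2) ^ Suc n :: real)"
proof (induction n)
  case 0
  show ?case by (auto intro!: continuous_intros)
next
  case (Suc n)
  have d: "((\<lambda>z. max 0 (a + b * (cmod z)\<^sup>2) ^ Suc (Suc n)) has_derivative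
      (\<lambda>v. real (Suc (Suc n)) * max 0 (a + b * (cmod z)\<^sup>2) ^ Suc n * (2 * b * (z \<bullet> v)))) (at z)" for z
  proof -
    have "((\<lambda>z::complex. a + b * (z \<bullet> z)) has_derivative (\<lambda>v. 2 * b * (z \<bullet> v))) (at z)"
      by (auto intro!: derivative_eq_intros simp: inner_commute)
    from has_derivative_compose[OF this DERIV_max_power[THEN has_field_derivative_imp_has_derivative]]
    show ?thesis unfolding power2_norm_eq_inner .
  qed
  have "C_on n UNIV (\<lambda>z. real (Suc (Suc n)) * max 0 (a + b * (cmod z)\<^sup>2) ^ Suc n * (2 * b * (z \<bullet> v)))" for v
    by (intro C_on_mult C_on_const Suc.IH open_UNIV C_on_bounded_linear[OF _ bounded_linear_inner_left] C_on_ident)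
  then show ?case by (intro C_on_SucI[OF open_UNIV d])
qed

text \<open>Regularity is proved one order at a time, so a cut-off of finite order is enough and
  truncated powers of quadratic polynomials provide it.\<close>

lemma cutoff_exists:
  assumes "0 < R"
  shows "\<exists>cut :: complex \<Rightarrow> real. C_on n UNIV cut \<and> (\<forall>t. 0 \<le> cut t \<and> cut t \<le> 1 \<and>
    (cmod t < R \<longrightarrow> cut t = 1) \<and> (cmod t > 2 * R \<longrightarrow> cut t = 0))"
proof -
  \<comment> \<open>\<open>a\<close> is positive exactly for \<open>|t| < 2 R\<close> and
    \<open>b\<close> exactly for \<open>|t| > R\<close>, so their sum never vanishes.\<close>
  define a where "a t = max 0 (4 * R\<^sup>2 + (-1) * (cmod t)\<^sup>2) ^ Suc n" for t
  define b where "b t = max 0 (- R\<^sup>2 + 1 * (cmod t)\<^sup>2) ^ Suc n" for t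
  have nonneg: "0 \<le> a t" "0 \<le> b t" for t by (simp_all add: a_def b_def)
  have R: "0 < R\<^sup>2" using assms by simp
  have pos: "0 < a t + b t" for t
  proof (cases "(cmod t)\<^sup>2 < 4 * R\<^sup>2")
    case True
    then have "0 < a t" by (simp add: a_def)
    then show ?thesis using nonneg(2)[of t] by linarith
  next
    case False
    then have "0 < - R\<^sup>2 + 1 * (cmod t)\<^sup>2" using R by linarith
    then have "0 < b t" by (simp add: b_def)
    then show ?thesis using nonneg(1)[of t] by linarith
  qed
  then have nz: "a t + b t \<noteq> 0" for t by (simp add: less_imp_neq[symmetric])
  show ?thesis
  proof (intro exI[of _ "\<lambda>t. a t / (a t + b t)"] conjI allI impI)
    show "C_on n UNIV (\<lambda>t. a t / (a t + b t))"
      unfolding a_def b_def by (intro C_on_divide C_on_add C_on_max_power open_UNIV nz[unfolded a_def b_def])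
    show "0 \<le> a t / (a t + b t)" "a t / (a t + b t) \<le> 1" for t
      using nonneg[of t] pos[of t] by (auto simp: divide_le_eq_1)
    show "a t / (a t + b t) = 1" if "cmod t < R" for t
    proof -
      have "(cmod t)\<^sup>2 \<le> R\<^sup>2" using that by (intro power_mono) auto
      then have "b t = 0" by (simp add: b_def max_def)
      then show ?thesis using pos[of t] by simp
    qed
    show "a t / (a t + b t) = 0" if "cmod t > 2 * R" for t
    proof -
      have "(2 * R)\<^sup>2 \<le> (cmod t)\<^sup>2" using that assms by (intro power_mono) auto
      then have "a t = 0" by (simp add: a_def max_def power_mult_distrib)
      then show ?thesis by simp
    qed
  qed
qed

text \<open>
  A cut-off splits the density into a compactly supported part and a part whose potential is locally
  the real part of a holomorphic function.
\<close>

theorem log_potential_regularity: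
  assumes q: "1 < q" and \<rho>: "decays q M \<rho>" and C: "C_on n UNIV \<rho>"
  shows "C_on (Suc n) UNIV (log_potential \<rho>)"
    and "1 \<le> n \<Longrightarrow> laplacian (log_potential \<rho>) x = log_mass * \<rho> x"
proof -
  have local: "C_on (Suc n) (ball 0 r) (log_potential \<rho>) \<and>
      (1 \<le> n \<longrightarrow> (\<forall>x\<in>ball 0 r. laplacian (log_potential \<rho>) x = log_mass * \<rho> x))" if r: "0 < r" for r
  proof -
    \<comment> \<open>Any radius beyond \<open>r\<close> would do; \<open>log_potential_far\<close>
      needs a positive margin between the ball and the support of the outer part.\<close>
    define R where "R = r + 1"
    have R: "0 < R" and rR: "r < R" using r by (simp_all add: R_def)
    obtain cut :: "complex \<Rightarrow> real" where cut1: "C_on n UNIV cut" and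
      "\<forall>t. 0 \<le> cut t \<and> cut t \<le> 1 \<and> (cmod t < R \<longrightarrow> cut t = 1) \<and> (cmod t > 2 * R \<longrightarrow> cut t = 0)"
      using cutoff_exists[OF R, of n] by auto
    then have cut: "C_on n UNIV cut" "0 \<le> cut t" "cut t \<le> 1"
      "cmod t < R \<Longrightarrow> cut t = 1" "cmod t > 2 * R \<Longrightarrow> cut t = 0" for t
      by simp_all
    define \<rho>1 where "\<rho>1 t = cut t * \<rho> t" for t
    define \<rho>2 where "\<rho>2 t = (1 - cut t) * \<rho> t" for t
    have [measurable]: "cut \<in> borel_measurable borel" "\<rho> \<in> borel_measurable borel"
      using C_on_imp_continuous[OF cut(1)] decays_measurable[OF \<rho>] by (auto intro: borel_measurable_continuous_onI)
    have le: "\<bar>\<rho>1 t\<bar> \<le> \<bar>\<rho> t\<bar>" "\<bar>\<rho>2 t\<bar> \<le> \<bar>\<rho> t\<bar>" for t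
      using cut(2,3)[of t] by (auto simp: \<rho>1_def \<rho>2_def abs_mult intro!: mult_left_le_one_le)
    have dec: "decays q M \<rho>1" "decays q M \<rho>2"
      unfolding decays_def using order_trans[OF le(1) decays_bound[OF \<rho>]] order_trans[OF le(2) decays_bound[OF \<rho>]]
      by (auto simp: \<rho>1_def[abs_def] \<rho>2_def[abs_def])
    have split: "log_potential \<rho> = (\<lambda>x. log_potential \<rho>1 x + log_potential \<rho>2 x)"
    proof
      fix x
      have "reg_log 0 (x - t) * \<rho> t = reg_log 0 (x - t) * \<rho>1 t + reg_log 0 (x - t) * \<rho>2 t" for t
        by (simp add: \<rho>1_def \<rho>2_def algebra_simps)
      then show "log_potential \<rho> x = log_potential \<rho>1 x + log_potential \<rho>2 x"
        unfolding log_potential_def conv_def using reg_log_integrable[OF q dec(1), of 0 x] reg_log_integrable[OF q dec(2), of 0 x]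
        by simp
    qed
    have C1: "C_on n UNIV \<rho>1" unfolding \<rho>1_def[abs_def] by (intro C_on_mult open_UNIV cut(1) C)
    have supp1: "\<rho>1 t = 0" if "cmod t > 2 * R" for t using cut(5)[OF that] by (simp add: \<rho>1_def)
    have supp2: "\<rho>2 t = 0" if "cmod t < R" for t using cut(4)[OF that] by (simp add: \<rho>2_def)
    have near: "C_on (Suc n) (ball 0 r) (log_potential \<rho>1)"
      using C_on_subset[OF log_potential_C_compact[OF C1 supp1] subset_UNIV] .
    have far: "C_on (Suc n) (ball 0 r) (log_potential \<rho>2)"
      "\<And>x. x \<in> ball 0 r \<Longrightarrow> laplacian (log_potential \<rho>2) x = 0"
      using log_potential_far[OF q dec(2) supp2 rR] by blast+
    have "laplacian (log_potential \<rho>) x = log_mass * \<rho> x" if n: "1 \<le> n" and x: "x \<in> ball 0 r" for x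
    proof -
      have "laplacian (log_potential \<rho>) x = laplacian (\<lambda>x. 1 * log_potential \<rho>1 x + 1 * log_potential \<rho>2 x) x"
        by (simp add: split)
      also have "\<dots> = 1 * laplacian (log_potential \<rho>1) x + 1 * laplacian (log_potential \<rho>2) x"
        using n by (intro laplacian_linear_comb[OF open_ball x] C_on_le[OF near] C_on_le[OF far(1)]) auto
      also have "\<dots> = log_mass * \<rho>1 x"
        using laplacian_log_potential_compact[OF C_on_le[OF C1 n] supp1] far(2)[OF x] by simp
      finally show ?thesis using cut(4)[of x] x by (simp add: \<rho>1_def R_def)
    qed
    moreover have "C_on (Suc n) (ball 0 r) (log_potential \<rho>)"
      unfolding split by (intro C_on_add open_ball near far)
    ultimately show ?thesis by blast
  qed
  show "C_on (Suc n) UNIV (log_potential \<rho>)"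
  proof (rule C_on_local)
    fix z :: complex
    show "\<exists>V. open V \<and> z \<in> V \<and> C_on (Suc n) V (log_potential \<rho>)"
      using local[of "cmod z + 1"] by (intro exI[of _ "ball 0 (cmod z + 1)"]) (simp add: add_nonneg_pos del: C_on.simps)
  qed
  show "laplacian (log_potential \<rho>) x = log_mass * \<rho> x" if "1 \<le> n"
    using local[of "cmod x + 1"] that by (simp add: add_nonneg_pos del: C_on.simps)
qed

section \<open>The Kazdan-Warner equation\<close>

lemma exp_diff_le:
  fixes a b m :: real
  assumes "a \<le> m" "b \<le> m"
  shows "\<bar>exp a - exp b\<bar> \<le> exp m * \<bar>a - b\<bar>"
proof -
  have *: "exp b - exp a \<le> exp m * (b - a)" if "a \<le> b" "b \<le> m" for a b :: real
  proof -
    have "1 - (b - a) \<le> exp (a - b)" using exp_ge_add_one_self[of "a - b"] by linarith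
    then have "exp b * (1 - exp (a - b)) \<le> exp m * (b - a)" using that by (intro mult_mono) auto
    then show ?thesis by (simp add: exp_diff right_diff_distrib)
  qed
  show ?thesis using *[of a b] *[of b a] assms by (cases "a \<le> b") auto
qed

lemma decays_abs_integral:
  assumes "1 < q" "decays q M \<rho>"
  shows "\<bar>\<integral>t. \<rho> t \<partial>lborel\<bar> \<le> M * (\<integral>t. jap t powr (-q) \<partial>lborel)"
proof -
  have "\<bar>\<integral>t. \<rho> t \<partial>lborel\<bar> \<le> (\<integral>t. \<bar>\<rho> t\<bar> \<partial>lborel)" by (rule integral_abs_bound)
  also have "\<dots> \<le> (\<integral>t. M * jap t powr (-q) \<partial>lborel)"
    using decays_bound[OF assms(2)]
    by (intro integral_mono integrable_abs decays_integrable[OF assms] integrable_mult_right integrable_jap_powr assms)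
  finally show ?thesis by simp
qed

abbreviation log_weight :: "complex \<Rightarrow> real" where
  "log_weight x \<equiv> 1 + half_log x"

lemma log_weight_ge_1: "1 \<le> log_weight x"
  using half_log_nonneg[of x] by simp

definition potential_constant :: "real \<Rightarrow> real" where
  "potential_constant q = log_constant q + (\<integral>t. jap t powr (-q) \<partial>lborel)"

lemma log_constant_nonneg: "0 \<le> log_constant q"
proof -
  have "0 \<le> (2 + half_log t) * jap t powr (-q)" for t using half_log_nonneg[of t] by simp
  then show ?thesis unfolding log_constant_def
    by (intro add_nonneg_nonneg mult_nonneg_nonneg Bochner_Integration.integral_nonneg sing_nonneg) simp_all
qed

lemma potential_constant_nonneg: "0 \<le> potential_constant q"
  unfolding potential_constant_def
  by (intro add_nonneg_nonneg log_constant_nonneg Bochner_Integration.integral_nonneg) simp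

text \<open>Boundedness of the potential from densities of decay \<open>q\<close> to functions
  measured against \<open>log_weight\<close>. Being linear in \<open>M\<close>, it gives both the
  invariance of a ball and the contraction estimate.\<close>

lemma log_potential_bound:
  assumes "1 < q" "decays q M \<rho>"
  shows "\<bar>log_potential \<rho> x\<bar> \<le> potential_constant q * M * log_weight x"
proof -
  let ?I = "\<integral>t. jap t powr (-q) \<partial>lborel"
  have M: "0 \<le> M" using assms decays_nonneg by blast
  have I: "0 \<le> ?I" by (intro Bochner_Integration.integral_nonneg) simp
  have "\<bar>log_potential \<rho> x - half_log x * (\<integral>t. \<rho> t \<partial>lborel)\<bar> \<le> log_constant q * M"
    using reg_log_estimate[OF assms, of 0 x] by (simp add: log_potential_def)
  moreover have "\<bar>half_log x * (\<integral>t. \<rho> t \<partial>lborel)\<bar> \<le> half_log x * (M * ?I)"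
    unfolding abs_mult abs_of_nonneg[OF half_log_nonneg]
    by (intro mult_left_mono decays_abs_integral[OF assms] half_log_nonneg)
  ultimately have "\<bar>log_potential \<rho> x\<bar> \<le> log_constant q * M + half_log x * (M * ?I)" by linarith
  also have "\<dots> \<le> log_constant q * M * log_weight x + log_weight x * (M * ?I)"
    using mult_left_mono[OF log_weight_ge_1[of x], of "log_constant q * M"] log_constant_nonneg[of q] M
      mult_right_mono[of "half_log x" "log_weight x" "M * ?I"] I by simp
  finally show ?thesis by (simp add: potential_constant_def algebra_simps)
qed

lemma log_potential_diff:
  assumes "1 < q" "decays q M \<rho>" "decays q M' \<rho>'"
  shows "log_potential (\<lambda>t. \<rho> t - \<rho>' t) x = log_potential \<rho> x - log_potential \<rho>' x"
  using reg_log_integrable[OF assms(1,2), of 0 x] reg_log_integrable[OF assms(1,3), of 0 x]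
  by (simp add: log_potential_def conv_def right_diff_distrib)

theorem kazdan_warner_plane:
  fixes g h :: "complex \<Rightarrow> real"
  assumes p: "1 < p" and g: "smooth_on UNIV g" and h: "smooth_on UNIV h"
    and h_nonneg: "\<And>z. 0 \<le> h z"
    and g_le: "\<And>z. \<bar>g z\<bar> \<le> C * jap z powr (-p)" and h_le: "\<And>z. h z \<le> C * jap z powr (-p)"
    and int_g: "(\<integral>z. g z \<partial>lborel) \<le> 0"
  shows "\<exists>f. smooth_on UNIV f \<and> (\<forall>z. laplacian f z = g z + h z * exp (f z))"
proof -
  have dg: "decays p C g"
    using g_le smooth_on_imp_C_on[OF g, of 0] by (auto simp: decays_def intro: borel_measurable_continuous_onI)
  have C: "0 \<le> C" using dg by (rule decays_nonneg)
  \<comment> \<open>The factor cancels the constant in the Laplacian of a logarithmic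
    potential.\<close>
  define u where "u x = inverse log_mass * log_potential g x" for x
  have u_C: "C_on n UNIV u" for n
    unfolding u_def[abs_def]
    by (intro C_on_mult C_on_const open_UNIV C_on_SucD[OF log_potential_regularity(1)[OF p dg smooth_on_imp_C_on[OF g]]])
  have pot_C2: "C_on 2 UNIV (log_potential g)"
    using log_potential_regularity(1)[OF p dg smooth_on_imp_C_on[OF g], of 1] by (simp only: numeral_2_eq_2 One_nat_def)
  have u_lap: "laplacian u x = g x" for x
    using laplacian_linear_comb[OF open_UNIV UNIV_I pot_C2 pot_C2, of "inverse log_mass" 0 x]
      log_potential_regularity(2)[OF p dg smooth_on_imp_C_on[OF g, of 1], of x] log_mass_pos
    by (simp add: u_def[abs_def])
  define B where "B = inverse log_mass * (log_constant p * C)"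
  \<comment> \<open>Only an upper bound is needed, since \<open>u\<close> enters the nonlinear term
    through \<open>exp u\<close>. The leading term of the potential is nonpositive by
    \<open>int_g\<close>.\<close>
  have u_le: "u x \<le> B" for x
  proof -
    have "\<bar>log_potential g x - half_log x * (\<integral>t. g t \<partial>lborel)\<bar> \<le> log_constant p * C"
      using reg_log_estimate[OF p dg, of 0 x] by (simp add: log_potential_def)
    moreover have "half_log x * (\<integral>t. g t \<partial>lborel) \<le> 0"
      by (intro mult_nonneg_nonpos half_log_nonneg int_g)
    ultimately have "log_potential g x \<le> log_constant p * C" by linarith
    then show ?thesis unfolding u_def B_def using log_mass_pos by (intro mult_left_mono) auto
  qed
  define W where "W x = h x * exp (u x)" for x
  have W_C: "C_on n UNIV W" for n
    unfolding W_def[abs_def] by (intro C_on_mult C_on_exp open_UNIV u_C smooth_on_imp_C_on[OF h])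
  have W_nonneg: "0 \<le> W x" for x using h_nonneg by (simp add: W_def)
  have W_le: "W x \<le> C * exp B * jap x powr (-p)" for x
  proof -
    have "W x \<le> C * jap x powr (-p) * exp B"
      unfolding W_def using h_le h_nonneg u_le C by (intro mult_mono) auto
    then show ?thesis by (simp add: mult_ac)
  qed
  \<comment> \<open>The surplus \<open>p - 1\<close> is split: the fixed-point density keeps decay
    \<open>q > 1\<close>, and \<open>p - q\<close> is the sum of \<open>A / 2\<close>, the cost of
    \<open>exp (A * log_weight x)\<close>, and \<open>\<eta>\<close>, the cost of one factor
    \<open>log_weight x\<close>.\<close>
  define q where "q = (1 + p) / 2"
  define A where "A = (p - 1) / 2"
  define \<eta> where "\<eta> = (p - 1) / 4"
  have pos: "1 < q" "0 < A" "0 < \<eta>" using p by (auto simp: q_def A_def \<eta>_def)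
  define K where "K = C * exp B * exp A * (1 + 1 / (2 * \<eta>))"
  have K: "0 \<le> K" using C pos by (simp add: K_def)
  \<comment> \<open>The additional factor \<open>log_weight x\<close> comes from differentiating
    \<open>exp (z x * log_weight x)\<close> with respect to \<open>z x\<close>; it is needed for the
    Lipschitz estimate.\<close>
  have W_exp: "W x * log_weight x * exp (A * log_weight x) \<le> K * jap x powr (-q)" for x
  proof -
    have e: "exp (A * log_weight x) = exp A * jap x powr (A / 2)"
      using jap_pos[of x] by (simp add: powr_def distrib_left exp_add jap_nz)
    have "1 \<le> jap x powr \<eta>" using jap_ge_1[of x] pos by (intro ge_one_powr_ge_zero) auto
    then have w: "log_weight x \<le> (1 + 1 / (2 * \<eta>)) * jap x powr \<eta>"
      using half_log_le_powr[OF pos(3), of x] by (simp add: distrib_right)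
    have "W x * log_weight x * exp (A * log_weight x)
        \<le> (C * exp B * jap x powr (-p)) * ((1 + 1 / (2 * \<eta>)) * jap x powr \<eta>) * (exp A * jap x powr (A / 2))"
      unfolding e using W_le[of x] w W_nonneg[of x] log_weight_ge_1[of x] C pos
      by (intro mult_mono) auto
    also have "\<dots> = K * (jap x powr (-p) * jap x powr \<eta> * jap x powr (A / 2))" by (simp add: K_def)
    also have "jap x powr (-p) * jap x powr \<eta> * jap x powr (A / 2) = jap x powr (-q)"
    proof -
      have "-p + \<eta> + A / 2 = -q" by (simp add: q_def A_def \<eta>_def field_simps)
      then show ?thesis by (simp only: powr_add[symmetric])
    qed
    finally show ?thesis .
  qed
  define E where "E = potential_constant q"
  have E: "0 \<le> E" unfolding E_def by (rule potential_constant_nonneg)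
  \<comment> \<open>Small enough for a contraction (\<open>1 / 2\<close>) and for the invariance of
    the ball (\<open>A\<close>); the summand \<open>1\<close> keeps the denominator positive when
    \<open>E * K\<close> vanishes.\<close>
  define \<delta> where "\<delta> = min (1 / 2) A / (E * K + 1)"
  have EK: "0 \<le> E * K" using E K by simp
  have \<delta>: "0 < \<delta>" using EK pos by (simp add: \<delta>_def)
  have "\<delta> * (E * K) \<le> \<delta> * (E * K + 1)" using \<delta> by simp
  also have "\<dots> = min (1 / 2) A" using EK by (simp add: \<delta>_def)
  finally have \<delta>_le: "\<delta> * (E * K) \<le> 1 / 2" "\<delta> * (E * K) \<le> A" by simp_all
  \<comment> \<open>With \<open>y = z * log_weight\<close>, the function \<open>R z\<close> is the
    density \<open>W * exp y\<close>, and \<open>T z = z\<close> says that \<open>y\<close> is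
    \<open>\<delta>\<close> times its potential.\<close>
  define R where "R z x = W x * exp (z x * log_weight x)" for z :: "complex \<Rightarrow> real" and x
  define T where "T z x = \<delta> * log_potential (R z) x / log_weight x" for z :: "complex \<Rightarrow> real" and x
  have exp_le: "z x * log_weight x \<le> A * log_weight x" if "\<And>x. \<bar>z x\<bar> \<le> A" for z :: "complex \<Rightarrow> real" and x
    using that[of x] log_weight_ge_1[of x] by (intro mult_right_mono) auto
  have R_meas: "R z \<in> borel_measurable borel" if "continuous_on UNIV z" for z
  proof -
    have [measurable]: "z \<in> borel_measurable borel" "W \<in> borel_measurable borel"
      using that C_on_imp_continuous[OF W_C] by (auto intro: borel_measurable_continuous_onI)
    show ?thesis unfolding R_def[abs_def] by measurable
  qed
  have R_decays: "decays q K (R z)" if z: "continuous_on UNIV z" "\<And>x. \<bar>z x\<bar> \<le> A" for z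
    unfolding decays_def
  proof (intro conjI allI R_meas z)
    fix x
    have "\<bar>R z x\<bar> = W x * 1 * exp (z x * log_weight x)" using W_nonneg[of x] by (simp add: R_def abs_mult)
    also have "\<dots> \<le> W x * log_weight x * exp (A * log_weight x)"
      using W_nonneg[of x] log_weight_ge_1[of x] exp_le[of z x, OF z(2)] by (intro mult_mono) auto
    finally show "\<bar>R z x\<bar> \<le> K * jap x powr (-q)" using W_exp[of x] by linarith
  qed
  \<comment> \<open>Stated for a general density because it is applied both to \<open>R z\<close>
    and to a difference of two such densities.\<close>
  have T_bound: "\<bar>\<delta> * log_potential \<rho> x / log_weight x\<bar> \<le> \<delta> * (E * M)" if "decays q M \<rho>" for \<rho> M x
  proof -
    have "\<delta> * \<bar>log_potential \<rho> x\<bar> \<le> \<delta> * (E * M * log_weight x)"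
      using \<delta> log_potential_bound[OF pos(1) that, of x] unfolding E_def by (intro mult_left_mono) auto
    moreover have lw: "0 < log_weight x" using log_weight_ge_1[of x] by linarith
    ultimately have "\<delta> * \<bar>log_potential \<rho> x\<bar> / log_weight x \<le> \<delta> * (E * M)"
      by (simp only: pos_divide_le_eq mult.assoc)
    then show ?thesis using \<delta> lw by (simp only: abs_mult abs_divide abs_of_pos)
  qed
  have T_le: "\<bar>T z x\<bar> \<le> A" if z: "continuous_on UNIV z" "\<And>x. \<bar>z x\<bar> \<le> A" for z x
    unfolding T_def using T_bound[OF R_decays[OF z], of x] \<delta>_le by linarith
  have T_cont: "continuous_on UNIV (T z)" if z: "continuous_on UNIV z" "\<And>x. \<bar>z x\<bar> \<le> A" for z
  proof -
    have "continuous_on UNIV (log_potential (R z))"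
      using C_on_imp_continuous[OF log_potential_C1[OF pos(1) R_decays[OF z]]] .
    moreover have "continuous_on UNIV (\<lambda>x. log_weight x)"
      by (intro continuous_intros) (simp_all add: jap_nz)
    moreover have "log_weight x \<noteq> 0" for x using log_weight_ge_1[of x] by linarith
    ultimately show ?thesis unfolding T_def[abs_def] by (intro continuous_on_divide continuous_on_mult continuous_on_const) auto
  qed
  have T_lip: "\<bar>T z x - T z' x\<bar> \<le> 1 / 2 * D"
    if z: "continuous_on UNIV z" "\<And>x. \<bar>z x\<bar> \<le> A" and z': "continuous_on UNIV z'" "\<And>x. \<bar>z' x\<bar> \<le> A"
      and D: "\<And>x. \<bar>z x - z' x\<bar> \<le> D" for z z' x D
  proof -
    have "decays q (K * D) (\<lambda>x. R z x - R z' x)"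
      unfolding decays_def
    proof (intro conjI allI borel_measurable_diff R_meas z z')
      fix x
      have D0: "0 \<le> D" using D[of x] by linarith
      have "\<bar>R z x - R z' x\<bar> = W x * \<bar>exp (z x * log_weight x) - exp (z' x * log_weight x)\<bar>"
        using W_nonneg[of x] by (simp add: R_def right_diff_distrib[symmetric] abs_mult)
      also have "\<dots> \<le> W x * (exp (A * log_weight x) * \<bar>z x * log_weight x - z' x * log_weight x\<bar>)"
        using W_nonneg by (intro mult_left_mono exp_diff_le exp_le[of z x, OF z(2)] exp_le[of z' x, OF z'(2)]) auto
      also have "\<bar>z x * log_weight x - z' x * log_weight x\<bar> = \<bar>z x - z' x\<bar> * log_weight x"
        using log_weight_ge_1[of x] by (simp add: left_diff_distrib[symmetric] abs_mult)
      also have "W x * (exp (A * log_weight x) * (\<bar>z x - z' x\<bar> * log_weight x))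
          = W x * log_weight x * exp (A * log_weight x) * \<bar>z x - z' x\<bar>" by (simp add: mult_ac)
      also have "\<dots> \<le> K * jap x powr (-q) * D"
        by (rule mult_mono[OF W_exp D]) (use K in auto)
      finally show "\<bar>R z x - R z' x\<bar> \<le> K * D * jap x powr (-q)" by (simp add: mult_ac)
    qed
    from T_bound[OF this, of x]
    have "\<bar>T z x - T z' x\<bar> \<le> \<delta> * (E * K) * D"
      unfolding T_def log_potential_diff[OF pos(1) R_decays[OF z] R_decays[OF z']]
      by (simp add: right_diff_distrib diff_divide_distrib mult_ac)
    also have "\<dots> \<le> 1 / 2 * D" using D[of x] by (intro mult_right_mono \<delta>_le) linarith
    finally show ?thesis .
  qed
  \<comment> \<open>\<open>Bcontfun\<close> is meaningful only for bounded continuous functions, so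
    \<open>\<Phi>\<close> represents \<open>T\<close> on the ball of radius \<open>A\<close> only;
    this is why membership in \<open>cball\<close> accompanies every use.\<close>
  define \<Phi> where "\<Phi> z = Bcontfun (T (apply_bcontfun z))" for z :: "(complex, real) bcontfun"
  have ball: "continuous_on UNIV (apply_bcontfun z) \<and> (\<forall>x. \<bar>apply_bcontfun z x\<bar> \<le> A)" if "z \<in> cball 0 A" for z :: "(complex, real) bcontfun"
    using that norm_bounded[of z] by (auto simp: dist_norm intro: order_trans)
  have \<Phi>: "apply_bcontfun (\<Phi> z) = T (apply_bcontfun z)" if z: "z \<in> cball 0 A" for z
    unfolding \<Phi>_def using ball[OF z] T_cont T_le by (intro Bcontfun_inverse bcontfun_normI[of _ A]) auto
  have "\<exists>!z\<in>cball 0 A. \<Phi> z = z"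
  proof (rule Banach_fix)
    show "complete (cball (0 :: (complex, real) bcontfun) A)" by (simp add: complete_eq_closed)
    show "cball (0 :: (complex, real) bcontfun) A \<noteq> {}" using pos by simp
    show "\<Phi> ` cball 0 A \<subseteq> cball 0 A"
      using \<Phi> ball T_le by (auto intro!: norm_bound)
    show "dist (\<Phi> z) (\<Phi> z') \<le> 1 / 2 * dist z z'" if "z \<in> cball 0 A" "z' \<in> cball 0 A" for z z'
    proof (rule dist_bound)
      fix x
      have "\<bar>apply_bcontfun z x - apply_bcontfun z' x\<bar> \<le> dist z z'" for x
        using dist_bounded[of z x z'] by (simp add: dist_real_def)
      then show "dist (apply_bcontfun (\<Phi> z) x) (apply_bcontfun (\<Phi> z') x) \<le> 1 / 2 * dist z z'"
        using T_lip[of "apply_bcontfun z" "apply_bcontfun z'" "dist z z'" x] \<Phi>[OF that(1)] \<Phi>[OF that(2)] ball[OF that(1)] ball[OF that(2)]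
        by (simp add: dist_real_def)
    qed
  qed auto
  then obtain zf :: "(complex, real) bcontfun" where zf: "zf \<in> cball 0 A" "\<Phi> zf = zf" by blast
  define z where "z = apply_bcontfun zf"
  have z: "continuous_on UNIV z" "\<And>x. \<bar>z x\<bar> \<le> A" and fixed: "T z = z"
    using ball[OF zf(1)] \<Phi>[OF zf(1)] zf(2) by (auto simp: z_def)
  define y where "y x = \<delta> * log_potential (R z) x" for x
  have zy: "z x * log_weight x = y x" for x
    using fun_cong[OF fixed, of x] log_weight_ge_1[of x] by (auto simp: T_def y_def field_simps)
  have Rz: "R z = (\<lambda>x. W x * exp (y x))" by (rule ext) (simp only: R_def zy)
  note dR = R_decays[OF z]
  \<comment> \<open>Bootstrapping: regularity of \<open>y\<close> passes to the density
    \<open>W * exp y\<close>, whose potential has one derivative more. The start needs only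
    continuity of the fixed point.\<close>
  have y_C: "C_on n UNIV y" for n
  proof (induction n)
    case 0
    have "C_on 1 UNIV y" unfolding y_def[abs_def]
      by (intro C_on_mult C_on_const open_UNIV log_potential_C1[OF pos(1) dR])
    then show ?case by (rule C_on_le) simp
  next
    case (Suc n)
    have "C_on n UNIV (R z)" unfolding Rz by (intro C_on_mult C_on_exp open_UNIV W_C Suc.IH)
    then show ?case unfolding y_def[abs_def]
      by (intro C_on_mult C_on_const open_UNIV log_potential_regularity(1)[OF pos(1) dR])
  qed
  have R_C: "C_on n UNIV (R z)" for n unfolding Rz by (intro C_on_mult C_on_exp open_UNIV W_C y_C)
  have potR_C2: "C_on 2 UNIV (log_potential (R z))"
    using log_potential_regularity(1)[OF pos(1) dR R_C, of 1] by (simp only: numeral_2_eq_2 One_nat_def)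
  \<comment> \<open>The parameter of the equation differs from \<open>\<delta>\<close> by the
    constant in the Laplacian of a potential.\<close>
  define \<epsilon> where "\<epsilon> = \<delta> * log_mass"
  have \<epsilon>: "0 < \<epsilon>" using \<delta> log_mass_pos by (simp add: \<epsilon>_def)
  have y_lap: "laplacian y x = \<epsilon> * R z x" for x
    using laplacian_linear_comb[OF open_UNIV UNIV_I potR_C2 potR_C2, of \<delta> 0 x]
      log_potential_regularity(2)[OF pos(1) dR R_C[of 1], of x] by (simp add: y_def[abs_def] \<epsilon>_def)
  \<comment> \<open>The constant \<open>ln \<epsilon>\<close> turns \<open>W * exp y\<close> into
    \<open>\<epsilon> * W * exp y\<close> inside the exponential term, which is exactly the
    Laplacian of \<open>y\<close>.\<close>
  define f where "f x = 1 * (1 * u x + 1 * y x) + ln \<epsilon> * 1" for x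
  have uy_C: "C_on n UNIV (\<lambda>x. 1 * u x + 1 * y x)" for n
    by (intro C_on_add C_on_mult C_on_const open_UNIV u_C y_C)
  have "smooth_on UNIV f"
    unfolding smooth_on_def f_def[abs_def] by (intro allI C_on_add C_on_mult C_on_const open_UNIV uy_C)
  moreover have "laplacian f x = g x + h x * exp (f x)" for x
  proof -
    have "laplacian f x = 1 * laplacian (\<lambda>x. 1 * u x + 1 * y x) x + ln \<epsilon> * laplacian (\<lambda>_. 1) x"
      unfolding f_def[abs_def] by (rule laplacian_linear_comb[OF open_UNIV UNIV_I uy_C C_on_const])
    also have "laplacian (\<lambda>_. 1) x = 0" by (simp add: laplacian_def)
    also have "laplacian (\<lambda>x. 1 * u x + 1 * y x) x = 1 * laplacian u x + 1 * laplacian y x"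
      by (rule laplacian_linear_comb[OF open_UNIV UNIV_I u_C y_C])
    finally have "laplacian f x = g x + \<epsilon> * R z x" by (simp only: u_lap y_lap mult_1 mult_zero_right add_0_right)
    also have "\<epsilon> * R z x = h x * exp (f x)"
      unfolding Rz W_def f_def using \<epsilon> by (simp add: exp_add)
    finally show ?thesis .
  qed
  ultimately show ?thesis by blast
qed

section \<open>The curvature equation\<close>

lemma smooth_on_japanese_powr: "smooth_on UNIV (\<lambda>z. jap z powr k)"
  by (simp add: smooth_on_def C_on_japanese_powr del: C_on.simps)

context holomorphic_bundle
begin

text \<open>The curvature coefficient is real and \<open>omega k z\<close> is purely imaginary, so
  the difference of the two sides is \<open>\<i> / 4\<close> times a real expression.\<close>

lemma curvature_equation_iff_laplacian:
  assumes K: "hermitian_structure L K" and f: "smooth_on UNIV f" and s: "smooth_section L UNIV s"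
  shows "\<i> * chern_curvature L (conformal f K) z + 1 / 2 * of_real (norm_sq (conformal f K) s z) * omega k z
      = of_real (lam z) / 2 * omega k z \<longleftrightarrow>
    laplacian f z = (4 * Re (chern_curvature L K z) - lam z * jap z powr k) + norm_sq K s z * jap z powr k * exp (f z)"
proof -
  define F where "F = Re (chern_curvature L K z)"
  define w where "w = jap z powr k"
  have "\<i> * chern_curvature L (conformal f K) z + 1 / 2 * of_real (norm_sq (conformal f K) s z) * omega k z
      - of_real (lam z) / 2 * omega k z
      = \<i> * of_real ((4 * F - laplacian f z + norm_sq K s z * w * exp (f z) - lam z * w) / 4)"
    unfolding chern_curvature_conformal[OF K f] norm_sq_conformal[OF s] omega_def w_def[symmetric]
      chern_curvature_real_smooth(1)[OF K, symmetric, of z, folded F_def]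
    by (simp add: field_simps)
  then have "\<i> * chern_curvature L (conformal f K) z + 1 / 2 * of_real (norm_sq (conformal f K) s z) * omega k z
      = of_real (lam z) / 2 * omega k z \<longleftrightarrow>
      \<i> * complex_of_real ((4 * F - laplacian f z + norm_sq K s z * w * exp (f z) - lam z * w) / 4) = 0"
    by (metis right_minus_eq)
  also have "\<dots> \<longleftrightarrow> 4 * F - laplacian f z + norm_sq K s z * w * exp (f z) - lam z * w = 0"
    by (simp only: mult_eq_0_iff of_real_eq_0_iff divide_eq_0_iff) simp
  finally show ?thesis unfolding F_def w_def by linarith
qed

end

theorem corollary4p2:
  fixes L :: "'e line_bundle"
    and K :: "'e \<Rightarrow> 'e \<Rightarrow> complex"
    and \<phi> :: "complex \<Rightarrow> 'e"
    and lam :: "complex \<Rightarrow> real"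
    and k l \<Lambda> :: real
  assumes "holomorphic_line_bundle L"
    and "smooth_section L UNIV \<phi>"
    and "\<exists>z. \<phi> z \<noteq> vzero L z"
    and "smooth_on UNIV lam"
    and "hermitian_structure L K"
    and "l > 0" and "l - 2 \<le> k" and "k < l - 1"
    and "Re (integral_2form (\<lambda>z. 2 * \<i> * chern_curvature L K z - of_real (lam z) * omega k z)) < 0"
    and "\<And>z. cmod (\<i> * Lambda_omega k (chern_curvature L K) z - of_real (lam z) / 2) + norm_sq K \<phi> z
               \<le> \<Lambda> * (1 + (cmod z)\<^sup>2) powr (- l)"
  shows "\<exists>H. hermitian_structure L H \<and>
           (\<forall>z. \<i> * chern_curvature L H z + 1 / 2 * of_real (norm_sq H \<phi> z) * omega k z
                = of_real (lam z) / 2 * omega k z)"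
proof -
  interpret holomorphic_bundle L by standard fact
  define F where "F z = Re (chern_curvature L K z)" for z
  have F: "chern_curvature L K z = of_real (F z)" for z
    using chern_curvature_real_smooth(1)[OF assms(5)] by (simp add: F_def)
  define w where "w z = jap z powr k" for z
  have w: "0 < w z" for z using jap_pos[of z] by (simp add: w_def)
  \<comment> \<open>Written with \<open>(- 1) *\<close> so that the closure rules for sums and
    products prove its smoothness.\<close>
  define g where "g z = 4 * F z + (- 1) * (lam z * w z)" for z
  define h where "h z = norm_sq K \<phi> z * w z" for z
  have smooth: "smooth_on UNIV g" "smooth_on UNIV h"
    unfolding g_def[abs_def] h_def[abs_def] w_def[abs_def] F_def[abs_def]
    by (intro smooth_on_add smooth_on_mult smooth_on_const open_UNIV smooth_on_japanese_powr assms(4)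
        chern_curvature_real_smooth(2)[OF assms(5)] smooth_norm_sq[OF assms(5,2)])+
  have n0: "0 \<le> norm_sq K \<phi> z" for z using norm_sq_nonneg[OF assms(5,2)] .
  \<comment> \<open>Division by \<open>omega k z\<close> turns the contracted curvature minus
    \<open>lam z / 2\<close> into \<open>g z / (2 * w z)\<close>. Both summands are nonnegative, so
    the one hypothesis bounds \<open>g\<close> and \<open>h\<close> separately.\<close>
  have bound: "\<bar>g z\<bar> / (2 * w z) + norm_sq K \<phi> z \<le> \<Lambda> * jap z powr (- l)" for z
  proof -
    have "\<i> * Lambda_omega k (chern_curvature L K) z - of_real (lam z) / 2 = of_real (g z / (2 * w z))"
      using w[of z] unfolding Lambda_omega_def omega_def F g_def w_def[symmetric] by (simp add: field_simps)
    then have "cmod (\<i> * Lambda_omega k (chern_curvature L K) z - of_real (lam z) / 2) = \<bar>g z\<bar> / (2 * w z)"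
      using w[of z] by (simp only: norm_of_real) simp
    then show ?thesis using assms(10)[of z] by simp
  qed
  have w_powr: "w z * jap z powr (- l) = jap z powr (- (l - k))" for z
    by (simp add: w_def powr_add[symmetric])
  have g_le: "\<bar>g z\<bar> \<le> 2 * \<Lambda> * jap z powr (- (l - k))" for z
  proof -
    have "\<bar>g z\<bar> / (2 * w z) \<le> \<Lambda> * jap z powr (- l)" using bound[of z] n0[of z] by linarith
    then have "\<bar>g z\<bar> \<le> \<Lambda> * jap z powr (- l) * (2 * w z)" using w[of z] by (simp add: pos_divide_le_eq)
    then show ?thesis unfolding w_powr[symmetric] by (simp add: mult_ac)
  qed
  have h_le: "h z \<le> 2 * \<Lambda> * jap z powr (- (l - k))" for z
  proof -
    have "0 \<le> \<bar>g z\<bar> / (2 * w z)" using w[of z] by simp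
    then have "norm_sq K \<phi> z \<le> \<Lambda> * jap z powr (- l)" using bound[of z] by linarith
    then have "h z \<le> \<Lambda> * jap z powr (- l) * w z"
      unfolding h_def using w[of z] by (intro mult_right_mono) auto
    \<comment> \<open>Nonnegativity allows the constant to be doubled, so that \<open>g\<close> and
      \<open>h\<close> share the constant \<open>2 * \<Lambda>\<close>.\<close>
    moreover have "0 \<le> \<Lambda> * jap z powr (- l) * w z"
      using calculation n0[of z] w[of z] unfolding h_def by (meson mult_nonneg_nonneg order_less_imp_le order_trans)
    ultimately show ?thesis unfolding w_powr[symmetric] by (simp add: mult_ac)
  qed
  \<comment> \<open>The factor \<open>- 2 * \<i>\<close> of the area form makes the integrand equal
    to \<open>g\<close>, so the degree hypothesis becomes a sign of the integral of
    \<open>g\<close>.\<close>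
  have "integral_2form (\<lambda>z. 2 * \<i> * chern_curvature L K z - of_real (lam z) * omega k z) = of_real (\<integral>z. g z \<partial>lborel)"
  proof -
    have "- 2 * \<i> * (2 * \<i> * chern_curvature L K z - of_real (lam z) * omega k z) = of_real (g z)" for z
      unfolding F omega_def g_def w_def[symmetric] by (simp add: algebra_simps)
    then show ?thesis unfolding integral_2form_def by (simp only: integral_complex_of_real)
  qed
  then have "(\<integral>z. g z \<partial>lborel) \<le> 0" using assms(9) by simp
  \<comment> \<open>The decay exponent is \<open>p = l - k\<close>, which exceeds \<open>1\<close>
    because \<open>k < l - 1\<close>.\<close>
  then obtain f where f: "smooth_on UNIV f" "\<And>z. laplacian f z = g z + h z * exp (f z)"
    using kazdan_warner_plane[OF _ smooth _ g_le h_le] assms(8) n0 w by (auto simp: h_def less_imp_le)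
  show ?thesis
  proof (intro exI[of _ "conformal f K"] conjI allI)
    show "hermitian_structure L (conformal f K)" using assms(5) f(1) by (rule hermitian_conformal)
    show "\<i> * chern_curvature L (conformal f K) z + 1 / 2 * of_real (norm_sq (conformal f K) \<phi> z) * omega k z
        = of_real (lam z) / 2 * omega k z" for z
      unfolding curvature_equation_iff_laplacian[OF assms(5) f(1) assms(2)] f(2)
      by (simp add: g_def h_def F_def w_def)
  qed
qed

end
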